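(* Let $(\Omega,\mathcal{F},\mathbb{P})$ be a nonatomic probability space, let $\mathcal{A}\subset L^\infty$ be a convex, law-invariant acceptance set, and let $1\le p<\infty$. The following statements are equivalent: (a) $\mathcal{R}_\mathcal{A}$ is $p$-robust on $\mathcal{M}_\infty$; (b) $\mathrm{Cl}_p(\mathcal{A})$ has nonempty interior in $L^p$. Moreover, $\mathrm{Index}_{\mathrm{qr}}(\rho_\mathcal{A})=1/\mathrm{Index}_{\mathrm{fin}}(\rho_\mathcal{A})$.
   Context: $L^p=L^p(\Omega,\mathcal{F},\mathbb{P})$ with the a.s. order; an acceptance set in $L^\infty$ is a nonempty proper $\mathcal{A}\subset L^\infty$ with $\mathcal{A}+L^\infty_+\subset\mathcal{A}$; it is law-invariant if $X\in\mathcal{A}$ whenever $X$ has the same law as some element of $\mathcal{A}$. $\mathrm{Cl}_p(\mathcal{A})$ is the closure of $\mathcal{A}$ in $L^p$. The cash-additive risk measure is $\rho_\mathcal{A}(X)=\inf\{m\in\mathbb{R}: X+m\in\mathcal{A}\}$, $X\in L^\infty$ (it is law-invariant). Let $\mathcal{M}_\infty=\{\mathbb{P}_X: X\in L^\infty\}$ be the set of laws of bounded random variables and define $\mathcal{R}_\mathcal{A}:\mathcal{M}_\infty\to\mathbb{R}$ by $\mathcal{R}_\mathcal{A}(\mathbb{P}_X)=\rho_\mathcal{A}(X)$. Let $\mathcal{M}$ be the Borel probability measures on $\mathbb{R}$ and $d_P$ the Prohorov metric. For $\mu\in\mathcal{M}$, let $(\Omega^\mu,\mathcal{F}^\mu,\mathbb{P}^\mu)$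 be a (nonatomic) probability space supporting an i.i.d. sequence $(X_n)$ with common law $\mu$, and let $m^\mu_n(\omega)=\frac1n\sum_{i=1}^n\delta_{X_i(\omega)}$ be the empirical distribution; $\mathcal{R}_\mathcal{A}(m^\mu_n)$ is the random variable $\omega\mapsto\mathcal{R}_\mathcal{A}(m^\mu_n(\omega))$, with law $\mathbb{P}^\mu_{\mathcal{R}_\mathcal{A}(m^\mu_n)}$. Let $\psi_p(x)=\frac1p|x|^p$. A set $\mathcal{N}\subset\mathcal{M}$ is uniformly $p$-integrating if $\lim_{M\to\infty}\sup_{\mu\in\mathcal{N}}\int_{\{\psi_p\ge M\}}\psi_p\,d\mu=0$. $\mathcal{R}_\mathcal{A}$ is $p$-robust on $\mathcal{M}_\infty$ if for every uniformly $p$-integrating $\mathcal{N}\subset\mathcal{M}_\infty$, every $\mu\in\mathcal{N}$ and $\varepsilon>0$ there exist $\delta>0$ and $n_0\in\mathbb{N}$ such that $d_P(\mu,\nu)+|\int\psi_p\,d\mu-\int\psi_p\,d\nu|\le\delta$ with $\nu\in\mathcal{N}$ implies $d_P(\mathbb{P}^\mu_{\mathcal{R}_\mathcal{A}(m^\mu_n)},\mathbb{P}^\nu_{\mathcal{R}_\mathcal{A}(m^\nu_n)})\le\varepsilon$ for all $n\ge n_0$. The index of qualitative robustness is $\mathrm{Index}_{\mathrm{qr}}(\rho_\mathcal{A})=(\inf\{p\in[1,\infty):\mathcal{R}_\mathcal{A}\text{ is }p\text{-robust on }\mathcal{M}_\infty\})^{-1}$ and the index of finiteness is $\mathrm{Index}_{\mathrm{fin}}(\rho_\mathcal{A})=\inf\{p\in[1,\infty):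 \mathrm{Cl}_p(\mathcal{A})\text{ has nonempty interior in }L^p\}$, with $\inf\emptyset=\infty$ and $1/\infty=0$. *)

theory Defs
  imports "HOL-Probability.Probability"
begin

text \<open>Random variables are represented by functions; elements of L^p are
  identified with their representatives. All notions below are invariant
  under a.s. equality of representatives.\<close>

definition nonatomic :: "'a measure \<Rightarrow> bool" where
  "nonatomic M \<longleftrightarrow> (\<forall>S\<in>sets M. measure M S > 0 \<longrightarrow>
      (\<exists>B\<in>sets M. B \<subseteq> S \<and> 0 < measure M B \<and> measure M B < measure M S))"

definition Linf :: "'a measure \<Rightarrow> ('a \<Rightarrow> real) set" where
  "Linf M = {X \<in> borel_measurable M. \<exists>C. AE \<omega> in M. \<bar>X \<omega>\<bar> \<le> C}"

definition Lp :: "'a measure \<Rightarrow> real \<Rightarrow> ('a \<Rightarrow> real) set" where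
  "Lp M p = {X \<in> borel_measurable M. integrable M (\<lambda>\<omega>. \<bar>X \<omega>\<bar> powr p)}"

definition Lp_dist :: "'a measure \<Rightarrow> real \<Rightarrow> ('a \<Rightarrow> real) \<Rightarrow> ('a \<Rightarrow> real) \<Rightarrow> real" where
  "Lp_dist M p X Y = (\<integral>\<omega>. \<bar>X \<omega> - Y \<omega>\<bar> powr p \<partial>M) powr (1 / p)"

definition Clp :: "'a measure \<Rightarrow> real \<Rightarrow> ('a \<Rightarrow> real) set \<Rightarrow> ('a \<Rightarrow> real) set" where
  "Clp M p A = {X \<in> Lp M p. \<forall>\<epsilon>>0. \<exists>Y\<in>A. Lp_dist M p X Y < \<epsilon>}"

definition Lp_nonempty_interior :: "'a measure \<Rightarrow> real \<Rightarrow> ('a \<Rightarrow> real) set \<Rightarrow> bool" where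
  "Lp_nonempty_interior M p S \<longleftrightarrow>
     (\<exists>X\<in>Lp M p. \<exists>r>0. {Y \<in> Lp M p. Lp_dist M p X Y < r} \<subseteq> S)"

definition acceptance_set :: "'a measure \<Rightarrow> ('a \<Rightarrow> real) set \<Rightarrow> bool" where
  "acceptance_set M A \<longleftrightarrow> A \<subseteq> Linf M \<and> A \<noteq> {} \<and> A \<noteq> Linf M \<and>
     (\<forall>X\<in>A. \<forall>Y\<in>Linf M. (AE \<omega> in M. 0 \<le> Y \<omega>) \<longrightarrow> (\<lambda>\<omega>. X \<omega> + Y \<omega>) \<in> A)"

definition law_invariant :: "'a measure \<Rightarrow> ('a \<Rightarrow> real) set \<Rightarrow> bool" where
  "law_invariant M A \<longleftrightarrow>
     (\<forall>X\<in>Linf M. \<forall>Y\<in>A. distr M borel X = distr M borel Y \<longrightarrow> X \<in> A)"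

definition convex_fset :: "('a \<Rightarrow> real) set \<Rightarrow> bool" where
  "convex_fset A \<longleftrightarrow>
     (\<forall>X\<in>A. \<forall>Y\<in>A. \<forall>t::real. 0 \<le> t \<and> t \<le> 1 \<longrightarrow> (\<lambda>\<omega>. t * X \<omega> + (1 - t) * Y \<omega>) \<in> A)"

definition rho :: "('a \<Rightarrow> real) set \<Rightarrow> ('a \<Rightarrow> real) \<Rightarrow> real" where
  "rho A X = Inf {m::real. (\<lambda>\<omega>. X \<omega> + m) \<in> A}"

definition laws_inf :: "'a measure \<Rightarrow> real measure set" where
  "laws_inf M = {distr M borel X | X. X \<in> Linf M}"

definition RA :: "'a measure \<Rightarrow> ('a \<Rightarrow> real) set \<Rightarrow> real measure \<Rightarrow> real" where
  "RA M A \<mu> = rho A (SOME X. X \<in> Linf M \<and> distr M borel X = \<mu>)"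

definition prohorov :: "real measure \<Rightarrow> real measure \<Rightarrow> real" where
  "prohorov \<mu> \<nu> = Inf {\<epsilon>::real. \<epsilon> > 0 \<and> (\<forall>B\<in>sets borel.
      measure \<mu> B \<le> measure \<nu> {x. \<exists>y\<in>B. dist x y < \<epsilon>} + \<epsilon> \<and>
      measure \<nu> B \<le> measure \<mu> {x. \<exists>y\<in>B. dist x y < \<epsilon>} + \<epsilon>)}"

definition psi :: "real \<Rightarrow> real \<Rightarrow> real" where
  "psi p x = \<bar>x\<bar> powr p / p"

definition empirical :: "nat \<Rightarrow> (nat \<Rightarrow> real) \<Rightarrow> real measure" where
  "empirical n x = distr (measure_pmf (pmf_of_set {..<n})) borel x"

definition sample_law :: "'a measure \<Rightarrow> ('a \<Rightarrow> real) set \<Rightarrow> real measure \<Rightarrow> nat \<Rightarrow> real measure" where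
  "sample_law M A \<mu> n = distr (PiM {..<n} (\<lambda>_. \<mu>)) borel (\<lambda>x. RA M A (empirical n x))"

definition unif_p_integrating :: "real \<Rightarrow> real measure set \<Rightarrow> bool" where
  "unif_p_integrating p N \<longleftrightarrow>
     ((\<lambda>c::real. SUP \<mu>\<in>N. \<integral>\<^sup>+ x. indicator {x. psi p x \<ge> c} x * ennreal (psi p x) \<partial>\<mu>)
        \<longlongrightarrow> 0) at_top"

definition p_robust :: "'a measure \<Rightarrow> ('a \<Rightarrow> real) set \<Rightarrow> real \<Rightarrow> bool" where
  "p_robust M A p \<longleftrightarrow>
     (\<forall>N. N \<subseteq> laws_inf M \<and> unif_p_integrating p N \<longrightarrow>
        (\<forall>\<mu>\<in>N. \<forall>\<epsilon>>0. \<exists>\<delta>>0. \<exists>n0::nat. \<forall>\<nu>\<in>N.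
           prohorov \<mu> \<nu> + \<bar>(\<integral>x. psi p x \<partial>\<mu>) - (\<integral>x. psi p x \<partial>\<nu>)\<bar> \<le> \<delta> \<longrightarrow>
           (\<forall>n\<ge>n0. n > 0 \<longrightarrow> prohorov (sample_law M A \<mu> n) (sample_law M A \<nu> n) \<le> \<epsilon>)))"

definition Index_qr :: "'a measure \<Rightarrow> ('a \<Rightarrow> real) set \<Rightarrow> ereal" where
  "Index_qr M A = 1 / Inf {ereal p | p. 1 \<le> p \<and> p_robust M A p}"

definition Index_fin :: "'a measure \<Rightarrow> ('a \<Rightarrow> real) set \<Rightarrow> ereal" where
  "Index_fin M A = Inf {ereal p | p. 1 \<le> p \<and> Lp_nonempty_interior M p (Clp M p A)}"


end

theory Submission
  imports Defs
begin

text \<open>Everything rests on one fact about the law-invariant convex set \<open>A\<close>: if elements of \<open>A\<close>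
  approximate a bounded \<open>Z\<close> in \<open>L\<^sup>p\<close>, then \<open>Z + e \<in> A\<close> for every \<open>e > 0\<close>. Indeed averages
  of equidistributed rearrangements replace an element of \<open>A\<close> by its conditional mean over the
  finitely many level sets of a discretised \<open>Z\<close>, and on finitely many events convergence of means
  is uniform convergence.
  Hence \<open>\<rho>\<close> is lower semicontinuous for the \<open>L\<^sup>p\<close> norm on bounded variables, and an
  \<open>L\<^sup>p\<close> ball in the closure of \<open>A\<close> is a ball on which the convex function \<open>\<rho>\<close> is bounded above,
  so that \<open>\<rho>\<close> is continuous.

  For \<open>\<nu>\<close> in a uniformly \<open>p\<close>-integrating set, close to \<open>\<mu>\<close>, the quantile coupling brings the
  empirical measure within small \<open>L\<^sup>p\<close> distance of \<open>\<mu>\<close> with high probability, uniformly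
  in \<open>\<nu>\<close> (Hoeffding on a finite grid, Markov for the tails); continuity then gives robustness.
  Conversely, if the interior is empty, there are bounded \<open>W\<^sub>k\<close> tending to 0 in \<open>L\<^sup>p\<close> with
  \<open>\<rho>(W\<^sub>k) > \<rho>(0) + 1\<close>; by lower semicontinuity the empirical risk under \<open>W\<^sub>k\<close> exceeds
  \<open>\<rho>(0) + 1\<close> with high probability, which contradicts robustness at the point mass at 0.\<close>

section \<open>Uniform variables on nonatomic spaces\<close>

text \<open>\<open>A\<close> is not assumed closed and \<open>rho\<close> sees only bounded
  variables. Limits are therefore absorbed by an arbitrarily small cash amount \<open>e\<close>, and
  unbounded members of an L^p ball are reached by truncation. Lower semicontinuity does not involve
  the interior of the closure, so it is still at hand when that interior is empty; the ball enters
  only in the upper half.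

  Samples live on product spaces unrelated to \<open>M\<close>. A single uniform variable
  \<open>V\<close> on \<open>M\<close> bridges the gap: \<open>quantile \<nu> (V \<omega>)\<close>
  realises all the laws on \<open>M\<close> at once, and L^p distances become integrals over the
  unit interval. Used under the conditional measure of an event, the same device supplies the
  rearrangements. Both uses rest on the intermediate value property of nonatomic measures.

  Robustness requires the radius and the sample size to be fixed before \<open>\<nu>\<close>.
  Hoeffding bounds do not depend on the law but control only finitely many values of the cdf;
  uniform integrability determines how far the grid must reach, and Markov's inequality controls the
  rest for every sample size.\<close>

lemma (in prob_space) nonatomic_small_subset:
  assumes na: "nonatomic M" and S: "S \<in> sets M" "prob S > 0" and e: "0 < (e::real)"
  shows "\<exists>B\<in>sets M. B \<subseteq> S \<and> 0 < prob B \<and> prob B < e"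
proof -
  have halve: "\<exists>B\<in>sets M. B \<subseteq> S \<and> 0 < prob B \<and> prob B \<le> prob S / 2^n" for n
  proof (induction n)
    case 0
    then show ?case using S by auto
  next
    case (Suc n)
    then obtain B where B: "B \<in> sets M" "B \<subseteq> S" "0 < prob B" "prob B \<le> prob S / 2^n" by auto
    then obtain C where C: "C \<in> sets M" "C \<subseteq> B" "0 < prob C" "prob C < prob B"
      using na unfolding nonatomic_def by blast
    have D: "prob (B - C) = prob B - prob C"
      using B C by (intro finite_measure_Diff) auto
    show ?case
    \<comment> \<open>\<open>C\<close> and \<open>B - C\<close> both have positive probability, and
      one of them has at most half the probability of \<open>B\<close>.\<close>
    proof (cases "prob C \<le> prob B / 2")
      case True
      moreover have "prob B / 2 \<le> prob S / 2^Suc n" using B by simp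
      ultimately show ?thesis using B C by (intro bexI[of _ C]) auto
    next
      case False
      moreover have "prob B / 2 \<le> prob S / 2^Suc n" using B by simp
      ultimately show ?thesis using B C D by (intro bexI[of _ "B - C"]) auto
    qed
  qed
  obtain n where "prob S / e < 2^n"
    using real_arch_pow[of 2 "prob S / e"] by auto
  then have "prob S / 2^n < e" using e by (simp add: field_simps)
  then show ?thesis using halve[of n] by (meson le_less_trans)
qed

text \<open>Sierpinski's theorem by greedy exhaustion: each step adds a set worth at least half of
  \<open>s\<close>, the supremum of what fits without exceeding \<open>a\<close>. If the union
  stayed below \<open>a\<close>, one small set \<open>C\<close> outside it would be admissible at
  every stage, so every step would gain at least \<open>prob C / 2\<close>, which is
  impossible.\<close>

theorem (in prob_space) nonatomic_intermediate_value:
  assumes na: "nonatomic M" and S: "S \<in> sets M" and a: "0 \<le> a" "a \<le> prob S"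
  shows "\<exists>B\<in>sets M. B \<subseteq> S \<and> prob B = a"
proof -
  define F where "F B = {C \<in> sets M. C \<subseteq> S - B \<and> prob B + prob C \<le> a}" for B
  define s where "s B = (SUP C\<in>F B. prob C)" for B
  have bdd: "bdd_above (prob ` F B)" for B by (intro bdd_aboveI[of _ 1]) auto
  have step: "\<exists>B'. (B' \<in> sets M \<and> B' \<subseteq> S \<and> prob B' \<le> a) \<and> B \<subseteq> B' \<and> prob B' \<ge> prob B + s B / 2"
    if B: "B \<in> sets M \<and> B \<subseteq> S \<and> prob B \<le> a" for B
  proof -
    have ne: "{} \<in> F B" using B by (auto simp: F_def)
    have "\<exists>C\<in>F B. prob C \<ge> s B / 2"
    proof (cases "s B > 0")
      case True
      then have "s B / 2 < (SUP C\<in>F B. prob C)" by (simp add: s_def)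
      then have "\<exists>C\<in>F B. s B / 2 < prob C" 
        using iffD1[OF less_cSUP_iff[OF _ bdd]] ne by (metis empty_iff)
      then show ?thesis by (auto intro: less_imp_le)
    qed (use ne in \<open>auto intro!: bexI[of _ "{}"]\<close>)
    then obtain C where C: "C \<in> F B" "prob C \<ge> s B / 2" by auto
    have "prob (B \<union> C) = prob B + prob C"
      using B C by (intro finite_measure_Union) (auto simp: F_def)
    then show ?thesis using B C by (intro exI[of _ "B \<union> C"]) (auto simp: F_def)
  qed
  have "\<exists>f. \<forall>n. (f n \<in> sets M \<and> f n \<subseteq> S \<and> prob (f n) \<le> a) \<and>
      (f n \<subseteq> f (Suc n) \<and> prob (f (Suc n)) \<ge> prob (f n) + s (f n) / 2)"
    by (rule dependent_nat_choice) (use S a step in \<open>auto intro: exI[of _ "{}"]\<close>)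
  then obtain f where f: "\<And>n. f n \<in> sets M" "\<And>n. f n \<subseteq> S" "\<And>n. prob (f n) \<le> a"
    "\<And>n. f n \<subseteq> f (Suc n)" "\<And>n. prob (f (Suc n)) \<ge> prob (f n) + s (f n) / 2" by auto
  define B where "B = (\<Union>n. f n)"
  have inc: "incseq f" by (rule incseq_SucI) (rule f)
  have lim: "(\<lambda>n. prob (f n)) \<longlonglongrightarrow> prob B"
    unfolding B_def by (rule finite_Lim_measure_incseq) (use f inc in auto)
  have B: "B \<in> sets M" "B \<subseteq> S" using f by (auto simp: B_def)
  have le: "prob B \<le> a" using f(3) by (intro LIMSEQ_le_const2[OF lim]) auto
  have "prob B = a"
  proof (rule ccontr)
    assume "prob B \<noteq> a"
    then have lt: "prob B < a" using le by auto
    have "prob (S - B) = prob S - prob B" using B S by (intro finite_measure_Diff) auto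
    then have "prob (S - B) > 0" using lt a by auto
    then obtain C where C: "C \<in> sets M" "C \<subseteq> S - B" "0 < prob C" "prob C < a - prob B"
      using nonatomic_small_subset[OF na, of "S - B" "a - prob B"] lt B S by auto
    have "prob (f n) \<le> prob B" for n
      using f B by (intro finite_measure_mono) (auto simp: B_def)
    then have CF: "C \<in> F (f n)" for n
      unfolding F_def using C by (auto simp: B_def) (smt (verit, best))
    have sC: "s (f n) \<ge> prob C" for n
      unfolding s_def by (rule cSUP_upper[OF CF bdd])
    have grow: "prob (f n) \<ge> real n * (prob C / 2)" for n
    proof (induction n)
      case (Suc n)
      then show ?case using f(5)[of n] sC[of n] by (simp add: field_simps)
    qed simp
    have "0 < prob C / 2" using C by simp
    then obtain n where "real n * (prob C / 2) > 1" using reals_Archimedean3 by blast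
    then show False using grow[of n] prob_le_1[of "f n"] by linarith
  qed
  then show ?thesis using B by auto
qed

text \<open>The open interval keeps quantiles finite: at level 0 the set of \<open>x\<close> with
  \<open>0 \<le> cdf \<mu> x\<close> is the whole line, and at level 1 the corresponding set may be
  empty.\<close>

abbreviation Uni :: "real measure" where
  "Uni \<equiv> restrict_space lborel {0<..<1}"

lemma prob_space_Uni: "prob_space Uni"
  by (auto simp: space_restrict_space emeasure_restrict_space intro!: prob_spaceI)

lemma space_Uni [simp]: "space Uni = {0<..<1}"
  by (simp add: space_restrict_space)

lemma cdf_Uni:
  assumes "0 \<le> t" "t \<le> 1"
  shows "cdf (distr Uni borel (\<lambda>x. x)) t = t"
proof -
  have m: "(\<lambda>x. x) \<in> borel_measurable Uni"
    by (intro measurable_restrict_space1) simp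
  have "cdf (distr Uni borel (\<lambda>x. x)) t = measure Uni ({..t} \<inter> {0<..<1})"
    unfolding cdf_def by (subst measure_distr[OF m]) auto
  also have "\<dots> = measure lborel ({..t} \<inter> {0<..<1})"
    by (subst measure_restrict_space) auto
  also have "\<dots> = measure lborel {0<..<t}"
    unfolding measure_def using AE_lborel_singleton[of t] assms
    by (intro arg_cong[where f = enn2real] emeasure_eq_AE) auto
  finally show ?thesis using assms by simp
qed

text \<open>A uniform variable arises as $U(\omega) = \inf \{k/2^n : \omega \in F_n(k)\}$ from
  a dyadic chain of events with $P(F_n(k)) = k/2^n$, refined by bisection.\<close>

lemma (in prob_space) nonatomic_uniform_cdf:
  assumes na: "nonatomic M"
  shows "\<exists>U\<in>borel_measurable M. \<forall>t\<in>{0..1}. prob {\<omega>\<in>space M. U \<omega> \<le> t} = t"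
proof -
  define P where "P n f \<longleftrightarrow> (\<forall>k\<le>2^n. f k \<in> sets M \<and> prob (f k) = real k / 2^n) \<and>
      (\<forall>k\<le>2^n. \<forall>l\<le>k. f l \<subseteq> f k) \<and> f (2^n) = space M" for n :: nat and f :: "nat \<Rightarrow> 'a set"
  have step: "\<exists>g. P (Suc n) g \<and> (\<forall>k\<le>2^n. g (2*k) = f k)" if Pf: "P n f" for n f
  proof -
    have fk: "f k \<in> sets M" "prob (f k) = real k / 2^n" if "k \<le> 2^n" for k using Pf that by (auto simp: P_def)
    have fm: "f l \<subseteq> f k" if "l \<le> k" "k \<le> 2^n" for k l using Pf that by (auto simp: P_def)
    have "\<exists>B\<in>sets M. B \<subseteq> f (Suc k) - f k \<and> prob B = 1 / 2^Suc n" if k: "k < 2^n" for k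
    proof (rule nonatomic_intermediate_value[OF na])
      have "prob (f (Suc k) - f k) = prob (f (Suc k)) - prob (f k)"
        using fk fm k by (intro finite_measure_Diff) auto
      then show "1 / 2^Suc n \<le> prob (f (Suc k) - f k)"
        using fk[of k] fk[of "Suc k"] k by (simp add: field_simps)
    qed (use fk k in auto)
    then obtain h where h: "\<And>k. k < 2^n \<Longrightarrow> h k \<in> sets M"
       "\<And>k. k < 2^n \<Longrightarrow> h k \<subseteq> f (Suc k) - f k" "\<And>k. k < 2^n \<Longrightarrow> prob (h k) = 1 / 2^Suc n"
      by metis
    \<comment> \<open>Even indices keep the old events; an odd index inserts half of the gap between
      two neighbours.\<close>
    define g where "g k = (if even k then f (k div 2) else f (k div 2) \<union> h (k div 2))" for k
    have g1: "g k \<in> sets M \<and> prob (g k) = real k / 2^Suc n" if "k \<le> 2^Suc n" for k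
    proof (cases "even k")
      case True
      then obtain j where "k = 2 * j" by auto
      then show ?thesis using that fk[of j] by (auto simp: g_def)
    next
      case False
      then obtain j where j: "k = 2 * j + 1" by (auto elim: oddE)
      then have jn: "j < 2^n" using that by auto
      have "prob (f j \<union> h j) = prob (f j) + prob (h j)"
        using jn fk h by (intro finite_measure_Union) fastforce+
      then show ?thesis using j jn fk[of j] h[of j] by (auto simp: g_def field_simps)
    qed
    have g2: "g k \<subseteq> g (Suc k)" if "Suc k \<le> 2^Suc n" for k
    proof (cases "even k")
      case True
      then show ?thesis by (auto simp: g_def)
    next
      case False
      then obtain j where j: "k = 2 * j + 1" by (auto elim: oddE)
      then have "j < 2^n" using that by auto
      then show ?thesis using j fm[of j "Suc j"] h[of j] by (auto simp: g_def)
    qed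
    have g3: "g l \<subseteq> g k" if "l \<le> k" "k \<le> 2^Suc n" for k l
      using that
    proof (induction k rule: dec_induct)
      case (step k)
      then show ?case using g2[of k] by auto
    qed auto
    show ?thesis
      using g1 g3 Pf by (intro exI[of _ g]) (auto simp: P_def g_def)
  qed
  have "\<exists>F. \<forall>n. P n (F n) \<and> (\<forall>k\<le>2^n. F (Suc n) (2*k) = F n k)"
  proof (rule dependent_nat_choice)
    show "\<exists>f. P 0 f"
      by (intro exI[of _ "\<lambda>k. if k = 0 then {} else space M"])
         (auto simp: P_def prob_space le_Suc_eq)
  qed (use step in auto)
  then obtain F where F: "\<And>n. P n (F n)" and F2: "\<And>n k. k \<le> 2^n \<Longrightarrow> F (Suc n) (2*k) = F n k" by auto
  have FS: "F n k \<in> sets M" "prob (F n k) = real k / 2^n" if "k \<le> 2^n" for n k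
    using F[of n] that by (auto simp: P_def)
  have shift: "F (n + d) (2^d * k) = F n k" if "k \<le> 2^n" for n d k
  proof (induction d)
    case (Suc d)
    have "2^d * k \<le> 2^(n+d)" using that by (simp add: power_add)
    then show ?case using Suc F2[of "2^d*k" "n+d"] by (simp add: mult.assoc)
  qed simp
  \<comment> \<open>Events of different levels are compared at the common level \<open>m+n\<close>,
    where \<open>shift\<close> identifies them with members of one chain.\<close>
  have chain: "F m j \<subseteq> F n k" if jk: "real j / 2^m \<le> real k / 2^n" "j \<le> 2^m" "k \<le> 2^n" for m j n k
  proof -
    have a: "F m j = F (m+n) (2^n * j)" "F n k = F (m+n) (2^m * k)"
      using shift[of j m n] shift[of k n m] jk by (auto simp: add.commute)
    have "real (2^n * j) \<le> real (2^m * k)" using jk(1) by (simp add: field_simps)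
    then have "2^n * j \<le> 2^m * k" by (simp only: of_nat_le_iff)
    moreover have "2^m * k \<le> 2^(m+n)" using jk by (simp add: power_add)
    ultimately show ?thesis unfolding a using F[of "m+n"] by (simp add: P_def)
  qed
  define D where "D = {(n,k). k \<le> (2::nat)^n}"
  define q where "q = (\<lambda>(n,k). real k / 2^n)" 
  define G where "G = (\<lambda>(n,k). F n k)"
  define U where "U \<omega> = Inf (q ` {d\<in>D. \<omega> \<in> G d})" for \<omega>
  have GD: "G d \<in> sets M" "prob (G d) = q d" "q d \<ge> 0" if "d \<in> D" for d using that FS by (auto simp: G_def q_def D_def)
  have GM: "G c \<subseteq> G d" if "c \<in> D" "d \<in> D" "q c \<le> q d" for c d
    using that chain by (auto simp: G_def D_def q_def split: prod.splits)
  have bdd: "bdd_below (q ` {d\<in>D. \<omega> \<in> G d})" for \<omega> by (rule bdd_belowI[of _ 0]) (use GD in auto)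
  have ne: "{d\<in>D. \<omega> \<in> G d} \<noteq> {}" if "\<omega> \<in> space M" for \<omega>
  proof -
    have "(0, 1) \<in> {d\<in>D. \<omega> \<in> G d}" using that F[of 0] by (auto simp: D_def G_def P_def)
    then show ?thesis by blast
  qed
  have U_less: "U \<omega> < t \<longleftrightarrow> (\<exists>d\<in>D. \<omega> \<in> G d \<and> q d < t)" if "\<omega> \<in> space M" for \<omega> t
    unfolding U_def using cInf_less_iff[OF _ bdd, of \<omega> t] ne[OF that] by auto
  have U_meas [measurable]: "U \<in> borel_measurable M"
  proof (rule borel_measurableI_less)
    fix t
    have "{\<omega>\<in>space M. U \<omega> < t} = (\<Union>d\<in>{d\<in>D. q d < t}. G d)"
      using U_less GD(1) sets.sets_into_space by fastforce
    also have "\<dots> \<in> sets M" 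
      by (intro sets.countable_UN') (use GD(1) in auto)
    finally show "{\<omega>\<in>space M. U \<omega> < t} \<in> sets M" .
  qed
  have dense: "\<exists>d\<in>D. a < q d \<and> q d < b" if "0 \<le> a" "a < b" "b \<le> 1" for a b :: real
  proof -
    obtain n where n: "2^n > 1 / (b - a)" using real_arch_pow[of 2 "1/(b-a)"] by auto
    \<comment> \<open>The first dyadic strictly above \<open>a\<close>; it lies below
      \<open>b\<close> because the mesh is less than \<open>b - a\<close>.\<close>
    define k where "k = nat \<lfloor>a * 2^n\<rfloor> + 1"
    have k: "real k = real_of_int \<lfloor>a * 2^n\<rfloor> + 1" using that by (simp add: k_def)
    have "a * 2^n < k" "k \<le> a * 2^n + 1" unfolding k by linarith+
    moreover have "a * 2^n + 1 < b * 2^n" using n that by (simp add: field_simps)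
    ultimately have "a * 2^n < k" "k < b * 2^n" by linarith+
    moreover from this have "real k \<le> 2^n" using that
      by (smt (verit, best) mult_left_le_one_le zero_le_power)
    then have "k \<le> 2^n" by (metis of_nat_le_iff of_nat_numeral of_nat_power)
    ultimately show ?thesis by (intro bexI[of _ "(n,k)"]) (auto simp: D_def q_def field_simps)
  qed
  \<comment> \<open>The event is squeezed between events \<open>G d\<close> with \<open>q d\<close>
    just below and just above \<open>t\<close>; density of the dyadics gives the exact value. At
    \<open>t = 0\<close> and \<open>t = 1\<close> one of the two bounds is trivial.\<close>
  have "prob {\<omega>\<in>space M. U \<omega> \<le> t} = t" if t: "t \<in> {0..1}" for t
  proof (rule antisym)
    show "prob {\<omega>\<in>space M. U \<omega> \<le> t} \<le> t"
    proof (cases "t = 1")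
      case False
      show ?thesis
      proof (rule dense_ge_bounded)
        show "t < 1" using t False by auto
        fix w assume w: "t < w" "w < 1"
        then obtain d where d: "d \<in> D" "t < q d" "q d < w" using dense[of t w] t by auto
        have "{\<omega>\<in>space M. U \<omega> \<le> t} \<subseteq> G d"
        proof safe
          fix \<omega> assume w: "\<omega> \<in> space M" "U \<omega> \<le> t"
          then have "U \<omega> < q d" using d by auto
          then obtain c where "c \<in> D" "\<omega> \<in> G c" "q c < q d" using U_less[OF w(1)] by auto
          then show "\<omega> \<in> G d" using GM[of c d] d by auto
        qed
        then have "prob {\<omega>\<in>space M. U \<omega> \<le> t} \<le> prob (G d)" using GD d by (intro finite_measure_mono) auto
        then show "prob {\<omega>\<in>space M. U \<omega> \<le> t} \<le> w" using GD d by auto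
      qed
    qed auto
    show "t \<le> prob {\<omega>\<in>space M. U \<omega> \<le> t}"
    proof (cases "t = 0")
      case False
      show ?thesis
      proof (rule dense_le_bounded)
        show "0 < t" using t False by auto
        fix w assume w: "0 < w" "w < t"
        then obtain d where d: "d \<in> D" "w < q d" "q d < t" using dense[of w t] t by auto
        have "G d \<subseteq> {\<omega>\<in>space M. U \<omega> \<le> t}"
          using U_less[of _ t] d GD(1)[OF d(1)] sets.sets_into_space by fastforce
        then have "prob (G d) \<le> prob {\<omega>\<in>space M. U \<omega> \<le> t}" by (intro finite_measure_mono) auto
        then show "w \<le> prob {\<omega>\<in>space M. U \<omega> \<le> t}" using GD d by auto
      qed
    qed auto
  qed
  then show ?thesis using U_meas by (intro bexI[of _ U]) auto
qed

theorem (in prob_space) nonatomic_uniform: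
  assumes na: "nonatomic M"
  shows "\<exists>U\<in>measurable M Uni. distr M Uni U = Uni"
proof -
  obtain U where U [measurable]: "U \<in> borel_measurable M"
    and Ut: "\<And>t. t \<in> {0..1} \<Longrightarrow> prob {\<omega>\<in>space M. U \<omega> \<le> t} = t"
    using nonatomic_uniform_cdf[OF na] by auto
  interpret Uni: prob_space Uni by (rule prob_space_Uni)
  have idm: "(\<lambda>x. x) \<in> borel_measurable Uni"
    by (intro measurable_restrict_space1) simp
  interpret D1: real_distribution "distr M borel U" by simp
  interpret D2: real_distribution "distr Uni borel (\<lambda>x. x)" using idm by (rule Uni.real_distribution_distr)
  have c1: "cdf (distr M borel U) t = t" if "t \<in> {0..1}" for t
    using Ut[OF that] unfolding cdf_def by (simp add: measure_distr vimage_def Int_def conj_commute)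
  have "cdf (distr M borel U) t = cdf (distr Uni borel (\<lambda>x. x)) t" for t
  proof -
    consider "t < 0" | "t \<in> {0..1}" | "t > 1" by fastforce
    then show ?thesis
    proof cases
      case 1
      then show ?thesis using D1.cdf_nondecreasing[of t 0] D2.cdf_nondecreasing[of t 0] c1[of 0] cdf_Uni[of 0]
          D1.cdf_nonneg[of t] D2.cdf_nonneg[of t] by simp
    next
      case 2
      then show ?thesis using c1 cdf_Uni by simp
    next
      case 3
      then show ?thesis using D1.cdf_nondecreasing[of 1 t] D2.cdf_nondecreasing[of 1 t] c1[of 1] cdf_Uni[of 1]
          D1.cdf_bounded_prob[of t] D2.cdf_bounded_prob[of t] by simp
    qed
  qed
  then have eq: "distr M borel U = distr Uni borel (\<lambda>x. x)"
    by (intro cdf_unique) (auto intro: D1.real_distribution_axioms D2.real_distribution_axioms)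
  have eS: "emeasure M (U -` S \<inter> space M) = emeasure Uni S" if "S \<in> sets borel" "S \<subseteq> {0<..<1}" for S
  proof -
    have "emeasure (distr M borel U) S = emeasure (distr Uni borel (\<lambda>x. x)) S" by (simp add: eq)
    moreover have "emeasure (distr Uni borel (\<lambda>x. x)) S = emeasure Uni (S \<inter> space Uni)"
      using that by (subst emeasure_distr[OF idm]) auto
    moreover have "S \<inter> space Uni = S" using that by auto
    ultimately show ?thesis using that by (simp add: emeasure_distr)
  qed
  \<comment> \<open>\<open>U\<close> may leave the open interval on a null set. The default 1/2
    makes \<open>V\<close> a map into \<open>Uni\<close> everywhere.\<close>
  define V where "V \<omega> = (if U \<omega> \<in> {0<..<1} then U \<omega> else 1/2)" for \<omega>
  have V [measurable]: "V \<in> borel_measurable M" unfolding V_def by measurable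
  have VU: "V \<in> measurable M Uni"
    by (rule measurable_restrict_space2) (auto simp: V_def)
  have "AE \<omega> in M. U \<omega> \<in> {0<..<1}"
  proof -
    have "emeasure M {\<omega>\<in>space M. U \<omega> \<in> {0<..<1}} = 1"
      using eS[of "{0<..<1}"] Uni.emeasure_space_1 by (simp add: vimage_def Int_def conj_commute)
    then show ?thesis
      by (subst prob_Collect_eq_1[symmetric]) (auto simp: measure_def)
  qed
  then have ae: "AE \<omega> in M. V \<omega> = U \<omega>" by eventually_elim (auto simp: V_def)
  have "distr M Uni V = Uni"
  proof (rule measure_eqI)
    fix S assume "S \<in> sets (distr M Uni V)"
    then have S: "S \<in> sets borel" "S \<subseteq> {0<..<1}" "S \<in> sets Uni" by (auto simp: sets_restrict_space_iff)
    have "emeasure (distr M Uni V) S = emeasure M (V -` S \<inter> space M)"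
      using VU S by (simp add: emeasure_distr)
    also have "\<dots> = emeasure M (U -` S \<inter> space M)"
      using ae S(1) by (intro emeasure_eq_AE) (auto intro: measurable_sets)
    finally show "emeasure (distr M Uni V) S = emeasure Uni S" using eS S by simp
  qed simp
  then show ?thesis using VU by auto
qed

section \<open>Convex law-invariant acceptance sets\<close>

lemma LinfI: "X \<in> borel_measurable M \<Longrightarrow> AE \<omega> in M. \<bar>X \<omega>\<bar> \<le> C \<Longrightarrow> X \<in> Linf M"
  by (auto simp: Linf_def)

lemma LinfE:
  assumes "X \<in> Linf M"
  obtains C where "0 \<le> C" "X \<in> borel_measurable M" "AE \<omega> in M. \<bar>X \<omega>\<bar> \<le> C"
proof -
  obtain C where C: "X \<in> borel_measurable M" "AE \<omega> in M. \<bar>X \<omega>\<bar> \<le> C"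
    using assms by (auto simp: Linf_def)
  show ?thesis by (rule that[of "\<bar>C\<bar>"]) (use C in auto)
qed

lemma Linf_measurable: "X \<in> Linf M \<Longrightarrow> X \<in> borel_measurable M"
  by (auto simp: Linf_def)

lemma Linf_affine:
  assumes X: "X \<in> Linf M" and Y: "Y \<in> Linf M"
  shows "(\<lambda>\<omega>. a * X \<omega> + b * Y \<omega> + c) \<in> Linf M"
proof -
  obtain C where C: "AE \<omega> in M. \<bar>X \<omega>\<bar> \<le> C" using X by (rule LinfE)
  obtain D where D: "AE \<omega> in M. \<bar>Y \<omega>\<bar> \<le> D" using Y by (rule LinfE)
  note [measurable] = Linf_measurable[OF X] Linf_measurable[OF Y]
  show ?thesis
  proof (rule LinfI)
    show "AE \<omega> in M. \<bar>a * X \<omega> + b * Y \<omega> + c\<bar> \<le> \<bar>a\<bar> * C + \<bar>b\<bar> * D + \<bar>c\<bar>"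
      using C(1) D(1)
    proof eventually_elim
      case (elim \<omega>)
      have "\<bar>a * X \<omega> + b * Y \<omega> + c\<bar> \<le> \<bar>a\<bar> * \<bar>X \<omega>\<bar> + \<bar>b\<bar> * \<bar>Y \<omega>\<bar> + \<bar>c\<bar>"
        using abs_triangle_ineq[of "a * X \<omega> + b * Y \<omega>" c] abs_triangle_ineq[of "a * X \<omega>" "b * Y \<omega>"]
        by (simp add: abs_mult)
      also have "\<dots> \<le> \<bar>a\<bar> * C + \<bar>b\<bar> * D + \<bar>c\<bar>"
        using elim by (intro add_mono mult_left_mono) auto
      finally show ?case .
    qed
  qed measurable
qed

lemma Linf_const [simp]: "(\<lambda>_. c) \<in> Linf M"
  by (rule LinfI[of _ _ "\<bar>c\<bar>"]) auto

lemma Linf_add: "X \<in> Linf M \<Longrightarrow> Y \<in> Linf M \<Longrightarrow> (\<lambda>\<omega>. X \<omega> + Y \<omega>) \<in> Linf M"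
  using Linf_affine[of X M Y 1 1 0] by simp

lemma Linf_diff: "X \<in> Linf M \<Longrightarrow> Y \<in> Linf M \<Longrightarrow> (\<lambda>\<omega>. X \<omega> - Y \<omega>) \<in> Linf M"
  using Linf_affine[of X M Y 1 "-1" 0] by simp

lemma Linf_cmult: "X \<in> Linf M \<Longrightarrow> (\<lambda>\<omega>. c * X \<omega>) \<in> Linf M"
  using Linf_affine[of X M X c 0 0] by simp

lemma Linf_shift: "X \<in> Linf M \<Longrightarrow> (\<lambda>\<omega>. X \<omega> + c) \<in> Linf M"
  using Linf_affine[of X M X 1 0 c] by simp

lemma Linf_if:
  assumes X: "X \<in> Linf M" and Y: "Y \<in> Linf M" and B: "Measurable.pred M P"
  shows "(\<lambda>\<omega>. if P \<omega> then X \<omega> else Y \<omega>) \<in> Linf M"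
proof -
  obtain C where C: "AE \<omega> in M. \<bar>X \<omega>\<bar> \<le> C" using X by (rule LinfE)
  obtain D where D: "AE \<omega> in M. \<bar>Y \<omega>\<bar> \<le> D" using Y by (rule LinfE)
  note [measurable] = Linf_measurable[OF X] Linf_measurable[OF Y]
  show ?thesis
  proof (rule LinfI)
    show "AE \<omega> in M. \<bar>if P \<omega> then X \<omega> else Y \<omega>\<bar> \<le> max C D"
      using C(1) D(1) by eventually_elim auto
  qed (use B in measurable)
qed

section \<open>Monotonicity, convexity and law invariance of the risk measure\<close>

locale convex_acceptance = prob_space M for M :: "'a measure" +
  fixes A :: "('a \<Rightarrow> real) set"
  assumes nonatomic: "nonatomic M" and acceptance: "acceptance_set M A"
    and convex: "convex_fset A" and law_inv: "law_invariant M A"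
begin

lemma A_Linf: "X \<in> A \<Longrightarrow> X \<in> Linf M"
  using acceptance by (auto simp: acceptance_set_def)

lemma A_mono:
  assumes "X \<in> A" "Y \<in> Linf M" "AE \<omega> in M. X \<omega> \<le> Y \<omega>"
  shows "Y \<in> A"
proof -
  have *: "(\<lambda>\<omega>. Y \<omega> - X \<omega>) \<in> Linf M" using assms A_Linf by (intro Linf_diff) auto
  have "AE \<omega> in M. 0 \<le> Y \<omega> - X \<omega>" using assms(3) by auto
  then have "(\<lambda>\<omega>. X \<omega> + (Y \<omega> - X \<omega>)) \<in> A"
    using acceptance[unfolded acceptance_set_def, THEN conjunct2, THEN conjunct2, THEN conjunct2,
        rule_format, OF assms(1) *] by simp
  then show ?thesis by simp
qed

text \<open>This and the next lemma ensure that \<open>rho\<close> is a genuine infimum, of a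
  nonempty set bounded below. A large shift dominates a member of \<open>A\<close>; a very negative
  one would force a fixed variable outside \<open>A\<close> into it.\<close>

lemma A_shift_nonempty:
  assumes "X \<in> Linf M"
  shows "\<exists>m. (\<lambda>\<omega>. X \<omega> + m) \<in> A"
proof -
  obtain Y where Y: "Y \<in> A" using acceptance by (auto simp: acceptance_set_def)
  obtain C where C: "AE \<omega> in M. \<bar>Y \<omega>\<bar> \<le> C" using A_Linf[OF Y] by (rule LinfE)
  obtain D where D: "AE \<omega> in M. \<bar>X \<omega>\<bar> \<le> D" using assms by (rule LinfE)
  have "AE \<omega> in M. Y \<omega> \<le> X \<omega> + (C + D)" using C D by eventually_elim auto
  then show ?thesis using A_mono[OF Y] Linf_shift[OF assms] by blast
qed

lemma A_shift_bdd_below: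
  assumes "X \<in> Linf M"
  shows "bdd_below {m. (\<lambda>\<omega>. X \<omega> + m) \<in> A}"
proof -
  obtain Y where Y: "Y \<in> Linf M" "Y \<notin> A" using acceptance by (auto simp: acceptance_set_def)
  obtain C where C: "AE \<omega> in M. \<bar>Y \<omega>\<bar> \<le> C" using Y(1) by (rule LinfE)
  obtain D where D: "AE \<omega> in M. \<bar>X \<omega>\<bar> \<le> D" using assms by (rule LinfE)
  have "- (C + D) \<le> m" if m: "(\<lambda>\<omega>. X \<omega> + m) \<in> A" for m
  proof (rule ccontr)
    assume "\<not> ?thesis"
    then have "AE \<omega> in M. X \<omega> + m \<le> Y \<omega>" using C D by auto
    then show False using A_mono[OF m Y(1)] Y(2) by blast
  qed
  then show ?thesis by (intro bdd_belowI) auto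
qed

lemma rho_le: "X \<in> Linf M \<Longrightarrow> (\<lambda>\<omega>. X \<omega> + m) \<in> A \<Longrightarrow> rho A X \<le> m"
  unfolding rho_def by (intro cInf_lower A_shift_bdd_below) auto

lemma rho_less_imp:
  assumes "X \<in> Linf M" "rho A X < m"
  shows "(\<lambda>\<omega>. X \<omega> + m) \<in> A"
proof -
  obtain k where k: "(\<lambda>\<omega>. X \<omega> + k) \<in> A" "k < m"
    using cInf_lessD[of "{m. (\<lambda>\<omega>. X \<omega> + m) \<in> A}" m] assms A_shift_nonempty[of X]
    unfolding rho_def by blast
  show ?thesis by (rule A_mono[OF k(1) Linf_shift[OF assms(1)]]) (use k in auto)
qed

text \<open>Monotonicity and cash additivity in a single inequality. Applied both ways it is the
  sup-norm Lipschitz bound; applied once it controls an extrapolated point in the semicontinuity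
  proof.\<close>

lemma rho_mono_shift:
  assumes X: "X \<in> Linf M" and Y: "Y \<in> Linf M" and c: "AE \<omega> in M. X \<omega> \<le> Y \<omega> + c"
  shows "rho A Y \<le> rho A X + c"
proof (rule field_le_epsilon)
  fix e :: real assume "0 < e"
  then have "(\<lambda>\<omega>. X \<omega> + (rho A X + e)) \<in> A" by (intro rho_less_imp[OF X]) simp
  moreover have "AE \<omega> in M. X \<omega> + (rho A X + e) \<le> Y \<omega> + (rho A X + c + e)"
    using c by eventually_elim simp
  ultimately have "(\<lambda>\<omega>. Y \<omega> + (rho A X + c + e)) \<in> A"
    by (rule A_mono[OF _ Linf_shift[OF Y]])
  then show "rho A Y \<le> rho A X + c + e" using rho_le[OF Y] by blast
qed

lemma rho_lipschitz:
  assumes "X \<in> Linf M" "Y \<in> Linf M" "AE \<omega> in M. \<bar>X \<omega> - Y \<omega>\<bar> \<le> c"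
  shows "\<bar>rho A X - rho A Y\<bar> \<le> c"
proof -
  have "AE \<omega> in M. X \<omega> \<le> Y \<omega> + c" "AE \<omega> in M. Y \<omega> \<le> X \<omega> + c" using assms(3) by auto
  then show ?thesis using rho_mono_shift[of X Y c] rho_mono_shift[of Y X c] assms by linarith
qed

lemma rho_law:
  assumes X: "X \<in> Linf M" and Y: "Y \<in> Linf M" and d: "distr M borel X = distr M borel Y"
  shows "rho A X = rho A Y"
proof -
  note [measurable] = Linf_measurable[OF X] Linf_measurable[OF Y]
  have *: "distr M borel (\<lambda>\<omega>. X \<omega> + m) = distr M borel (\<lambda>\<omega>. Y \<omega> + m)" for m
  proof -
    have "distr M borel (\<lambda>\<omega>. X \<omega> + m) = distr (distr M borel X) borel (\<lambda>x. x + m)"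
      by (subst distr_distr) (auto simp: comp_def)
    also have "\<dots> = distr M borel (\<lambda>\<omega>. Y \<omega> + m)"
      unfolding d by (subst distr_distr) (auto simp: comp_def)
    finally show ?thesis .
  qed
  have "(\<lambda>\<omega>. X \<omega> + m) \<in> A \<longleftrightarrow> (\<lambda>\<omega>. Y \<omega> + m) \<in> A" for m
    using law_inv[unfolded law_invariant_def, rule_format, OF Linf_shift[OF X, of m], of "\<lambda>\<omega>. Y \<omega> + m"]
      law_inv[unfolded law_invariant_def, rule_format, OF Linf_shift[OF Y, of m], of "\<lambda>\<omega>. X \<omega> + m"]
      *[of m] by auto
  then show ?thesis by (simp add: rho_def)
qed

lemma rho_convex:
  assumes X: "X \<in> Linf M" and Y: "Y \<in> Linf M" and t: "0 \<le> t" "t \<le> 1"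
  shows "rho A (\<lambda>\<omega>. t * X \<omega> + (1 - t) * Y \<omega>) \<le> t * rho A X + (1 - t) * rho A Y"
proof (rule field_le_epsilon)
  fix e :: real assume "0 < e"
  then have "(\<lambda>\<omega>. X \<omega> + (rho A X + e)) \<in> A" "(\<lambda>\<omega>. Y \<omega> + (rho A Y + e)) \<in> A"
    using rho_less_imp[OF X] rho_less_imp[OF Y] by simp_all
  then have "(\<lambda>\<omega>. t * (X \<omega> + (rho A X + e)) + (1 - t) * (Y \<omega> + (rho A Y + e))) \<in> A"
    using convex[unfolded convex_fset_def, rule_format] t by simp
  also have "(\<lambda>\<omega>. t * (X \<omega> + (rho A X + e)) + (1 - t) * (Y \<omega> + (rho A Y + e)))
     = (\<lambda>\<omega>. t * X \<omega> + (1 - t) * Y \<omega> + (t * rho A X + (1 - t) * rho A Y + e))"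
    by (auto simp: algebra_simps)
  finally show "rho A (\<lambda>\<omega>. t * X \<omega> + (1 - t) * Y \<omega>) \<le> t * rho A X + (1 - t) * rho A Y + e"
    by (intro rho_le) (use Linf_affine[OF X Y, of t "1-t" 0] in simp)
qed

text \<open>By law invariance the representative picked by \<open>SOME\<close> in \<open>RA\<close>
  does not matter.\<close>

lemma RA_distr:
  assumes X: "X \<in> Linf M"
  shows "RA M A (distr M borel X) = rho A X"
proof -
  have "\<exists>Y. Y \<in> Linf M \<and> distr M borel Y = distr M borel X" using X by auto
  from someI_ex[OF this] show ?thesis unfolding RA_def using rho_law X by blast
qed

lemma A_average:
  fixes n :: nat
  assumes "\<And>i. i < n \<Longrightarrow> X i \<in> A" "n > 0"
  shows "(\<lambda>\<omega>. (\<Sum>i<n. X i \<omega>) / n) \<in> A"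
  using assms(2,1)
proof (induction n rule: nat_induct_non_zero)
  case (Suc n)
  \<comment> \<open>The weight that turns the mean of \<open>n\<close> terms and one further term
    into the mean of \<open>Suc n\<close> terms.\<close>
  define t where "t = real n / real (Suc n)"
  have t: "0 \<le> t" "t \<le> 1" by (auto simp: t_def)
  have "(\<lambda>\<omega>. t * ((\<Sum>i<n. X i \<omega>) / n) + (1 - t) * X n \<omega>) \<in> A"
    using convex[unfolded convex_fset_def, rule_format, of "\<lambda>\<omega>. (\<Sum>i<n. X i \<omega>) / n" "X n" t] t Suc by simp
  also have "(\<lambda>\<omega>. t * ((\<Sum>i<n. X i \<omega>) / n) + (1 - t) * X n \<omega>) = (\<lambda>\<omega>. (\<Sum>i<Suc n. X i \<omega>) / Suc n)"
  proof
    fix \<omega>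
    have "t * ((\<Sum>i<n. X i \<omega>) / n) = (\<Sum>i<n. X i \<omega>) / Suc n" "1 - t = 1 / Suc n"
      using Suc.hyps by (simp add: t_def, simp add: t_def field_simps)
    then show "t * ((\<Sum>i<n. X i \<omega>) / n) + (1 - t) * X n \<omega> = (\<Sum>i<Suc n. X i \<omega>) / Suc n"
      by (simp add: add_divide_distrib)
  qed
  finally show ?case .
qed simp

end

section \<open>Conditional averages and closure\<close>

text \<open>The law of a pasted variable is \<open>prob B\<close> times its conditional law on
  \<open>B\<close> plus a part off \<open>B\<close> common to both sides. Equidistribution under the
  conditional measure thus becomes equidistribution under \<open>M\<close>, the form in which law
  invariance applies.\<close>

lemma (in prob_space) distr_paste:
  assumes B: "B \<in> sets M" "prob B > 0"
    and [measurable]: "f \<in> borel_measurable M" "g \<in> borel_measurable M" "Y \<in> borel_measurable M"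
    and eq: "distr (uniform_measure M B) borel f = distr (uniform_measure M B) borel g"
  shows "distr M borel (\<lambda>\<omega>. if \<omega> \<in> B then f \<omega> else Y \<omega> :: real) =
         distr M borel (\<lambda>\<omega>. if \<omega> \<in> B then g \<omega> else Y \<omega>)"
proof (rule measure_eqI)
  note [measurable] = B(1)
  fix S assume "S \<in> sets (distr M borel (\<lambda>\<omega>. if \<omega> \<in> B then f \<omega> else Y \<omega>))"
  then have [measurable]: "S \<in> sets borel" by simp
  have split: "measure (distr M borel (\<lambda>\<omega>. if \<omega> \<in> B then h \<omega> else Y \<omega>)) S =
      prob B * measure (distr (uniform_measure M B) borel h) S + prob ((Y -` S \<inter> space M) - B)"
    if [measurable]: "h \<in> borel_measurable M" for h
  proof -
    have "(\<lambda>\<omega>. if \<omega> \<in> B then h \<omega> else Y \<omega>) -` S \<inter> space M = (B \<inter> (h -` S \<inter> space M)) \<union> ((Y -` S \<inter> space M) - B)"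
      using sets.sets_into_space[OF B(1)] by (auto split: if_splits)
    then have "measure (distr M borel (\<lambda>\<omega>. if \<omega> \<in> B then h \<omega> else Y \<omega>)) S =
        prob ((B \<inter> (h -` S \<inter> space M)) \<union> ((Y -` S \<inter> space M) - B))"
      by (simp add: measure_distr)
    also have "\<dots> = prob (B \<inter> (h -` S \<inter> space M)) + prob ((Y -` S \<inter> space M) - B)"
      by (rule finite_measure_Union) auto
    also have "prob (B \<inter> (h -` S \<inter> space M)) = prob B * measure (distr (uniform_measure M B) borel h) S"
      using B by (subst measure_distr) (auto simp: measure_uniform_measure emeasure_eq_measure)
    finally show ?thesis .
  qed
  interpret D1: prob_space "distr M borel (\<lambda>\<omega>. if \<omega> \<in> B then f \<omega> else Y \<omega>)" by (rule prob_space_distr) measurable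
  interpret D2: prob_space "distr M borel (\<lambda>\<omega>. if \<omega> \<in> B then g \<omega> else Y \<omega>)" by (rule prob_space_distr) measurable
  show "emeasure (distr M borel (\<lambda>\<omega>. if \<omega> \<in> B then f \<omega> else Y \<omega>)) S =
        emeasure (distr M borel (\<lambda>\<omega>. if \<omega> \<in> B then g \<omega> else Y \<omega>)) S"
    unfolding D1.emeasure_eq_measure D2.emeasure_eq_measure by (subst split, simp)+ (simp add: eq)
qed simp

text \<open>Makes a uniform variable available under the conditional measure of an event, where the
  rearrangements take place.\<close>

lemma (in prob_space) nonatomic_uniform_measure:
  assumes na: "nonatomic M" and B: "B \<in> sets M" "prob B > 0"
  shows "nonatomic (uniform_measure M B)"
  unfolding nonatomic_def
proof safe
  fix S assume S: "S \<in> sets (uniform_measure M B)" "0 < measure (uniform_measure M B) S"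
  have m: "measure (uniform_measure M B) T = prob (B \<inter> T) / prob B" if "T \<in> sets M" for T
    using that B by (simp add: measure_uniform_measure emeasure_eq_measure)
  have "prob (B \<inter> S) > 0" using S m[of S] B by (auto simp: zero_less_divide_iff)
  then obtain C where C: "C \<in> sets M" "C \<subseteq> B \<inter> S" "0 < prob C" "prob C < prob (B \<inter> S)"
    using na S B unfolding nonatomic_def by (metis sets.Int sets_uniform_measure)
  then have "B \<inter> C = C" by auto
  then show "\<exists>C\<in>sets (uniform_measure M B). C \<subseteq> S \<and> 0 < measure (uniform_measure M B) C
      \<and> measure (uniform_measure M B) C < measure (uniform_measure M B) S"
    using C B S m[of C] m[of S] by (intro bexI[of _ C]) (auto simp: divide_strict_right_mono)
qed

lemma (in prob_space) integral_uniform_measure: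
  assumes B: "B \<in> sets M" "prob B > 0" and [measurable]: "f \<in> borel_measurable M"
  shows "(\<integral>\<omega>. f \<omega> \<partial>uniform_measure M B) = (\<integral>\<omega>. indicator B \<omega> * f \<omega> \<partial>M) / prob B"
proof -
  have "uniform_measure M B = density M (\<lambda>\<omega>. ennreal (indicator B \<omega> / prob B))"
    unfolding uniform_measure_def using B
    by (intro density_cong) (auto simp: emeasure_eq_measure divide_ennreal[symmetric] ennreal_indicator)
  then have "(\<integral>\<omega>. f \<omega> \<partial>uniform_measure M B) = (\<integral>\<omega>. (indicator B \<omega> / prob B) * f \<omega> \<partial>M)"
    using B by (simp add: integral_real_density)
  then show ?thesis by simp
qed

lemma floor_uniform:
  assumes N: "N > 0"
  shows "distr Uni (count_space UNIV) (\<lambda>u. nat \<lfloor>real N * u\<rfloor>) = measure_pmf (pmf_of_set {..<N})"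
proof (rule measure_eqI_countable[of _ UNIV])
  have m: "(\<lambda>u. nat \<lfloor>real N * u\<rfloor>) \<in> measurable Uni (count_space UNIV)"
    by (intro measurable_restrict_space1) measurable
  fix l :: nat
  have eq: "(\<lambda>u. nat \<lfloor>real N * u\<rfloor>) -` {l} \<inter> space Uni = (if l < N then {l/N..<(l+1)/N} \<inter> {0<..<1} else {})"
  proof -
    have 1: "nat \<lfloor>real N * u\<rfloor> = l \<longleftrightarrow> l/N \<le> u \<and> u < (l+1)/N" if "0 < u" for u
    proof -
      have "nat \<lfloor>real N * u\<rfloor> = l \<longleftrightarrow> \<lfloor>real N * u\<rfloor> = int l" using that N by auto
      also have "\<dots> \<longleftrightarrow> real l \<le> N * u \<and> N * u < real l + 1" by (auto simp: floor_eq_iff)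
      also have "\<dots> \<longleftrightarrow> l/N \<le> u \<and> u < (l+1)/N" using N by (auto simp: field_simps)
      finally show ?thesis .
    qed
    have 2: "l < N" if "l/N \<le> u" "u < 1" for u :: real
    proof -
      have "real l / N < 1" using that by linarith
      then show ?thesis using N by (simp add: field_simps)
    qed
    show ?thesis
    proof (rule set_eqI)
      fix u
      have "u \<in> (\<lambda>u. nat \<lfloor>real N * u\<rfloor>) -` {l} \<inter> space Uni \<longleftrightarrow> nat \<lfloor>real N * u\<rfloor> = l \<and> u \<in> {0<..<1}"
        by simp
      also have "\<dots> \<longleftrightarrow> l/N \<le> u \<and> u < (l+1)/N \<and> u \<in> {0<..<1}"
        using 1[of u] by auto
      also have "\<dots> \<longleftrightarrow> u \<in> (if l < N then {l/N..<(l+1)/N} \<inter> {0<..<1} else {})"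
        using 2[of u] by auto
      finally show "u \<in> (\<lambda>u. nat \<lfloor>real N * u\<rfloor>) -` {l} \<inter> space Uni \<longleftrightarrow>
        u \<in> (if l < N then {l/N..<(l+1)/N} \<inter> {0<..<1} else {})" .
    qed
  qed
  have "emeasure lborel ({l/N..<(l+1)/N} \<inter> {0<..<1}) = ennreal (1/N)" if l: "l < N"
  proof -
    have "(l+1)/N \<le> 1" "0 \<le> real l / N" using l N by (auto simp: field_simps)
    then have "emeasure lborel ({l/N..<(l+1)/N} \<inter> {0<..<1}) = emeasure lborel {l/N..<(l+1)/N}"
    proof (intro emeasure_eq_AE)
      \<comment> \<open>Only the cell \<open>l = 0\<close> is affected by the intersection: it loses
        the endpoint 0.\<close>
      show "AE x in lborel. (x \<in> {l/N..<(l+1)/N} \<inter> {0<..<1}) = (x \<in> {l/N..<(l+1)/N})"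
        using AE_lborel_singleton[of 0]
      proof eventually_elim
        case (elim x)
        have "0 < x \<and> x < 1" if "l/N \<le> x" "x < (l+1)/N"
          using that elim \<open>(l+1)/N \<le> 1\<close> \<open>0 \<le> real l / N\<close> by linarith
        then show ?case by auto
      qed
    qed auto
    also have "\<dots> = ennreal (1/N)" using N by (simp add: divide_right_mono diff_divide_distrib[symmetric])
    finally show ?thesis .
  qed
  then have "emeasure Uni (if l < N then {l/N..<(l+1)/N} \<inter> {0<..<1} else {}) = ennreal (if l < N then 1/N else 0)"
    by (auto simp: emeasure_restrict_space)
  moreover have "emeasure (measure_pmf (pmf_of_set {..<N})) {l} = ennreal (if l < N then 1/N else 0)"
    using N by (subst emeasure_pmf_single, subst pmf_of_set) auto
  ultimately show "emeasure (distr Uni (count_space UNIV) (\<lambda>u. nat \<lfloor>real N * u\<rfloor>)) {l} = emeasure (measure_pmf (pmf_of_set {..<N})) {l}"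
    by (subst emeasure_distr[OF m]) (simp, simp only: eq)
qed auto

section \<open>Quantile functions: generalised inverses of distribution functions\<close>

definition quantile :: "real measure \<Rightarrow> real \<Rightarrow> real" where
  "quantile \<mu> u = Inf {x. u \<le> cdf \<mu> x}"

text \<open>The Galois connection between quantile and cdf; through it every later comparison of
  quantiles becomes a comparison of cdfs at a grid point.\<close>

lemma quantile_le_iff:
  assumes "real_distribution \<mu>" "u \<in> {0<..<1}"
  shows "quantile \<mu> u \<le> x \<longleftrightarrow> u \<le> cdf \<mu> x"
proof -
  interpret cdf_distribution \<mu> unfolding cdf_distribution_def by (rule assms)
  show ?thesis using pseudoinverse[of u x] assms(2) unfolding quantile_def by auto
qed

lemma quantile_mono:
  assumes "real_distribution \<mu>" "0 < u" "u \<le> v" "v < 1"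
  shows "quantile \<mu> u \<le> quantile \<mu> v"
  using quantile_le_iff[OF assms(1), of u "quantile \<mu> v"] quantile_le_iff[OF assms(1), of v "quantile \<mu> v"] assms
  by auto

lemma distr_quantile:
  assumes "real_distribution \<mu>"
  shows "quantile \<mu> \<in> borel_measurable Uni" "distr Uni borel (quantile \<mu>) = \<mu>"
proof -
  interpret cdf_distribution \<mu> unfolding cdf_distribution_def by (rule assms)
  have *: "quantile \<mu> = I" by (auto simp: quantile_def fun_eq_iff)
  show "quantile \<mu> \<in> borel_measurable Uni" unfolding *
    using measurable_CI by (simp add: measurable_def sets_restrict_space space_restrict_space)
  show "distr Uni borel (quantile \<mu>) = \<mu>" unfolding * by (rule distr_I_eq_M)
qed

lemma quantile_bounded:
  assumes mu: "real_distribution \<mu>" and K: "AE x in \<mu>. \<bar>x\<bar> \<le> K" and u: "u \<in> {0<..<1}"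
  shows "\<bar>quantile \<mu> u\<bar> \<le> K"
proof -
  interpret real_distribution \<mu> by (rule mu)
  have "cdf \<mu> K = prob (space \<mu>)" unfolding cdf_def
    using K by (intro finite_measure_eq_AE) auto
  then have "quantile \<mu> u \<le> K" using u prob_space by (auto simp: quantile_le_iff[OF mu u])
  moreover have "- K \<le> quantile \<mu> u"
  proof (rule ccontr)
    assume "\<not> ?thesis"
    then have "AE x in \<mu>. x \<notin> {..quantile \<mu> u}" using K by auto
    then have "cdf \<mu> (quantile \<mu> u) = prob {}" unfolding cdf_def
      by (intro finite_measure_eq_AE) auto
    then show False using quantile_le_iff[OF mu u, of "quantile \<mu> u"] u by auto
  qed
  ultimately show ?thesis by auto
qed

text \<open>Used in two ways: read in \<open>i\<close>, rotation preserves the uniform law on the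
  indices; read in the amount of rotation, it makes the sum over all rotations independent of the
  starting cell.\<close>

lemma bij_betw_rotate:
  assumes "N > 0"
  shows "bij_betw (\<lambda>i. (k + i) mod N) {..<N} {..<N::nat}"
proof -
  have aux: "i = j" if "i \<le> j" "j < N" "(k + i) mod N = (k + j) mod N" for i j
  proof -
    have "N dvd (k + j) - (k + i)" using that by (metis mod_eq_dvd_iff_nat add_le_mono order_refl)
    then have "N dvd j - i" by simp
    moreover have "j - i < N" using that by simp
    ultimately have "j - i = 0" by (meson dvd_imp_le not_gr_zero not_less)
    then show ?thesis using that by simp
  qed
  have inj: "inj_on (\<lambda>i. (k + i) mod N) {..<N}"
  proof (rule inj_onI)
    fix i j assume "i \<in> {..<N}" "j \<in> {..<N}" "(k + i) mod N = (k + j) mod N"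
    then show "i = j" using aux[of i j] aux[of j i] by (cases "i \<le> j") auto
  qed
  moreover have "(\<lambda>i. (k + i) mod N) ` {..<N} \<subseteq> {..<N}" using assms by auto
  ultimately show ?thesis by (simp add: bij_betw_def endo_inj_surj)
qed

context convex_acceptance begin

text \<open>Replacing \<open>Y\<close> on \<open>B\<close> by its conditional mean: cut \<open>B\<close> into \<open>N\<close> pieces of equal probability
  along the quantile function of \<open>Y\<close> on \<open>B\<close>; the \<open>N\<close> cyclic rotations of the resulting step
  function are equidistributed and average to a constant.\<close>

lemma A_average_event:
  assumes Y: "Y \<in> A" and B: "B \<in> sets M" "prob B > 0" and e: "e > 0"
  shows "(\<lambda>\<omega>. if \<omega> \<in> B then (\<integral>\<omega>'. Y \<omega>' \<partial>uniform_measure M B) + e else Y \<omega>) \<in> A"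
proof -
  note [measurable] = B(1)
  define Q where "Q = uniform_measure M B"
  interpret Q: prob_space Q unfolding Q_def
    by (rule prob_space_uniform_measure) (use B in \<open>auto simp: emeasure_eq_measure\<close>)
  have [simp, measurable_cong]: "sets Q = sets M" by (simp add: Q_def)
  have [simp]: "space Q = space M" by (simp add: Q_def)
  have QM: "measurable Q = (measurable M :: 'c measure \<Rightarrow> _)" by (intro ext) (auto simp: measurable_def)
  obtain K where K: "0 \<le> K" "AE \<omega> in M. \<bar>Y \<omega>\<bar> \<le> K" and Ym [measurable]: "Y \<in> borel_measurable M"
    using A_Linf[OF Y] by (rule LinfE)
  have KQ: "AE \<omega> in Q. \<bar>Y \<omega>\<bar> \<le> K" unfolding Q_def
  proof (rule AE_uniform_measureI)
    show "AE \<omega> in M. \<omega> \<in> B \<longrightarrow> \<bar>Y \<omega>\<bar> \<le> K" using K(2) by eventually_elim simp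
  qed (rule B)
  have YQ: "Y \<in> borel_measurable Q" unfolding QM by (rule Ym)
  define nu where "nu = distr Q borel Y"
  have nu: "real_distribution nu"
    unfolding nu_def by (rule Q.real_distribution_distr) (rule YQ)
  have KI: "\<bar>quantile nu u\<bar> \<le> K" if "u \<in> {0<..<1}" for u
  proof (rule quantile_bounded[OF nu _ that])
    show "AE x in nu. \<bar>x\<bar> \<le> K" unfolding nu_def
      by (subst AE_distr_iff[OF YQ]) (use KQ in simp_all)
  qed
  have "nonatomic Q" unfolding Q_def by (rule nonatomic_uniform_measure[OF nonatomic B])
  from Q.nonatomic_uniform[OF this]
  obtain V where V: "V \<in> measurable Q Uni" "distr Q Uni V = Uni" by (elim bexE)
  have V01: "V \<omega> \<in> {0<..<1}" if "\<omega> \<in> space M" for \<omega>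
    using measurable_space[OF V(1), of \<omega>] that by simp
  note Im = distr_quantile(1)[OF nu]
  have IVm: "(\<lambda>\<omega>. quantile nu (V \<omega>)) \<in> borel_measurable Q"
    by (rule measurable_compose[OF V(1) Im])
  have IV: "distr Q borel (\<lambda>\<omega>. quantile nu (V \<omega>)) = nu"
    using distr_distr[OF Im V(1)] V(2) distr_quantile(2)[OF nu] by (simp add: comp_def)
  \<comment> \<open>With \<open>N\<close> cells the averages of the upper and lower step functions
    differ by \<open>2 * K / N\<close>, which has to be at most \<open>e\<close>.\<close>
  have "\<exists>N::nat. 2 * K / e < N" by (rule reals_Archimedean2)
  then obtain N where N0: "2 * K / e < real N" by auto
  have N: "N > 0" using N0 K e by (cases N) (auto simp: divide_less_0_iff)
  have Ne: "2 * K / N \<le> e" using N0 N e by (simp add: field_simps)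
  define kap where "kap \<omega> = nat \<lfloor>real N * V \<omega>\<rfloor>" for \<omega>
  have fm: "(\<lambda>u. nat \<lfloor>real N * u\<rfloor>) \<in> measurable Uni (count_space UNIV)"
    by (intro measurable_restrict_space1) measurable
  have kapQ: "kap \<in> measurable Q (count_space UNIV)"
    unfolding kap_def by (rule measurable_compose[OF V(1) fm])
  then have kapm [measurable]: "kap \<in> measurable M (count_space UNIV)" by (simp add: QM)
  have kapN: "kap \<omega> < N" if "\<omega> \<in> space M" for \<omega>
  proof -
    have "real N * V \<omega> < N" using V01[OF that] N by auto
    then show ?thesis unfolding kap_def using V01[OF that] N by (simp add: nat_less_iff floor_less_iff)
  qed
  have kapd: "distr Q (count_space UNIV) kap = measure_pmf (pmf_of_set {..<N})"
    using distr_distr[OF fm V(1)] V(2) floor_uniform[OF N] by (simp add: comp_def kap_def[abs_def])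
  \<comment> \<open>\<open>c\<close> and \<open>d\<close> are the values of the quantile function at
    the right and left end of each cell. At levels 1 and 0, where no quantile is defined, the bounds
    \<open>K\<close> and \<open>- K\<close> take its place.\<close>
  define c where "c l = (if Suc l < N then quantile nu (real (Suc l) / N) else K)" for l
  define d where "d l = (if l = 0 then - K else quantile nu (real l / N))" for l
  have dc: "d (kap \<omega>) \<le> quantile nu (V \<omega>)" "quantile nu (V \<omega>) \<le> c (kap \<omega>)" if w: "\<omega> \<in> space M" for \<omega>
  proof -
    have v: "V \<omega> \<in> {0<..<1}" using V01 w by auto
    have "real (kap \<omega>) = of_int \<lfloor>N * V \<omega>\<rfloor>" using v by (auto simp: kap_def)
    then have "real (kap \<omega>) \<le> N * V \<omega>" "N * V \<omega> < real (kap \<omega>) + 1" by linarith+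
    then have 1: "real (kap \<omega>) / N \<le> V \<omega>" "V \<omega> \<le> real (Suc (kap \<omega>)) / N" using N by (auto simp: field_simps)
    show "d (kap \<omega>) \<le> quantile nu (V \<omega>)"
      using KI[OF v] 1 v kapN[OF w] N unfolding d_def
      by (auto intro!: quantile_mono[OF nu])
    show "quantile nu (V \<omega>) \<le> c (kap \<omega>)"
      using KI[OF v] 1 v N unfolding c_def
      by (auto intro!: quantile_mono[OF nu])
  qed
  \<comment> \<open>The right end of a cell is the left end of the next, so the sums telescope and
    only the two extreme values \<open>K\<close> and \<open>- K\<close> survive.\<close>
  have cd: "(\<Sum>l<N. c l) = (\<Sum>l<N. d l) + 2 * K"
  proof -
    obtain m where m: "N = Suc m" using N by (cases N) auto
    have "(\<Sum>l<N. c l) = (\<Sum>l<m. d (Suc l)) + K" by (simp add: m c_def d_def)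
    moreover have "(\<Sum>l<N. d l) = - K + (\<Sum>l<m. d (Suc l))"
      unfolding m sum.lessThan_Suc_shift by (simp add: d_def)
    ultimately show ?thesis by simp
  qed
  have EY: "(\<integral>\<omega>. Y \<omega> \<partial>Q) = (\<integral>\<omega>. quantile nu (V \<omega>) \<partial>Q)"
  proof -
    have "(\<integral>\<omega>. Y \<omega> \<partial>Q) = (\<integral>x. x \<partial>nu)" unfolding nu_def by (subst integral_distr) (auto simp: QM)
    also have "\<dots> = (\<integral>x. x \<partial>distr Q borel (\<lambda>\<omega>. quantile nu (V \<omega>)))" by (simp only: IV)
    also have "\<dots> = (\<integral>\<omega>. quantile nu (V \<omega>) \<partial>Q)"
      by (rule integral_distr) (use IVm in auto)
    finally show ?thesis .
  qed
  have "(\<Sum>l<N. d l) / N \<le> (\<integral>\<omega>. Y \<omega> \<partial>Q)"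
  proof -
    have "(\<Sum>l<N. d l) / N = (\<integral>l. d l \<partial>measure_pmf (pmf_of_set {..<N}))"
      using N by (subst integral_pmf_of_set) auto
    also have "\<dots> = (\<integral>\<omega>. d (kap \<omega>) \<partial>Q)" unfolding kapd[symmetric]
      by (rule integral_distr) (use kapQ in auto)
    also have "\<dots> \<le> (\<integral>\<omega>. quantile nu (V \<omega>) \<partial>Q)"
    proof (rule integral_mono)
      show "integrable Q (\<lambda>\<omega>. quantile nu (V \<omega>))"
        by (rule Q.integrable_const_bound[of _ K]) (use KI V01 IVm in auto)
      show "integrable Q (\<lambda>\<omega>. d (kap \<omega>))"
      proof (rule Q.integrable_const_bound[of _ K])
        show "AE \<omega> in Q. norm (d (kap \<omega>)) \<le> K"
          using kapN KI K N by (auto simp: d_def)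
      qed (simp add: QM)
    qed (use dc in auto)
    finally show ?thesis by (simp add: EY)
  qed
  then have cavg: "(\<Sum>l<N. c l) / N \<le> (\<integral>\<omega>. Y \<omega> \<partial>Q) + e"
    using Ne by (simp add: cd add_divide_distrib)
  \<comment> \<open>\<open>W\<close> rearranges \<open>Y\<close> on \<open>B\<close> along
    \<open>V\<close> without changing its law. \<open>X 0\<close> is the upper step function above
    \<open>W\<close>, and \<open>X i\<close> shifts its cells cyclically by
    \<open>i\<close>.\<close>
  define W where "W \<omega> = (if \<omega> \<in> B then quantile nu (V \<omega>) else Y \<omega>)" for \<omega>
  define X where "X i \<omega> = (if \<omega> \<in> B then c ((i + kap \<omega>) mod N) else Y \<omega>)" for i \<omega>
  have BM: "B \<subseteq> space M" by (rule sets.sets_into_space[OF B(1)])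
  have IVM [measurable]: "(\<lambda>\<omega>. quantile nu (V \<omega>)) \<in> borel_measurable M" using IVm by (simp add: QM)
  have WL: "W \<in> Linf M"
  proof (rule LinfI)
    show "W \<in> borel_measurable M" unfolding W_def by measurable
    show "AE \<omega> in M. \<bar>W \<omega>\<bar> \<le> K" using K(2) AE_space
      by eventually_elim (use KI V01 in \<open>auto simp: W_def\<close>)
  qed
  have cK: "\<bar>c l\<bar> \<le> K" for l unfolding c_def using KI K N by auto
  have XL: "X i \<in> Linf M" for i
  proof (rule LinfI)
    show "X i \<in> borel_measurable M" unfolding X_def by measurable
    show "AE \<omega> in M. \<bar>X i \<omega>\<bar> \<le> K" using K(2)
      by eventually_elim (use cK in \<open>auto simp: X_def\<close>)
  qed
  have "distr M borel W = distr M borel Y"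
  proof -
    have "distr M borel W = distr M borel (\<lambda>\<omega>. if \<omega> \<in> B then Y \<omega> else Y \<omega>)" unfolding W_def
      by (rule distr_paste[OF B IVM Ym Ym]) (simp only: Q_def[symmetric] nu_def[symmetric] IV)
    then show ?thesis by simp
  qed
  then have "W \<in> A" using law_inv WL Y unfolding law_invariant_def by blast
  moreover have "AE \<omega> in M. W \<omega> \<le> X 0 \<omega>"
    using dc(2) kapN BM by (intro AE_I2) (auto simp: W_def X_def)
  ultimately have X0: "X 0 \<in> A" using A_mono XL by blast
  \<comment> \<open>The cell index \<open>kap\<close> is uniform under the conditional measure and
    rotation permutes the cells, so the conditional law of \<open>X i\<close> on \<open>B\<close>
    does not depend on \<open>i\<close>.\<close>
  have rot: "distr Q borel (\<lambda>\<omega>. c ((i + kap \<omega>) mod N)) = distr (measure_pmf (pmf_of_set {..<N})) borel c" for i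
  proof -
    have "distr Q borel (\<lambda>\<omega>. c ((i + kap \<omega>) mod N))
        = distr (distr Q (count_space UNIV) kap) borel (\<lambda>l. c ((i + l) mod N))"
      by (subst distr_distr) (use kapQ in \<open>auto simp: comp_def\<close>)
    also have "\<dots> = distr (distr (measure_pmf (pmf_of_set {..<N})) (count_space UNIV) (\<lambda>l. (i + l) mod N)) borel c"
      unfolding kapd by (subst distr_distr) (auto simp: comp_def)
    also have "distr (measure_pmf (pmf_of_set {..<N})) (count_space UNIV) (\<lambda>l. (i + l) mod N)
       = measure_pmf (map_pmf (\<lambda>l. (i + l) mod N) (pmf_of_set {..<N}))"
      by (simp only: map_pmf_rep_eq)
    also have "map_pmf (\<lambda>l. (i + l) mod N) (pmf_of_set {..<N}) = pmf_of_set {..<N}"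
      by (rule map_pmf_of_set_bij_betw[OF bij_betw_rotate[OF N]]) (use N in auto)
    finally show ?thesis .
  qed
  have XA: "X i \<in> A" for i
  proof -
    have "distr M borel (X i) = distr M borel (X 0)" unfolding X_def
      by (rule distr_paste[OF B]) (use rot[of i] rot[of 0] in \<open>simp_all add: Q_def[symmetric]\<close>)
    then show ?thesis using law_inv XL X0 unfolding law_invariant_def by blast
  qed
  have "(\<lambda>\<omega>. (\<Sum>i<N. X i \<omega>) / N) \<in> A" by (rule A_average[OF XA N])
  then show ?thesis
  proof (rule A_mono)
    show "(\<lambda>\<omega>. if \<omega> \<in> B then (\<integral>\<omega>'. Y \<omega>' \<partial>uniform_measure M B) + e else Y \<omega>) \<in> Linf M"
      by (intro Linf_if Linf_const A_Linf[OF Y]) measurable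
    \<comment> \<open>At a fixed point of \<open>B\<close> the \<open>N\<close> rotations visit
      every cell value exactly once, so the average is the same constant all over
      \<open>B\<close>.\<close>
    have "(\<Sum>i<N. X i \<omega>) / N \<le> (if \<omega> \<in> B then (\<integral>\<omega>'. Y \<omega>' \<partial>uniform_measure M B) + e else Y \<omega>)" for \<omega>
    proof (cases "\<omega> \<in> B")
      case True
      have "(\<Sum>i<N. X i \<omega>) = (\<Sum>i<N. c ((kap \<omega> + i) mod N))" using True by (simp add: X_def add.commute)
      also have "\<dots> = (\<Sum>l<N. c l)" by (rule sum.reindex_bij_betw[OF bij_betw_rotate[OF N]])
      finally show ?thesis using True cavg by (simp add: Q_def)
    next
      case False
      then show ?thesis using N by (simp add: X_def)
    qed
    then show "AE \<omega> in M. (\<Sum>i<N. X i \<omega>) / N \<le> (if \<omega> \<in> B then (\<integral>\<omega>'. Y \<omega>' \<partial>uniform_measure M B) + e else Y \<omega>)"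
      by simp
  qed
qed

end

section \<open>From closeness in L^p to membership up to a small cash amount\<close>

lemma (in prob_space) expectation_abs_le_of_powr:
  assumes X: "X \<in> Linf M" and p: "1 \<le> p" and t: "t > 0"
    and le: "(\<integral>\<omega>. \<bar>X \<omega>\<bar> powr p \<partial>M) \<le> t powr p"
  shows "(\<integral>\<omega>. \<bar>X \<omega>\<bar> \<partial>M) \<le> 2 * t"
proof -
  obtain C where C: "0 \<le> C" "AE \<omega> in M. \<bar>X \<omega>\<bar> \<le> C" and [measurable]: "X \<in> borel_measurable M"
    using X by (rule LinfE)
  have int: "integrable M (\<lambda>\<omega>. \<bar>X \<omega>\<bar> powr p)"
    by (rule integrable_const_bound[of _ "C powr p"]) (use C(2) p in \<open>auto elim!: eventually_mono intro!: powr_mono2\<close>)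
  \<comment> \<open>Pointwise, either \<open>|x|\<close> is at most \<open>t\<close>, or
    \<open>|x| powr (1 - p)\<close> is at most \<open>t powr (1 - p)\<close> since
    \<open>1 - p\<close> is not positive. This passes to first moments, which control means over
    events.\<close>
  have "(\<integral>\<omega>. \<bar>X \<omega>\<bar> \<partial>M) \<le> (\<integral>\<omega>. t + \<bar>X \<omega>\<bar> powr p * t powr (1 - p) \<partial>M)"
  proof (rule integral_mono)
    show "integrable M (\<lambda>\<omega>. \<bar>X \<omega>\<bar>)" by (rule integrable_const_bound[of _ C]) (use C in auto)
    show "integrable M (\<lambda>\<omega>. t + \<bar>X \<omega>\<bar> powr p * t powr (1 - p))" using int by auto
    fix \<omega>
    show "\<bar>X \<omega>\<bar> \<le> t + \<bar>X \<omega>\<bar> powr p * t powr (1 - p)"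
    proof (cases "\<bar>X \<omega>\<bar> \<le> t")
      case False
      then have "\<bar>X \<omega>\<bar> powr (1 - p) \<le> t powr (1 - p)" using t p by (intro powr_mono2') auto
      then have "\<bar>X \<omega>\<bar> powr p * \<bar>X \<omega>\<bar> powr (1 - p) \<le> \<bar>X \<omega>\<bar> powr p * t powr (1 - p)"
        by (intro mult_left_mono) auto
      moreover have "\<bar>X \<omega>\<bar> powr p * \<bar>X \<omega>\<bar> powr (1 - p) = \<bar>X \<omega>\<bar>"
        using False t by (simp add: powr_add[symmetric])
      ultimately show ?thesis using t by linarith
    qed (use t in \<open>auto intro: add_increasing2\<close>)
  qed
  also have "\<dots> = t + (\<integral>\<omega>. \<bar>X \<omega>\<bar> powr p \<partial>M) * t powr (1 - p)"
    using int by (simp add: prob_space)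
  also have "\<dots> \<le> t + t powr p * t powr (1 - p)"
    using le by (intro add_left_mono mult_right_mono) auto
  also have "\<dots> = 2 * t" using t by (simp add: powr_add[symmetric])
  finally show ?thesis .
qed

context convex_acceptance begin

text \<open>Induction over the bins, with \<open>A_average_event\<close> applied to one bin at a
  time. The bins are disjoint, so earlier replacements leave the mean of \<open>Y\<close> on the
  current bin unchanged and the slack \<open>e\<close> is paid once per bin instead of
  accumulating.\<close>

lemma A_average_bins:
  fixes b :: "'a \<Rightarrow> nat"
  assumes Y: "Y \<in> A" and [measurable]: "b \<in> measurable M (count_space UNIV)" and e: "e > 0"
  defines "m \<equiv> \<lambda>j. (\<integral>\<omega>. Y \<omega> \<partial>uniform_measure M {\<omega>\<in>space M. b \<omega> = j}) + e"
  shows "(\<lambda>\<omega>. if b \<omega> < k then m (b \<omega>) else Y \<omega>) \<in> A"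
proof -
  obtain C where C: "0 \<le> C" "AE \<omega> in M. \<bar>Y \<omega>\<bar> \<le> C" and [measurable]: "Y \<in> borel_measurable M"
    using A_Linf[OF Y] by (rule LinfE)
  have L: "(\<lambda>\<omega>. if b \<omega> < k then m (b \<omega>) else Y \<omega>) \<in> Linf M" for k
  proof (rule LinfI)
    show "AE \<omega> in M. \<bar>if b \<omega> < k then m (b \<omega>) else Y \<omega>\<bar> \<le> (\<Sum>j<k. \<bar>m j\<bar>) + C"
      using C(2)
    proof eventually_elim
      case (elim \<omega>)
      have "\<bar>m (b \<omega>)\<bar> \<le> (\<Sum>j<k. \<bar>m j\<bar>)" if "b \<omega> < k"
        using that by (intro member_le_sum[of _ _ "\<lambda>j. \<bar>m j\<bar>"]) auto
      moreover have "0 \<le> (\<Sum>j<k. \<bar>m j\<bar>)" by (rule sum_nonneg) simp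
      ultimately show ?case using elim C(1) by (smt (verit, best))
    qed
  qed measurable
  show ?thesis
  proof (induction k)
    case 0
    then show ?case using Y by simp
  next
    case (Suc k)
    define F where "F \<omega> = (if b \<omega> < k then m (b \<omega>) else Y \<omega>)" for \<omega>
    define B where "B = {\<omega>\<in>space M. b \<omega> = k}"
    have B [measurable]: "B \<in> sets M" unfolding B_def by measurable
    have F: "F \<in> A" using Suc by (simp add: F_def[abs_def])
    have [measurable]: "F \<in> borel_measurable M" by (rule Linf_measurable[OF A_Linf[OF F]])
    show ?case
    proof (cases "prob B > 0")
      case True
      have FY: "(\<integral>\<omega>. F \<omega> \<partial>uniform_measure M B) = (\<integral>\<omega>. Y \<omega> \<partial>uniform_measure M B)"
      proof -
        have "(\<lambda>\<omega>. indicator B \<omega> * F \<omega>) = (\<lambda>\<omega>. indicator B \<omega> * Y \<omega>)"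
          by (auto simp: B_def F_def indicator_def)
        then show ?thesis using B True by (simp add: integral_uniform_measure)
      qed
      have "(\<lambda>\<omega>. if \<omega> \<in> B then (\<integral>\<omega>'. F \<omega>' \<partial>uniform_measure M B) + e else F \<omega>) \<in> A"
        by (rule A_average_event[OF F B True e])
      moreover have "(\<integral>\<omega>'. F \<omega>' \<partial>uniform_measure M B) + e = m k"
        unfolding FY unfolding m_def B_def ..
      ultimately have "(\<lambda>\<omega>. if \<omega> \<in> B then m k else F \<omega>) \<in> A" by (simp only:)
      then show ?thesis
        by (rule A_mono[OF _ L]) (auto intro!: AE_I2 simp: B_def F_def less_Suc_eq)
    next
      case False
      then have "AE \<omega> in M. \<omega> \<notin> B"
        using B by (intro AE_not_in) (auto simp: null_sets_def emeasure_eq_measure zero_less_measure_iff)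
      then have "AE \<omega> in M. F \<omega> \<le> (if b \<omega> < Suc k then m (b \<omega>) else Y \<omega>)"
        using AE_space by eventually_elim (auto simp: B_def F_def less_Suc_eq)
      then show ?thesis by (rule A_mono[OF F L])
    qed
  qed
qed

text \<open>Averaging \<open>Y\<close> over the level sets of a discretisation of \<open>Z\<close> turns closeness in mean
  into uniform closeness.\<close>

theorem A_Lp_closure:
  assumes Z: "Z \<in> Linf M" and p: "1 \<le> p"
    and close: "\<And>d. d > 0 \<Longrightarrow> \<exists>Y\<in>A. (\<integral>\<omega>. \<bar>Y \<omega> - Z \<omega>\<bar> powr p \<partial>M) < d"
    and e0: "e0 > 0"
  shows "(\<lambda>\<omega>. Z \<omega> + e0) \<in> A"
proof -
  \<comment> \<open>One third each for the width of a bin, the error of the conditional mean and the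
    slack of \<open>A_average_bins\<close>.\<close>
  define e where "e = e0 / 3"
  have e: "e > 0" using e0 by (simp add: e_def)
  obtain K where K: "0 \<le> K" "AE \<omega> in M. \<bar>Z \<omega>\<bar> \<le> K" and [measurable]: "Z \<in> borel_measurable M"
    using Z by (rule LinfE)
  \<comment> \<open>Clipping \<open>Z\<close> at \<open>K\<close> confines the bin index below
    \<open>k\<close> at every point, not just almost surely.\<close>
  define b where "b \<omega> = nat \<lfloor>(max (-K) (min K (Z \<omega>)) + K) / e\<rfloor>" for \<omega>
  have b [measurable]: "b \<in> measurable M (count_space UNIV)" unfolding b_def by measurable
  define k where "k = Suc (nat \<lfloor>(2 * K) / e\<rfloor>)"
  have bk: "b \<omega> < k" for \<omega>
    unfolding b_def k_def less_Suc_eq_le using e K by (intro nat_mono floor_mono divide_right_mono) auto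
  define B where "B j = {\<omega>\<in>space M. b \<omega> = j}" for j
  have B [measurable]: "B j \<in> sets M" for j unfolding B_def by measurable
  have bZ: "- K + j * e \<le> Z \<omega> \<and> Z \<omega> \<le> - K + (j + 1) * e" if "\<bar>Z \<omega>\<bar> \<le> K" "b \<omega> = j" for \<omega> j
  proof -
    have "max (-K) (min K (Z \<omega>)) = Z \<omega>" using that by auto
    then have "real j = of_int \<lfloor>(Z \<omega> + K) / e\<rfloor>" using that e by (auto simp: b_def)
    then have "real j \<le> (Z \<omega> + K) / e" "(Z \<omega> + K) / e \<le> real j + 1" by linarith+
    then show ?thesis using e by (auto simp: field_simps)
  qed
  \<comment> \<open>The least positive bin probability. Inserting 1 keeps \<open>Min\<close> away
    from the empty set.\<close>
  define q where "q = Min (insert 1 (prob ` B ` {j. j < k \<and> prob (B j) > 0}))"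
  have q: "q > 0" unfolding q_def by (subst Min_gr_iff) auto
  have qB: "q \<le> prob (B j)" if "j < k" "prob (B j) > 0" for j
    unfolding q_def using that by (intro Min_le) auto
  \<comment> \<open>With the factor 2 of \<open>expectation_abs_le_of_powr\<close> the first moment
    of \<open>Y - Z\<close> is at most \<open>e * q\<close>; division by a bin probability of at
    least \<open>q\<close> leaves an error of at most \<open>e\<close> in the mean.\<close>
  define t where "t = e * q / 2"
  have t: "t > 0" using e q by (simp add: t_def)
  obtain Y where Y: "Y \<in> A" "(\<integral>\<omega>. \<bar>Y \<omega> - Z \<omega>\<bar> powr p \<partial>M) < t powr p"
    using close[of "t powr p"] t by auto
  have YZ: "(\<integral>\<omega>. \<bar>Y \<omega> - Z \<omega>\<bar> \<partial>M) \<le> e * q"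
    using expectation_abs_le_of_powr[OF Linf_diff[OF A_Linf[OF Y(1)] Z] p t] Y(2) by (simp add: t_def)
  obtain C where C: "0 \<le> C" "AE \<omega> in M. \<bar>Y \<omega>\<bar> \<le> C" and [measurable]: "Y \<in> borel_measurable M"
    using A_Linf[OF Y(1)] by (rule LinfE)
  have intYZ: "integrable M (\<lambda>\<omega>. \<bar>Y \<omega> - Z \<omega>\<bar>)"
    by (rule integrable_const_bound[of _ "C + K"]) (use C(2) K(2) in \<open>eventually_elim; simp\<close>, measurable)
  define m where "m j = (\<integral>\<omega>. Y \<omega> \<partial>uniform_measure M (B j)) + e" for j
  have mle: "m j \<le> - K + j * e + 3 * e" if j: "j < k" "prob (B j) > 0" for j
  proof -
    have "(\<integral>\<omega>. Y \<omega> \<partial>uniform_measure M (B j)) = (\<integral>\<omega>. indicator (B j) \<omega> * Y \<omega> \<partial>M) / prob (B j)"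
      using j by (simp add: integral_uniform_measure)
    also have "(\<integral>\<omega>. indicator (B j) \<omega> * Y \<omega> \<partial>M) \<le> (\<integral>\<omega>. indicator (B j) \<omega> * (- K + (j + 1) * e) + \<bar>Y \<omega> - Z \<omega>\<bar> \<partial>M)"
    proof (rule integral_mono_AE)
      show "integrable M (\<lambda>\<omega>. indicator (B j) \<omega> * Y \<omega>)"
        by (rule integrable_const_bound[of _ C])
          (use C in \<open>auto elim!: eventually_mono simp: indicator_def\<close>)
      show "integrable M (\<lambda>\<omega>. indicator (B j) \<omega> * (- K + (j + 1) * e) + \<bar>Y \<omega> - Z \<omega>\<bar>)"
        using intYZ by (intro Bochner_Integration.integrable_add integrable_mult_left) (auto simp: emeasure_eq_measure)
      show "AE \<omega> in M. indicator (B j) \<omega> * Y \<omega> \<le> indicator (B j) \<omega> * (- K + (j + 1) * e) + \<bar>Y \<omega> - Z \<omega>\<bar>"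
        using K(2)
      proof eventually_elim
        case (elim \<omega>)
        have "Y \<omega> \<le> - K + (j + 1) * e + \<bar>Y \<omega> - Z \<omega>\<bar>" if "\<omega> \<in> B j"
        proof -
          have "b \<omega> = j" using that by (simp add: B_def)
          then have "Z \<omega> \<le> - K + (j + 1) * e" using bZ[OF elim, of j] by (simp add: algebra_simps)
          then show ?thesis by linarith
        qed
        then show ?case by (cases "\<omega> \<in> B j") simp_all
      qed
    qed
    also have "(\<integral>\<omega>. indicator (B j) \<omega> * (- K + (j + 1) * e) + \<bar>Y \<omega> - Z \<omega>\<bar> \<partial>M)
        = prob (B j) * (- K + (j + 1) * e) + (\<integral>\<omega>. \<bar>Y \<omega> - Z \<omega>\<bar> \<partial>M)"
      using intYZ by (subst Bochner_Integration.integral_add) (auto simp: emeasure_eq_measure)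
    also have "\<dots> \<le> prob (B j) * (- K + (j + 1) * e) + e * prob (B j)"
      using YZ qB[OF j] e by (intro add_left_mono) (meson mult_left_mono less_imp_le order_trans)
    also have "\<dots> / prob (B j) = - K + j * e + 2 * e"
      using j by (simp add: field_simps)
    finally show ?thesis using j by (simp add: m_def divide_right_mono)
  qed
  have "(\<lambda>\<omega>. if b \<omega> < k then m (b \<omega>) else Y \<omega>) \<in> A"
    using A_average_bins[OF Y(1) b e, of k] unfolding m_def B_def .
  then show ?thesis
  proof (rule A_mono[OF _ Linf_shift[OF Z]])
    \<comment> \<open>On null bins the value \<open>m j\<close> carries no information, so these
      finitely many bins are discarded together.\<close>
    have "AE \<omega> in M. \<forall>j\<in>{j. j < k \<and> prob (B j) = 0}. \<omega> \<notin> B j"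
      by (subst AE_finite_all) (auto intro!: AE_not_in simp: null_sets_def emeasure_eq_measure)
    then show "AE \<omega> in M. (if b \<omega> < k then m (b \<omega>) else Y \<omega>) \<le> Z \<omega> + e0"
      using K(2) AE_space
    proof eventually_elim
      case (elim \<omega>)
      have "prob (B (b \<omega>)) > 0" using elim bk[of \<omega>] by (auto simp: B_def zero_less_measure_iff)
      then have "m (b \<omega>) \<le> - K + b \<omega> * e + 3 * e" using mle bk by auto
      then show ?case using bZ[OF elim(2) refl] bk[of \<omega>] by (simp add: e_def)
    qed
  qed
qed

end

section \<open>Semicontinuity of the risk measure\<close>

text \<open>Stands in for the triangle inequality of the p-norm; the constant is harmless because
  only small neighbourhoods matter.\<close>

lemma abs_add_powr_le:
  fixes a b p :: real
  assumes "0 < p"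
  shows "\<bar>a + b\<bar> powr p \<le> 2 powr p * (\<bar>a\<bar> powr p + \<bar>b\<bar> powr p)"
proof -
  have "\<bar>a + b\<bar> powr p \<le> (2 * max \<bar>a\<bar> \<bar>b\<bar>) powr p"
    using assms by (intro powr_mono2) auto
  also have "\<dots> = 2 powr p * max \<bar>a\<bar> \<bar>b\<bar> powr p" by (intro powr_mult)
  also have "\<dots> \<le> 2 powr p * (\<bar>a\<bar> powr p + \<bar>b\<bar> powr p)"
    by (intro mult_left_mono) (auto simp: max_def)
  finally show ?thesis .
qed

text \<open>The estimates below are made with p-th moments; roots occur only at the interface with
  \<open>Clp\<close> and \<open>Lp_nonempty_interior\<close>.\<close>

lemma Lp_dist_less_iff:
  assumes "0 < p" "0 < r"
  shows "Lp_dist M p X Y < r \<longleftrightarrow> (\<integral>\<omega>. \<bar>X \<omega> - Y \<omega>\<bar> powr p \<partial>M) < r powr p"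
proof -
  define I where "I = (\<integral>\<omega>. \<bar>X \<omega> - Y \<omega>\<bar> powr p \<partial>M)"
  have I: "I \<ge> 0" unfolding I_def by (rule integral_nonneg_AE) simp
  have "I powr (1/p) < r \<longleftrightarrow> (I powr (1/p)) powr p < r powr p"
    using assms by (metis powr_ge_zero powr_less_mono2 powr_mono2 not_less less_imp_le)
  also have "(I powr (1/p)) powr p = I" using I assms by (simp add: powr_powr)
  finally show ?thesis by (simp add: Lp_dist_def I_def)
qed

context prob_space begin

lemma Linf_integrable_powr:
  assumes "X \<in> Linf M" "0 < p"
  shows "integrable M (\<lambda>\<omega>. \<bar>X \<omega>\<bar> powr p)"
proof -
  obtain C where C: "0 \<le> C" "X \<in> borel_measurable M" "AE \<omega> in M. \<bar>X \<omega>\<bar> \<le> C"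
    using assms(1) by (rule LinfE)
  note [measurable] = C(2)
  show ?thesis
    by (rule integrable_const_bound[of _ "C powr p"])
       (use C(3) assms(2) in \<open>auto elim!: eventually_mono intro!: powr_mono2\<close>)
qed

lemma Linf_Lp: "X \<in> Linf M \<Longrightarrow> 0 < p \<Longrightarrow> X \<in> Lp M p"
  using Linf_integrable_powr[of X p] by (auto simp: Lp_def Linf_measurable)

lemma Lp_integrable_diff:
  assumes X: "X \<in> Lp M p" and Y: "Y \<in> Lp M p" and p: "0 < p"
  shows "integrable M (\<lambda>\<omega>. \<bar>X \<omega> - Y \<omega>\<bar> powr p)"
proof (rule Bochner_Integration.integrable_bound)
  have [measurable]: "X \<in> borel_measurable M" "Y \<in> borel_measurable M"
    using X Y by (simp_all add: Lp_def)
  show "integrable M (\<lambda>\<omega>. 2 powr p * (\<bar>X \<omega>\<bar> powr p + \<bar>Y \<omega>\<bar> powr p))"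
    using X Y by (simp add: Lp_def)
  show "(\<lambda>\<omega>. \<bar>X \<omega> - Y \<omega>\<bar> powr p) \<in> borel_measurable M" by measurable
  show "AE \<omega> in M. norm (\<bar>X \<omega> - Y \<omega>\<bar> powr p) \<le> norm (2 powr p * (\<bar>X \<omega>\<bar> powr p + \<bar>Y \<omega>\<bar> powr p))"
    using abs_add_powr_le[OF p, of "X \<omega>" "- Y \<omega>" for \<omega>] by (intro AE_I2) simp
qed

lemma Lp_diff_triangle:
  assumes X: "X \<in> Lp M p" and Y: "Y \<in> Lp M p" and Z: "Z \<in> Lp M p" and p: "0 < p"
  shows "(\<integral>\<omega>. \<bar>X \<omega> - Z \<omega>\<bar> powr p \<partial>M) \<le>
    2 powr p * ((\<integral>\<omega>. \<bar>X \<omega> - Y \<omega>\<bar> powr p \<partial>M) + (\<integral>\<omega>. \<bar>Y \<omega> - Z \<omega>\<bar> powr p \<partial>M))"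
proof -
  have "(\<integral>\<omega>. \<bar>X \<omega> - Z \<omega>\<bar> powr p \<partial>M) \<le>
      (\<integral>\<omega>. 2 powr p * (\<bar>X \<omega> - Y \<omega>\<bar> powr p + \<bar>Y \<omega> - Z \<omega>\<bar> powr p) \<partial>M)"
    using abs_add_powr_le[OF p, of "X \<omega> - Y \<omega>" "Y \<omega> - Z \<omega>" for \<omega>]
    by (intro integral_mono) (use assms Lp_integrable_diff in auto)
  then show ?thesis using assms by (simp add: Lp_integrable_diff)
qed

text \<open>Clipping at level \<open>n\<close> and dominated convergence. The pointwise bound by
  \<open>X\<close> keeps the truncation inside a ball around 0 that contains
  \<open>X\<close>.\<close>

lemma Lp_truncation:
  assumes X: "X \<in> Lp M p" and p: "0 < p" and d: "d > 0"
  shows "\<exists>Z\<in>Linf M. (\<forall>\<omega>. \<bar>Z \<omega>\<bar> \<le> \<bar>X \<omega>\<bar>) \<and> (\<integral>\<omega>. \<bar>X \<omega> - Z \<omega>\<bar> powr p \<partial>M) < d"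
proof -
  have [measurable]: "X \<in> borel_measurable M" and int: "integrable M (\<lambda>\<omega>. \<bar>X \<omega>\<bar> powr p)"
    using X by (auto simp: Lp_def)
  define Z where "Z n \<omega> = max (- real n) (min (real n) (X \<omega>))" for n \<omega>
  have "(\<lambda>n. \<integral>\<omega>. \<bar>X \<omega> - Z n \<omega>\<bar> powr p \<partial>M) \<longlonglongrightarrow> (\<integral>\<omega>. 0 \<partial>M)"
  proof (rule integral_dominated_convergence[where w = "\<lambda>\<omega>. \<bar>X \<omega>\<bar> powr p"])
    show "AE \<omega> in M. (\<lambda>n. \<bar>X \<omega> - Z n \<omega>\<bar> powr p) \<longlonglongrightarrow> 0"
    proof (rule AE_I2)
      fix \<omega>
      obtain N :: nat where N: "\<bar>X \<omega>\<bar> \<le> real N" using real_arch_simple by blast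
      have "\<forall>\<^sub>F n in sequentially. \<bar>X \<omega> - Z n \<omega>\<bar> powr p = 0"
        using eventually_ge_at_top[of N]
      proof eventually_elim
        case (elim n)
        then have "real N \<le> real n" by simp
        with N have "Z n \<omega> = X \<omega>" unfolding Z_def by auto
        then show ?case by simp
      qed
      then show "(\<lambda>n. \<bar>X \<omega> - Z n \<omega>\<bar> powr p) \<longlonglongrightarrow> 0" by (rule tendsto_eventually)
    qed
    show "AE \<omega> in M. norm (\<bar>X \<omega> - Z n \<omega>\<bar> powr p) \<le> \<bar>X \<omega>\<bar> powr p" for n
    proof (rule AE_I2)
      fix \<omega>
      have "\<bar>X \<omega> - Z n \<omega>\<bar> \<le> \<bar>X \<omega>\<bar>" unfolding Z_def by auto
      then show "norm (\<bar>X \<omega> - Z n \<omega>\<bar> powr p) \<le> \<bar>X \<omega>\<bar> powr p" using p by (simp add: powr_mono2)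
    qed
    show "(\<lambda>\<omega>. \<bar>X \<omega> - Z n \<omega>\<bar> powr p) \<in> borel_measurable M" for n
      unfolding Z_def by measurable
  qed (use int in auto)
  then have "(\<lambda>n. \<integral>\<omega>. \<bar>X \<omega> - Z n \<omega>\<bar> powr p \<partial>M) \<longlonglongrightarrow> 0" by simp
  from order_tendstoD(2)[OF this d] obtain n where n: "(\<integral>\<omega>. \<bar>X \<omega> - Z n \<omega>\<bar> powr p \<partial>M) < d"
    by (meson eventually_happens' trivial_limit_sequentially)
  have "Z n \<in> Linf M"
  proof (rule LinfI)
    show "Z n \<in> borel_measurable M" unfolding Z_def by measurable
    show "AE \<omega> in M. \<bar>Z n \<omega>\<bar> \<le> real n" by (rule AE_I2) (auto simp: Z_def)
  qed
  moreover have "\<bar>Z n \<omega>\<bar> \<le> \<bar>X \<omega>\<bar>" for \<omega> unfolding Z_def by auto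
  ultimately show ?thesis using n by blast
qed

end

section \<open>Convexity: local bounds, continuity and the interior of the closure\<close>

context convex_acceptance begin

text \<open>The centre of the ball may be unbounded, so it is replaced by a truncation. Bounded
  variables in the closure are acceptable after adding any \<open>e > 0\<close>, whence their risk
  is at most 0.\<close>

lemma interior_imp_rho_local_bound:
  assumes p: "1 \<le> p" and int: "Lp_nonempty_interior M p (Clp M p A)"
  shows "\<exists>Z0\<in>Linf M. \<exists>d>0. \<forall>Z\<in>Linf M. (\<integral>\<omega>. \<bar>Z \<omega> - Z0 \<omega>\<bar> powr p \<partial>M) < d \<longrightarrow> rho A Z \<le> 0"
proof -
  have p0: "0 < p" using p by simp
  obtain X r where X: "X \<in> Lp M p" and r: "r > 0"
    and ball: "\<And>Y. Y \<in> Lp M p \<Longrightarrow> Lp_dist M p X Y < r \<Longrightarrow> Y \<in> Clp M p A"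
    using int unfolding Lp_nonempty_interior_def by auto
  \<comment> \<open>Two errors of size \<open>d\<close>, enlarged by the factor
    \<open>2 powr p\<close> of \<open>Lp_diff_triangle\<close>, add up to
    \<open>r powr p\<close>.\<close>
  define d where "d = r powr p / (2 * 2 powr p)"
  have d: "d > 0" using r by (simp add: d_def)
  obtain Z0 where Z0: "Z0 \<in> Linf M" "(\<integral>\<omega>. \<bar>X \<omega> - Z0 \<omega>\<bar> powr p \<partial>M) < d"
    using Lp_truncation[OF X p0 d] by auto
  have "rho A Z \<le> 0" if Z: "Z \<in> Linf M" "(\<integral>\<omega>. \<bar>Z \<omega> - Z0 \<omega>\<bar> powr p \<partial>M) < d" for Z
  proof -
    have "(\<integral>\<omega>. \<bar>X \<omega> - Z \<omega>\<bar> powr p \<partial>M) \<le>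
        2 powr p * ((\<integral>\<omega>. \<bar>X \<omega> - Z0 \<omega>\<bar> powr p \<partial>M) + (\<integral>\<omega>. \<bar>Z0 \<omega> - Z \<omega>\<bar> powr p \<partial>M))"
      by (rule Lp_diff_triangle) (use X Z Z0 p0 Linf_Lp in auto)
    also have "\<dots> < 2 powr p * (d + d)"
      using Z(2) Z0(2) by (intro mult_strict_left_mono add_strict_mono) (auto simp: abs_minus_commute)
    also have "\<dots> = r powr p" by (simp add: d_def)
    finally have "Z \<in> Clp M p A"
      using ball Z(1) p0 r by (simp add: Lp_dist_less_iff Linf_Lp)
    then have cl: "\<And>e. e > 0 \<Longrightarrow> \<exists>Y\<in>A. Lp_dist M p Z Y < e" by (simp add: Clp_def)
    have "(\<lambda>\<omega>. Z \<omega> + e) \<in> A" if e: "e > 0" for e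
    proof (rule A_Lp_closure[OF Z(1) p _ e])
      fix d :: real assume d: "d > 0"
      then obtain Y where Y: "Y \<in> A" "Lp_dist M p Z Y < d powr (1/p)" using cl[of "d powr (1/p)"] by auto
      then have "(\<integral>\<omega>. \<bar>Z \<omega> - Y \<omega>\<bar> powr p \<partial>M) < (d powr (1/p)) powr p"
        using Lp_dist_less_iff[OF p0, of "d powr (1/p)" M Z Y] d by simp
      then show "\<exists>Y\<in>A. (\<integral>\<omega>. \<bar>Y \<omega> - Z \<omega>\<bar> powr p \<partial>M) < d"
        using Y d p0 by (intro bexI[of _ Y]) (simp_all add: powr_powr abs_minus_commute)
    qed
    then have "rho A Z \<le> 0 + e" if "e > 0" for e using rho_le[OF Z(1), of e] that by simp
    then show ?thesis by (rule field_le_epsilon)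
  qed
  then show ?thesis using Z0(1) d by blast
qed

text \<open>The classical transfer of a local upper bound of a convex function. \<open>Y\<close> is
  written as \<open>l * Z + (1 - l) * X1\<close> with \<open>Z\<close> in the ball around
  \<open>Z0\<close> and \<open>X1\<close> slightly beyond \<open>X\<close> on the line from
  \<open>Z0\<close>. \<open>X1\<close> is uniformly close to \<open>X\<close>, so the sup-norm
  estimate suffices for its risk.\<close>

lemma rho_upper_semicontinuous:
  assumes p: "1 \<le> p" and int: "Lp_nonempty_interior M p (Clp M p A)"
    and X: "X \<in> Linf M" and e: "e > 0"
  shows "\<exists>d>0. \<forall>Y\<in>Linf M. (\<integral>\<omega>. \<bar>Y \<omega> - X \<omega>\<bar> powr p \<partial>M) < d \<longrightarrow> rho A Y < rho A X + e"
proof -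
  obtain Z0 d0 where Z0: "Z0 \<in> Linf M" and d0: "d0 > 0"
    and bnd: "\<And>Z. Z \<in> Linf M \<Longrightarrow> (\<integral>\<omega>. \<bar>Z \<omega> - Z0 \<omega>\<bar> powr p \<partial>M) < d0 \<Longrightarrow> rho A Z \<le> 0"
    using interior_imp_rho_local_bound[OF p int] by blast
  obtain K where K: "0 \<le> K" "AE \<omega> in M. \<bar>X \<omega> - Z0 \<omega>\<bar> \<le> K" using Linf_diff[OF X Z0] by (rule LinfE)
  \<comment> \<open>\<open>l \<le> 1/2\<close> bounds \<open>l / (1 - l)\<close> by
    \<open>2 * l\<close>; the other term makes both losses, \<open>2 * l * K\<close> from moving to
    \<open>X1\<close> and \<open>l * |rho A X|\<close> from the factor \<open>1 - l\<close>, at most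
    \<open>e / 2\<close> in total. The summand 1 keeps the denominator positive.\<close>
  define l where "l = min (1/2) (e / 2 / (2 * K + \<bar>rho A X\<bar> + 1))"
  have D: "2 * K + \<bar>rho A X\<bar> + 1 > 0" using K by simp
  have l: "0 < l" "l \<le> 1/2" using e D unfolding l_def by (simp, intro min.cobounded1)
  have "l * (2 * K + \<bar>rho A X\<bar> + 1) \<le> (e / 2 / (2 * K + \<bar>rho A X\<bar> + 1)) * (2 * K + \<bar>rho A X\<bar> + 1)"
    using D by (intro mult_right_mono) (auto simp: l_def)
  also have "\<dots> = e / 2" using D by (intro nonzero_eq_divide_eq[THEN iffD1, OF _ refl]) linarith
  finally have le: "l * (2 * K + \<bar>rho A X\<bar> + 1) \<le> e / 2" .
  define X1 where "X1 \<omega> = X \<omega> + (l / (1 - l)) * (X \<omega> - Z0 \<omega>)" for \<omega>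
  have X1: "X1 \<in> Linf M"
    unfolding X1_def[abs_def] by (intro Linf_add X Linf_cmult Linf_diff Z0)
  have "AE \<omega> in M. X \<omega> \<le> X1 \<omega> + 2 * l * K"
    using K(2)
  proof eventually_elim
    case (elim \<omega>)
    have c: "0 \<le> l / (1 - l)" "l / (1 - l) \<le> 2 * l" using l mult_left_mono[of l "1/2" "2*l"]
      by (auto simp: field_simps)
    have "(l / (1 - l)) * (Z0 \<omega> - X \<omega>) \<le> (l / (1 - l)) * K" using c elim by (intro mult_left_mono) auto
    moreover have "(l / (1 - l)) * K \<le> 2 * l * K" using c K by (intro mult_right_mono) auto
    moreover have "X1 \<omega> = X \<omega> - (l / (1 - l)) * (Z0 \<omega> - X \<omega>)"
      unfolding X1_def right_diff_distrib by simp
    ultimately show ?case by linarith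
  qed
  then have r1: "rho A X1 \<le> rho A X + 2 * l * K" by (rule rho_mono_shift[OF X X1])
  have r2: "(1 - l) * rho A X1 < rho A X + e"
  proof -
    have "(1 - l) * rho A X1 \<le> (1 - l) * (rho A X + 2 * l * K)" using l r1 by (intro mult_left_mono) auto
    also have "\<dots> = rho A X - l * rho A X + (1 - l) * (2 * l * K)" by (simp add: algebra_simps)
    also have "\<dots> \<le> rho A X + l * \<bar>rho A X\<bar> + 2 * l * K"
    proof -
      have "- l * rho A X \<le> l * \<bar>rho A X\<bar>" using l by (metis abs_ge_minus_self mult.commute mult_minus_left mult_minus_right mult_left_mono less_imp_le)
      moreover have "(1 - l) * (2 * l * K) \<le> 1 * (2 * l * K)" using l K by (intro mult_right_mono) auto
      ultimately show ?thesis by linarith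
    qed
    also have "\<dots> < rho A X + e" using le l e by (simp add: algebra_simps)
    finally show ?thesis .
  qed
  show ?thesis
  \<comment> \<open>\<open>Z - Z0\<close> is \<open>Y - X\<close> stretched by \<open>1 / l\<close>,
    so its p-th moment grows by \<open>(1 / l) powr p\<close>.\<close>
  proof (intro exI[of _ "l powr p * d0"] conjI ballI impI)
    show "0 < l powr p * d0" using l d0 by simp
    fix Y assume Y: "Y \<in> Linf M" and c: "(\<integral>\<omega>. \<bar>Y \<omega> - X \<omega>\<bar> powr p \<partial>M) < l powr p * d0"
    define Z where "Z \<omega> = Z0 \<omega> + (1 / l) * (Y \<omega> - X \<omega>)" for \<omega>
    have Z: "Z \<in> Linf M"
      unfolding Z_def[abs_def] by (intro Linf_add X Y Linf_cmult Linf_diff Z0)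
    have "(\<integral>\<omega>. \<bar>Z \<omega> - Z0 \<omega>\<bar> powr p \<partial>M) = (\<integral>\<omega>. (1 / l) powr p * \<bar>Y \<omega> - X \<omega>\<bar> powr p \<partial>M)"
      using l by (intro Bochner_Integration.integral_cong refl)
        (simp only: Z_def add_diff_cancel_left' abs_mult powr_mult, simp)
    also have "\<dots> = (1 / l) powr p * (\<integral>\<omega>. \<bar>Y \<omega> - X \<omega>\<bar> powr p \<partial>M)" by simp
    also have "\<dots> < (1 / l) powr p * (l powr p * d0)" using c l by (intro mult_strict_left_mono) auto
    also have "\<dots> = d0" using l by (simp add: powr_divide)
    finally have "rho A Z \<le> 0" by (rule bnd[OF Z])
    then have "l * rho A Z \<le> 0" using l by (simp add: mult_le_0_iff)
    moreover have "rho A (\<lambda>\<omega>. l * Z \<omega> + (1 - l) * X1 \<omega>) \<le> l * rho A Z + (1 - l) * rho A X1"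
      by (rule rho_convex[OF Z X1]) (use l in auto)
    moreover have "(\<lambda>\<omega>. l * Z \<omega> + (1 - l) * X1 \<omega>) = Y"
      using l by (auto simp: Z_def X1_def fun_eq_iff field_simps)
    ultimately show "rho A Y < rho A X + e" using r2 by simp
  qed
qed

text \<open>The lower bound comes from the upper one by reflection: \<open>X\<close> is the midpoint
  of \<open>Y\<close> and \<open>2 * X - Y\<close>, which is just as close to
  \<open>X\<close>.\<close>

lemma rho_continuous:
  assumes p: "1 \<le> p" and int: "Lp_nonempty_interior M p (Clp M p A)"
    and X: "X \<in> Linf M" and e: "e > 0"
  shows "\<exists>d>0. \<forall>Y\<in>Linf M. (\<integral>\<omega>. \<bar>Y \<omega> - X \<omega>\<bar> powr p \<partial>M) < d \<longrightarrow> \<bar>rho A Y - rho A X\<bar> < e"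
proof -
  obtain d where d: "d > 0" and up: "\<And>Y. Y \<in> Linf M \<Longrightarrow> (\<integral>\<omega>. \<bar>Y \<omega> - X \<omega>\<bar> powr p \<partial>M) < d \<Longrightarrow> rho A Y < rho A X + e"
    using rho_upper_semicontinuous[OF p int X e] by blast
  have "\<bar>rho A Y - rho A X\<bar> < e" if Y: "Y \<in> Linf M" "(\<integral>\<omega>. \<bar>Y \<omega> - X \<omega>\<bar> powr p \<partial>M) < d" for Y
  proof -
    define Y' where "Y' \<omega> = 2 * X \<omega> - Y \<omega>" for \<omega>
    have Y': "Y' \<in> Linf M" unfolding Y'_def[abs_def] by (intro Linf_diff Linf_cmult X Y)
    have "(\<integral>\<omega>. \<bar>Y' \<omega> - X \<omega>\<bar> powr p \<partial>M) < d"
      using Y(2) by (simp add: Y'_def abs_minus_commute)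
    from up[OF Y' this] have 1: "rho A Y' < rho A X + e" .
    have "rho A (\<lambda>\<omega>. (1/2) * Y \<omega> + (1 - 1/2) * Y' \<omega>) \<le> (1/2) * rho A Y + (1 - 1/2) * rho A Y'"
      by (rule rho_convex[OF Y(1) Y']) auto
    moreover have "(\<lambda>\<omega>. (1/2) * Y \<omega> + (1 - 1/2) * Y' \<omega>) = X" by (auto simp: Y'_def fun_eq_iff field_simps)
    ultimately have "rho A X \<le> (1/2) * rho A Y + (1/2) * rho A Y'" by simp
    then show ?thesis using 1 up[OF Y] by linarith
  qed
  then show ?thesis using d by blast
qed

text \<open>The criterion whose failure produces the bad sequence in the converse.\<close>

lemma rho_bound_imp_interior:
  assumes p: "1 \<le> p" and d: "d > 0"
    and bnd: "\<And>W. W \<in> Linf M \<Longrightarrow> (\<integral>\<omega>. \<bar>W \<omega>\<bar> powr p \<partial>M) < d \<Longrightarrow> rho A W \<le> c"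
  shows "Lp_nonempty_interior M p (Clp M p A)"
proof -
  have p0: "0 < p" using p by simp
  \<comment> \<open>The extra 1 makes \<open>rho A W < c + 1\<close> strict, since the infimum
    defining \<open>rho\<close> need not be attained.\<close>
  define X where "X = (\<lambda>_::'a. c + 1)"
  have X: "X \<in> Lp M p" unfolding X_def by (intro Linf_Lp p0) simp
  have "Y \<in> Clp M p A" if Y: "Y \<in> Lp M p" "Lp_dist M p X Y < d powr (1/p)" for Y
  proof -
    define V where "V \<omega> = Y \<omega> - (c + 1)" for \<omega>
    have Ym: "Y \<in> borel_measurable M" using Y by (simp add: Lp_def)
    have intV: "integrable M (\<lambda>\<omega>. \<bar>V \<omega>\<bar> powr p)"
      using Lp_integrable_diff[OF Y(1) X p0] by (simp add: V_def X_def)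
    have V: "V \<in> Lp M p" using Ym intV by (simp add: Lp_def V_def[abs_def])
    have "(\<integral>\<omega>. \<bar>X \<omega> - Y \<omega>\<bar> powr p \<partial>M) < (d powr (1/p)) powr p"
      using Y(2) d p0 by (simp add: Lp_dist_less_iff)
    then have Vd: "(\<integral>\<omega>. \<bar>V \<omega>\<bar> powr p \<partial>M) < d"
      using d p0 by (simp add: powr_powr V_def X_def abs_minus_commute)
    have "\<exists>U\<in>A. Lp_dist M p Y U < e" if e: "e > 0" for e
    proof -
      have "e powr p > 0" using e by simp
      then obtain W where W: "W \<in> Linf M" "\<And>\<omega>. \<bar>W \<omega>\<bar> \<le> \<bar>V \<omega>\<bar>" "(\<integral>\<omega>. \<bar>V \<omega> - W \<omega>\<bar> powr p \<partial>M) < e powr p"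
        using Lp_truncation[OF V p0] by blast
      have "(\<integral>\<omega>. \<bar>W \<omega>\<bar> powr p \<partial>M) \<le> (\<integral>\<omega>. \<bar>V \<omega>\<bar> powr p \<partial>M)"
        by (intro integral_mono) (use intV Linf_integrable_powr[OF W(1) p0] W(2) p0 in \<open>auto intro: powr_mono2\<close>)
      then have "rho A W \<le> c" using bnd[OF W(1)] Vd by simp
      then have WA: "(\<lambda>\<omega>. W \<omega> + (c + 1)) \<in> A" by (intro rho_less_imp[OF W(1)]) simp
      have "Lp_dist M p Y (\<lambda>\<omega>. W \<omega> + (c + 1)) < e"
        using W(3) by (subst Lp_dist_less_iff[OF p0 e]) (simp add: V_def algebra_simps)
      then show ?thesis using WA by blast
    qed
    then show ?thesis using Y(1) by (simp add: Clp_def)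
  qed
  then show ?thesis unfolding Lp_nonempty_interior_def
    using X d by (intro bexI[of _ X] exI[of _ "d powr (1/p)"]) auto
qed

text \<open>If it failed, variables \<open>Y + (c + e)\<close> in \<open>A\<close> would approximate
  \<open>X + (c + e)\<close>, and the closure property would put \<open>X + (c + 2 * e)\<close> into
  \<open>A\<close>, whereas \<open>rho A X\<close> is \<open>c + 3 * e\<close>.\<close>

lemma rho_lower_semicontinuous:
  assumes p: "1 \<le> p" and X: "X \<in> Linf M" and c: "c < rho A X"
  shows "\<exists>d>0. \<forall>Y\<in>Linf M. (\<integral>\<omega>. \<bar>Y \<omega> - X \<omega>\<bar> powr p \<partial>M) < d \<longrightarrow> c < rho A Y"
proof (rule ccontr)
  assume neg: "\<not> ?thesis"
  define e where "e = (rho A X - c) / 3"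
  have e: "e > 0" using c by (simp add: e_def)
  have "(\<lambda>\<omega>. (X \<omega> + (c + e)) + e) \<in> A"
  proof (rule A_Lp_closure[OF Linf_shift[OF X] p _ e])
    fix d :: real assume "d > 0"
    then obtain Y where Y: "Y \<in> Linf M" "(\<integral>\<omega>. \<bar>Y \<omega> - X \<omega>\<bar> powr p \<partial>M) < d" "rho A Y \<le> c"
      using neg by (meson not_less)
    have "(\<lambda>\<omega>. Y \<omega> + (c + e)) \<in> A" by (rule rho_less_imp[OF Y(1)]) (use Y e in simp)
    then show "\<exists>Y\<in>A. (\<integral>\<omega>. \<bar>Y \<omega> - (X \<omega> + (c + e))\<bar> powr p \<partial>M) < d"
      by (rule rev_bexI) (use Y in simp)
  qed
  then have "(\<lambda>\<omega>. X \<omega> + (c + e + e)) \<in> A" by (simp add: add.assoc)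
  then have "rho A X \<le> c + e + e" by (rule rho_le[OF X])
  then show False using c by (simp add: e_def field_simps)
qed

end

section \<open>Quantile coupling\<close>

text \<open>Off the exceptional set of levels \<open>u\<close> within \<open>\<tau>\<close> of a value of the first cdf on the grid
  \<open>h\<int>\<close>, closeness of the cdfs on the grid forces both quantiles into neighbouring grid cells.\<close>

lemma quantile_coupling_bound:
  fixes m :: nat and p h K L \<tau> :: real
  assumes mu: "real_distribution \<mu>" and nu: "real_distribution \<nu>" and p: "1 \<le> p"
    and K: "AE x in \<mu>. \<bar>x\<bar> \<le> K" "K \<le> L" "0 < L" and h: "0 < h" and m: "L \<le> m * h" and tau: "0 < \<tau>"
    and cdfs: "\<And>j::int. \<bar>j\<bar> \<le> m + 1 \<Longrightarrow> cdf \<nu> (j * h) \<le> cdf \<mu> ((j + 1) * h) + \<tau>"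
      "\<And>j::int. \<bar>j\<bar> \<le> m + 1 \<Longrightarrow> cdf \<mu> ((j - 1) * h) \<le> cdf \<nu> (j * h) + \<tau>"
    and int: "integrable \<nu> (\<lambda>x. \<bar>x\<bar> powr p)"
  shows "(\<integral>u. \<bar>quantile \<nu> u - quantile \<mu> u\<bar> powr p \<partial>Uni) \<le>
    (2 * h) powr p + (2 * L) powr p * ((2 * m + 5) * (2 * \<tau>))
      + 2 powr p * (\<integral>x. indicator {x. \<bar>x\<bar> > L} x * \<bar>x\<bar> powr p \<partial>\<nu>)"
proof -
  interpret Uni: prob_space Uni by (rule prob_space_Uni)
  \<comment> \<open>The indices \<open>j + 1\<close> and \<open>j - 2\<close> with
    \<open>|j| \<le> m\<close> all fall in this range; its size gives the factor
    \<open>2 * m + 5\<close>.\<close>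
  define J where "J = {- (int m + 2)..int m + 2}"
  define T where "T i = {cdf \<mu> (of_int i * h) - \<tau>..cdf \<mu> (of_int i * h) + \<tau>} \<inter> {0<..<1}" for i :: int
  define E where "E = (\<Union>i\<in>J. T i)"
  define g where "g x = indicator {x. \<bar>x\<bar> > L} x * \<bar>x\<bar> powr p" for x :: real
  have Tm: "T i \<in> sets Uni" for i by (auto simp: T_def sets_restrict_space_iff)
  have Em: "E \<in> sets Uni" unfolding E_def using Tm by (auto simp: J_def)
  have "measure Uni (T i) \<le> 2 * \<tau>" for i
  proof -
    have "measure Uni (T i) = measure lborel (T i)"
      by (subst measure_restrict_space) (auto simp: T_def)
    also have "\<dots> \<le> measure lborel {cdf \<mu> (of_int i * h) - \<tau>..cdf \<mu> (of_int i * h) + \<tau>}"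
      by (intro measure_mono_fmeasurable fmeasurable_compact) (auto simp: T_def)
    finally show ?thesis using tau by simp
  qed
  moreover have "measure Uni E \<le> (\<Sum>i\<in>J. measure Uni (T i))"
    unfolding E_def by (rule Uni.finite_measure_subadditive_finite) (use Tm in \<open>auto simp: J_def\<close>)
  ultimately have "measure Uni E \<le> (\<Sum>i\<in>J. 2 * \<tau>)" by (meson order_trans sum_mono)
  also have "\<dots> = (2 * m + 5) * (2 * \<tau>)" by (simp add: J_def)
  finally have mE: "measure Uni E \<le> (2 * m + 5) * (2 * \<tau>)" .
  have main: "\<bar>quantile \<nu> u - quantile \<mu> u\<bar> powr p \<le>
      (2 * h) powr p + (2 * L) powr p * indicator E u + 2 powr p * g (quantile \<nu> u)" if u: "u \<in> {0<..<1}" for u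
  proof -
    define x where "x = quantile \<mu> u"
    define y where "y = quantile \<nu> u"
    have xK: "\<bar>x\<bar> \<le> K" unfolding x_def by (rule quantile_bounded[OF mu K(1) u])
    have nn: "0 \<le> (2 * h) powr p" "0 \<le> (2 * L) powr p * indicator E u" "0 \<le> 2 powr p * g y"
      by (auto simp: g_def)
    \<comment> \<open>Three cases, one per summand: \<open>y\<close> beyond \<open>L\<close>, where
      \<open>|x| \<le> |y|\<close>; an exceptional level, where both are at most \<open>L\<close>;
      and the regular case.\<close>
    have "\<bar>y - x\<bar> powr p \<le> (2 * h) powr p + (2 * L) powr p * indicator E u + 2 powr p * g y"
    proof (cases "\<bar>y\<bar> > L")
      case True
      have "\<bar>y - x\<bar> powr p \<le> (2 * \<bar>y\<bar>) powr p" using True xK K p by (intro powr_mono2) auto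
      also have "\<dots> = 2 powr p * g y" using True by (simp add: g_def powr_mult)
      finally show ?thesis using nn by linarith
    next
      case yL: False
      show ?thesis
      proof (cases "u \<in> E")
        case True
        have "\<bar>y - x\<bar> powr p \<le> (2 * L) powr p" using yL xK K p by (intro powr_mono2) auto
        moreover have "(2 * L) powr p * indicator E u = (2 * L) powr p" using True by simp
        ultimately show ?thesis using nn by linarith
      next
        case False
        \<comment> \<open>\<open>y\<close> lies in the cell from \<open>(j - 1) * h\<close>
          (excluded) to \<open>j * h\<close> (included).\<close>
        define j where "j = \<lceil>y / h\<rceil>"
        have j: "of_int j - 1 < y / h" "y / h \<le> of_int j" unfolding j_def by linarith+
        have jy: "(of_int j - 1) * h < y" "y \<le> of_int j * h" using j h by (auto simp: field_simps)
        have "y / h \<le> m" "- m \<le> y / h" using yL m h by (auto simp: field_simps)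
        then have "real_of_int j < real_of_int (int m + 1)" "real_of_int (- int m) \<le> real_of_int j"
          using j by simp_all
        then have jm: "\<bar>j\<bar> \<le> int m" unfolding of_int_less_iff of_int_le_iff by linarith
        have nE: "\<bar>u - cdf \<mu> (of_int i * h)\<bar> > \<tau>" if "i \<in> J" for i
          using False that u by (auto simp: E_def T_def abs_le_iff not_le)
        have a1: "u \<le> cdf \<nu> (of_int j * h)"
          using jy(2) quantile_le_iff[OF nu u] by (simp add: y_def)
        have a2: "cdf \<nu> ((of_int j - 1) * h) < u"
          using jy(1) quantile_le_iff[OF nu u, of "(of_int j - 1) * h"] by (simp add: y_def not_le[symmetric])
        \<comment> \<open>Off \<open>E\<close> the level \<open>u\<close> is more than \<tau> away
          from each grid value of \<open>cdf \<mu>\<close>, so inequalities with error \<tau> become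
          exact. This places \<open>x\<close> between \<open>(j - 2) * h\<close> and
          \<open>(j + 1) * h\<close>, within \<open>2 * h\<close> of \<open>y\<close>.\<close>
        have "u \<le> cdf \<mu> (of_int (j + 1) * h) + \<tau>" using a1 cdfs(1)[of j] jm by simp
        moreover have "j + 1 \<in> J" using jm by (auto simp: J_def)
        ultimately have "u \<le> cdf \<mu> (of_int (j + 1) * h)" using nE[of "j + 1"] tau by linarith
        then have b1: "x \<le> (of_int j + 1) * h" using quantile_le_iff[OF mu u] by (simp add: x_def)
        have "cdf \<mu> (of_int (j - 2) * h) \<le> cdf \<nu> ((of_int j - 1) * h) + \<tau>"
          using cdfs(2)[of "j - 1"] jm by (simp add: diff_diff_eq)
        then have "cdf \<mu> (of_int (j - 2) * h) < u + \<tau>" using a2 by linarith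
        moreover have "j - 2 \<in> J" using jm by (auto simp: J_def)
        ultimately have "\<not> u \<le> cdf \<mu> (of_int (j - 2) * h)" using nE[of "j - 2"] tau by linarith
        then have b2: "(of_int j - 2) * h < x"
          using quantile_le_iff[OF mu u, of "of_int (j - 2) * h"] by (simp add: x_def)
        have "\<bar>y - x\<bar> \<le> 2 * h" using jy b1 b2 by (auto simp: algebra_simps abs_le_iff)
        then have "\<bar>y - x\<bar> powr p \<le> (2 * h) powr p" using p by (intro powr_mono2) auto
        then show ?thesis using nn by linarith
      qed
    qed
    then show ?thesis by (simp add: x_def y_def)
  qed
  have gb [measurable]: "g \<in> borel_measurable borel" unfolding g_def by measurable
  interpret nu: real_distribution \<nu> by (rule nu)
  have gi: "integrable \<nu> g"
    by (rule Bochner_Integration.integrable_bound[OF int])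
      (auto simp: g_def indicator_def nu.events_eq_borel cong: measurable_cong_sets)
  have giU: "integrable Uni (\<lambda>u. g (quantile \<nu> u))"
    using gi distr_quantile[OF nu] integrable_distr_eq[of "quantile \<nu>" Uni borel g] by auto
  have Eint: "integrable Uni (indicator E :: real \<Rightarrow> real)"
    using Em by (simp add: Uni.emeasure_eq_measure)
  have "(\<integral>u. \<bar>quantile \<nu> u - quantile \<mu> u\<bar> powr p \<partial>Uni) \<le>
    (\<integral>u. (2 * h) powr p + (2 * L) powr p * indicator E u + 2 powr p * g (quantile \<nu> u) \<partial>Uni)"
  proof (rule integral_mono')
    show "integrable Uni (\<lambda>u. (2 * h) powr p + (2 * L) powr p * indicator E u + 2 powr p * g (quantile \<nu> u))"
      using giU Eint by auto
    fix u assume "u \<in> space Uni"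
    then have u: "u \<in> {0<..<1}" by simp
    show "\<bar>quantile \<nu> u - quantile \<mu> u\<bar> powr p \<le>
        (2 * h) powr p + (2 * L) powr p * indicator E u + 2 powr p * g (quantile \<nu> u)" by (rule main[OF u])
    have "0 \<le> \<bar>quantile \<nu> u - quantile \<mu> u\<bar> powr p" by simp
    then show "0 \<le> (2 * h) powr p + (2 * L) powr p * indicator E u + 2 powr p * g (quantile \<nu> u)"
      using main[OF u] by linarith
  qed
  also have "\<dots> = (2 * h) powr p + (2 * L) powr p * measure Uni E + 2 powr p * (\<integral>u. g (quantile \<nu> u) \<partial>Uni)"
    using giU Eint Em Uni.prob_space Int_absorb2[OF sets.sets_into_space[OF Em]] by simp
  also have "(\<integral>u. g (quantile \<nu> u) \<partial>Uni) = (\<integral>x. g x \<partial>\<nu>)"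
    using integral_distr[OF distr_quantile(1)[OF nu] gb] distr_quantile(2)[OF nu] by simp
  also have "(2 * h) powr p + (2 * L) powr p * measure Uni E + 2 powr p * (\<integral>x. g x \<partial>\<nu>)
     \<le> (2 * h) powr p + (2 * L) powr p * ((2 * m + 5) * (2 * \<tau>)) + 2 powr p * (\<integral>x. g x \<partial>\<nu>)"
    using mE by (intro add_right_mono add_left_mono mult_left_mono) auto
  finally show ?thesis by (simp add: g_def)
qed

text \<open>With one \<open>V\<close> for all laws these copies are comonotone, which is the
  coupling used throughout.\<close>

lemma quantile_transform:
  assumes mu: "real_distribution \<mu>" and K: "AE x in \<mu>. \<bar>x\<bar> \<le> K"
    and V: "V \<in> measurable M Uni" "distr M Uni V = Uni"
  shows "(\<lambda>\<omega>. quantile \<mu> (V \<omega>)) \<in> Linf M" "distr M borel (\<lambda>\<omega>. quantile \<mu> (V \<omega>)) = \<mu>"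
proof -
  note q = distr_quantile[OF mu]
  have "V \<omega> \<in> {0<..<1}" if "\<omega> \<in> space M" for \<omega> using measurable_space[OF V(1) that] by simp
  then show "(\<lambda>\<omega>. quantile \<mu> (V \<omega>)) \<in> Linf M"
    by (intro LinfI[of _ _ K] AE_I2 measurable_compose[OF V(1) q(1)]) (rule quantile_bounded[OF mu K])
  show "distr M borel (\<lambda>\<omega>. quantile \<mu> (V \<omega>)) = \<mu>"
    using distr_distr[OF q(1) V(1)] V(2) q(2) by (simp add: comp_def)
qed

section \<open>Empirical measures\<close>

lemma integral_empirical:
  assumes "n > 0" and [measurable]: "g \<in> borel_measurable borel"
  shows "(\<integral>y. g y \<partial>empirical n x) = (\<Sum>i<n. g (x i)) / real n"
proof -
  have "{..<n} \<noteq> {}" using assms(1) by auto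
  then show ?thesis unfolding empirical_def
    by (subst integral_distr) (simp_all add: integral_pmf_of_set)
qed

lemma real_distribution_empirical: "real_distribution (empirical n x)"
  unfolding empirical_def
  by (rule prob_space.real_distribution_distr[OF prob_space_measure_pmf]) simp

lemma cdf_empirical:
  assumes "n > 0"
  shows "cdf (empirical n x) t = (\<Sum>i<n. indicator {..t} (x i)) / real n"
proof -
  interpret real_distribution "empirical n x" by (rule real_distribution_empirical)
  have "cdf (empirical n x) t = (\<integral>y. indicator {..t} y \<partial>empirical n x)"
    unfolding cdf_def by simp
  also have "\<dots> = (\<Sum>i<n. indicator {..t} (x i)) / real n"
    by (rule integral_empirical[OF assms]) simp
  finally show ?thesis .
qed

lemma AE_empirical_bounded:
  assumes n: "n > 0"
  shows "AE y in empirical n x. \<bar>y\<bar> \<le> (\<Sum>i<n. \<bar>x i\<bar>)"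
proof -
  have "\<bar>x i\<bar> \<le> (\<Sum>i<n. \<bar>x i\<bar>)" if "i < n" for i
    by (rule member_le_sum[of i "{..<n}" "\<lambda>i. \<bar>x i\<bar>"]) (simp_all add: that)
  moreover have "set_pmf (pmf_of_set {..<n}) = {..<n}"
    by (rule set_pmf_of_set) (use n in auto)
  ultimately have "AE i in measure_pmf (pmf_of_set {..<n}). \<bar>x i\<bar> \<le> (\<Sum>i<n. \<bar>x i\<bar>)"
    unfolding AE_measure_pmf_iff by blast
  then show ?thesis unfolding empirical_def by (subst AE_distr_iff) simp_all
qed

lemma integrable_empirical:
  assumes "n > 0" "g \<in> borel_measurable borel"
  shows "integrable (empirical n x) (g :: real \<Rightarrow> real)"
proof -
  have "set_pmf (pmf_of_set {..<n}) = {..<n}"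
    by (rule set_pmf_of_set) (use assms in auto)
  then have "integrable (measure_pmf (pmf_of_set {..<n})) (\<lambda>i. g (x i))"
    by (intro integrable_measure_pmf_finite) simp
  then show ?thesis unfolding empirical_def
    by (subst integrable_distr_eq[OF _ assms(2)]) simp_all
qed

lemma distr_PiM_coordinate:
  assumes nu: "real_distribution \<nu>" and i: "i < n"
  shows "distr (PiM {..<n} (\<lambda>_. \<nu>)) borel (\<lambda>x. x i) = \<nu>"
proof -
  interpret real_distribution \<nu> by (rule nu)
  have "distr (PiM {..<n} (\<lambda>_. \<nu>)) borel (\<lambda>x. x i) = distr (PiM {..<n} (\<lambda>_. \<nu>)) \<nu> (\<lambda>x. x i)"
    by (rule distr_cong) auto
  also have "\<dots> = \<nu>" by (rule distr_PiM_component) (use i prob_space_axioms in auto)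
  finally show ?thesis .
qed

lemma measurable_PiM_coordinate:
  assumes nu: "real_distribution \<nu>" and i: "i < n"
  shows "(\<lambda>x. x i) \<in> borel_measurable (PiM {..<n} (\<lambda>_. \<nu>))"
proof -
  interpret real_distribution \<nu> by (rule nu)
  have "(\<lambda>x. x i) \<in> measurable (PiM {..<n} (\<lambda>_. \<nu>)) \<nu>"
    by (rule measurable_component_singleton) (use i in simp)
  moreover have "measurable (PiM {..<n} (\<lambda>_. \<nu>)) \<nu> = borel_measurable (PiM {..<n} (\<lambda>_. \<nu>))"
    by (rule measurable_cong_sets) simp_all
  ultimately show ?thesis by simp
qed

text \<open>Independence amounts to the joint law being the product of the marginals; here the joint
  map is the identity on the extensional product space.\<close>

lemma indep_vars_PiM_coordinate:
  assumes nu: "real_distribution \<nu>" and n: "n > 0"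
  shows "prob_space.indep_vars (PiM {..<n} (\<lambda>_. \<nu>)) (\<lambda>_. borel) (\<lambda>i x. x i) {..<n}"
proof -
  interpret real_distribution \<nu> by (rule nu)
  let ?P = "PiM {..<n} (\<lambda>_. \<nu>)"
  interpret P: prob_space ?P by (rule prob_space_PiM) (rule prob_space_axioms)
  have ne: "{..<n} \<noteq> {}" using n by auto
  have s: "sets (PiM {..<n} (\<lambda>_. borel)) = sets ?P" by (rule sets_PiM_cong) auto
  have "distr ?P (PiM {..<n} (\<lambda>_. borel)) (\<lambda>x. \<lambda>i\<in>{..<n}. x i) = distr ?P ?P (\<lambda>x. x)"
  proof (rule distr_cong)
    fix x assume "x \<in> space ?P"
    then show "(\<lambda>i\<in>{..<n}. x i) = x" by (simp add: space_PiM PiE_def extensional_restrict)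
  qed (simp_all only: s)
  also have "\<dots> = ?P" by (rule distr_id2) simp
  also have "\<dots> = PiM {..<n} (\<lambda>i. distr ?P borel (\<lambda>x. x i))"
    by (rule PiM_cong) (simp_all add: distr_PiM_coordinate[OF nu])
  finally have "distr ?P (PiM {..<n} (\<lambda>_. borel)) (\<lambda>x. \<lambda>i\<in>{..<n}. x i)
      = PiM {..<n} (\<lambda>i. distr ?P borel (\<lambda>x. x i))" .
  then show ?thesis
    by (intro iffD2[OF P.indep_vars_iff_distr_eq_PiM'[OF ne]] measurable_PiM_coordinate[OF nu]) simp_all
qed

text \<open>Hoeffding's inequality for indicators of a half-line. The bound depends neither on the
  law nor on \<open>t\<close>, which is the source of uniformity in the sample size.\<close>

lemma empirical_cdf_deviation:
  assumes nu: "real_distribution \<nu>" and n: "n > 0" and e: "e > 0"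
  defines "P \<equiv> PiM {..<n} (\<lambda>_. \<nu>)"
  shows "measure P {x\<in>space P. \<bar>cdf (empirical n x) t - cdf \<nu> t\<bar> \<ge> e} \<le> 2 * exp (- 2 * e\<^sup>2 * n)"
proof -
  interpret real_distribution \<nu> by (rule nu)
  interpret P: prob_space P unfolding P_def by (rule prob_space_PiM) (rule prob_space_axioms)
  define f where "f = (indicator {..t} :: real \<Rightarrow> real)"
  have fm [measurable]: "f \<in> borel_measurable borel" by (simp add: f_def)
  have cm: "(\<lambda>x. x i) \<in> borel_measurable P" if "i < n" for i
    unfolding P_def by (rule measurable_PiM_coordinate[OF nu that])
  have d: "distr P borel (\<lambda>x. f (x i)) = distr \<nu> borel f" if "i < n" for i
    using distr_distr[OF fm cm[OF that]] distr_PiM_coordinate[OF nu that] by (simp add: comp_def P_def)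
  have Ef: "P.expectation (\<lambda>x. f (x 0)) = cdf \<nu> t"
  proof -
    have "P.expectation (\<lambda>x. f (x 0)) = (\<integral>y. f y \<partial>distr P borel (\<lambda>x. x 0))"
      by (rule integral_distr[symmetric]) (use cm n in auto)
    also have "\<dots> = cdf \<nu> t"
      using n by (simp add: P_def distr_PiM_coordinate[OF nu] f_def cdf_def)
    finally show ?thesis .
  qed
  interpret H: Hoeffding_ineq_iid P "{..<n}" "\<lambda>i x. f (x i)" "\<lambda>x. f (x 0)" 0 1 "cdf \<nu> t"
  proof (unfold_locales)
    show "P.indep_vars (\<lambda>_. borel) (\<lambda>i x. f (x i)) {..<n}"
      by (rule P.indep_vars_compose2[where Y="\<lambda>_. f"])
        (use indep_vars_PiM_coordinate[OF nu n] in \<open>auto simp: P_def\<close>)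
    show "distr P borel (\<lambda>x. f (x i)) = distr P borel (\<lambda>x. f (x 0))" if "i \<in> {..<n}" for i
      using d[of i] d[of 0] that n by simp
    show "(\<lambda>x. f (x 0)) \<in> borel_measurable P" by (rule measurable_compose[OF cm[OF n] fm])
    show "AE x in P. f (x 0) \<in> {0..1}" by (auto simp: f_def indicator_def)
    show "cdf \<nu> t \<equiv> P.expectation (\<lambda>x. f (x 0))" using Ef by simp
  qed simp
  have "{x\<in>space P. \<bar>cdf (empirical n x) t - cdf \<nu> t\<bar> \<ge> e}
      = {x\<in>space P. \<bar>(\<Sum>i<n. f (x i)) - real n * cdf \<nu> t\<bar> \<ge> n * e}"
  proof -
    have "\<bar>cdf (empirical n x) t - cdf \<nu> t\<bar> = \<bar>(\<Sum>i<n. f (x i)) - real n * cdf \<nu> t\<bar> / n" for x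
    proof -
      have "cdf (empirical n x) t - cdf \<nu> t = ((\<Sum>i<n. f (x i)) - real n * cdf \<nu> t) / n"
        using n by (simp add: cdf_empirical f_def diff_divide_distrib)
      then show ?thesis by simp
    qed
    then have "\<bar>cdf (empirical n x) t - cdf \<nu> t\<bar> \<ge> e \<longleftrightarrow>
        \<bar>(\<Sum>i<n. f (x i)) - real n * cdf \<nu> t\<bar> \<ge> n * e" for x
      using n by (simp only: le_divide_eq mult.commute) simp
    then show ?thesis by (simp only:)
  qed
  also have "P.prob \<dots> \<le> 2 * exp (- 2 * (n * e)\<^sup>2 / (n * (1 - 0)\<^sup>2))"
  proof -
    have "{..<n} \<noteq> {}" using n by auto
    from H.Hoeffding_ineq_abs_ge[OF _ _ this, of "n * e"] show ?thesis using n e by simp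
  qed
  also have "- 2 * (n * e)\<^sup>2 / (n * (1 - 0)\<^sup>2) = - 2 * e\<^sup>2 * n"
    using n by (simp add: power2_eq_square)
  finally show ?thesis .
qed

text \<open>By linearity the empirical integral of \<open>g\<close> has mean
  \<open>\<integral>y. g y \<partial>\<nu>\<close> for every \<open>n\<close>. This serves the tail
  function, which has no bound common to all the laws and so no common Hoeffding rate.\<close>

lemma empirical_markov:
  assumes nu: "real_distribution \<nu>" and n: "n > 0" and a: "a > 0"
    and g: "g \<in> borel_measurable borel" "\<And>y. 0 \<le> g y" "integrable \<nu> g"
  defines "P \<equiv> PiM {..<n} (\<lambda>_. \<nu>)"
  shows "measure P {x\<in>space P. (\<integral>y. g y \<partial>empirical n x) \<ge> a} \<le> (\<integral>y. g y \<partial>\<nu>) / a"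
proof -
  interpret real_distribution \<nu> by (rule nu)
  have cm: "(\<lambda>x. x i) \<in> borel_measurable P" if "i < n" for i
    unfolding P_def by (rule measurable_PiM_coordinate[OF nu that])
  have d: "distr P borel (\<lambda>x. x i) = \<nu>" if "i < n" for i
    using distr_PiM_coordinate[OF nu that] by (simp add: P_def)
  have i: "integrable P (\<lambda>x. g (x i))" "(\<integral>x. g (x i) \<partial>P) = (\<integral>y. g y \<partial>\<nu>)" if "i < n" for i
    using integrable_distr_eq[OF cm[OF that] g(1)] integral_distr[OF cm[OF that] g(1)] g(3) d[OF that] by auto
  have "measure P {x\<in>space P. (\<Sum>i<n. g (x i)) / n \<ge> a} \<le> (\<integral>x. (\<Sum>i<n. g (x i)) / n \<partial>P) / a"
  proof (rule integral_Markov_inequality_measure[OF _ sets.empty_sets])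
    show "integrable P (\<lambda>x. (\<Sum>i<n. g (x i)) / n)"
      by (intro integrable_divide Bochner_Integration.integrable_sum) (use i in auto)
    show "AE x in P. 0 \<le> (\<Sum>i<n. g (x i)) / n"
      using g(2) by (intro AE_I2 divide_nonneg_nonneg sum_nonneg) auto
  qed (rule a)
  also have "(\<integral>x. (\<Sum>i<n. g (x i)) / n \<partial>P) = (\<integral>y. g y \<partial>\<nu>)"
    using i n by simp
  finally show ?thesis using integral_empirical[OF n g(1)] by simp
qed

section \<open>Prohorov closeness, uniform tails and the uniform law of large numbers\<close>

lemma prohorov_lessD:
  assumes "real_distribution \<mu>" "real_distribution \<nu>" "prohorov \<mu> \<nu> < d"
  shows "\<exists>\<epsilon>>0. \<epsilon> < d \<and> (\<forall>B\<in>sets borel.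
      measure \<mu> B \<le> measure \<nu> {x. \<exists>y\<in>B. dist x y < \<epsilon>} + \<epsilon> \<and>
      measure \<nu> B \<le> measure \<mu> {x. \<exists>y\<in>B. dist x y < \<epsilon>} + \<epsilon>)"
proof -
  interpret mu: real_distribution \<mu> by fact
  interpret nu: real_distribution \<nu> by fact
  let ?S = "{\<epsilon>::real. \<epsilon> > 0 \<and> (\<forall>B\<in>sets borel.
      measure \<mu> B \<le> measure \<nu> {x. \<exists>y\<in>B. dist x y < \<epsilon>} + \<epsilon> \<and>
      measure \<nu> B \<le> measure \<mu> {x. \<exists>y\<in>B. dist x y < \<epsilon>} + \<epsilon>)}"
  have "1 \<in> ?S"
    by (intro CollectI conjI ballI zero_less_one add_increasing measure_nonneg mu.prob_le_1 nu.prob_le_1)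
  then have "?S \<noteq> {}" by blast
  from cInf_lessD[OF this assms(3)[unfolded prohorov_def]]
  obtain e where "e \<in> ?S" "e < d" ..
  then show ?thesis by (intro exI[of _ e]) simp
qed

text \<open>A neighbourhood of a half-line lies in a half-line, so testing with \<open>{..t}\<close>
  gives a comparison of Levy type, the only form in which Prohorov closeness enters the
  coupling.\<close>

lemma prohorov_cdf:
  assumes mu: "real_distribution \<mu>" and nu: "real_distribution \<nu>" and lt: "prohorov \<mu> \<nu> < d" and h: "d \<le> h"
  shows "cdf \<mu> t \<le> cdf \<nu> (t + h) + d" "cdf \<nu> t \<le> cdf \<mu> (t + h) + d"
proof -
  interpret mu: real_distribution \<mu> by fact
  interpret nu: real_distribution \<nu> by fact
  obtain e where e: "e > 0" "e < d" and B: "\<And>B. B \<in> sets borel \<Longrightarrow>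
      measure \<mu> B \<le> measure \<nu> {x. \<exists>y\<in>B. dist x y < e} + e \<and>
      measure \<nu> B \<le> measure \<mu> {x. \<exists>y\<in>B. dist x y < e} + e"
    using prohorov_lessD[OF mu nu lt] by (elim exE conjE) simp
  have sub: "{x. \<exists>y\<in>{..t}. dist x y < e} \<subseteq> {..t + h}"
    using e h by (auto simp: dist_real_def)
  have "measure \<nu> {x. \<exists>y\<in>{..t}. dist x y < e} \<le> measure \<nu> {..t + h}"
    by (rule nu.finite_measure_mono[OF sub]) simp
  moreover have "measure \<mu> {x. \<exists>y\<in>{..t}. dist x y < e} \<le> measure \<mu> {..t + h}"
    by (rule mu.finite_measure_mono[OF sub]) simp
  ultimately show "cdf \<mu> t \<le> cdf \<nu> (t + h) + d" "cdf \<nu> t \<le> cdf \<mu> (t + h) + d"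
    using B[of "{..t}", THEN conjunct1] B[of "{..t}", THEN conjunct2] e unfolding cdf_def by simp_all
qed

text \<open>\<open>(p * c) powr (1/p)\<close> is where \<open>psi p\<close> reaches the level
  \<open>c\<close>, and \<open>|x| powr p\<close> is \<open>p\<close> times \<open>psi p x\<close>;
  hence the target \<open>s / p\<close> for the supremum.\<close>

lemma unif_p_integrating_tail:
  assumes p: "1 \<le> p" and N: "unif_p_integrating p N" and s: "s > 0"
  shows "\<exists>L0. \<forall>L\<ge>L0. \<forall>\<nu>\<in>N. real_distribution \<nu> \<longrightarrow>
    (\<integral>x. indicator {x. \<bar>x\<bar> > L} x * \<bar>x\<bar> powr p \<partial>\<nu>) \<le> s"
proof -
  let ?T = "\<lambda>c \<nu>. \<integral>\<^sup>+ x. indicator {x. psi p x \<ge> c} x * ennreal (psi p x) \<partial>\<nu>"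
  have "\<forall>\<^sub>F c in at_top. (SUP \<mu>\<in>N. ?T c \<mu>) < ennreal (s / p)"
    using N s p unfolding unif_p_integrating_def by (intro order_tendstoD(2)) auto
  then have "\<forall>\<^sub>F c::real in at_top. (SUP \<mu>\<in>N. ?T c \<mu>) < ennreal (s / p) \<and> c \<ge> 1"
    using eventually_ge_at_top[of 1] by eventually_elim auto
  from eventually_happens'[OF trivial_limit_at_top_linorder this]
  obtain c :: real where c: "(SUP \<mu>\<in>N. ?T c \<mu>) < ennreal (s / p)" "c \<ge> 1" by blast
  have "(\<integral>x. indicator {x. \<bar>x\<bar> > L} x * \<bar>x\<bar> powr p \<partial>\<nu>) \<le> s"
    if L: "L \<ge> (p * c) powr (1/p)" and nuN: "\<nu> \<in> N" and nu: "real_distribution \<nu>" for L \<nu>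
  proof -
    interpret real_distribution \<nu> by (rule nu)
    have "(p * c) powr (1/p) > 0" using p c by simp
    then have pw: "psi p x \<ge> c" if "\<bar>x\<bar> > L" for x
    proof -
      have "((p * c) powr (1/p)) powr p \<le> \<bar>x\<bar> powr p" using that L p by (intro powr_mono2) auto
      also have "((p * c) powr (1/p)) powr p = p * c" using p c by (simp add: powr_powr)
      finally show ?thesis using p by (simp add: psi_def le_divide_eq mult.commute)
    qed
    have "(\<integral>x. indicator {x. \<bar>x\<bar> > L} x * \<bar>x\<bar> powr p \<partial>\<nu>)
        = enn2real (\<integral>\<^sup>+x. ennreal (indicator {x. \<bar>x\<bar> > L} x * \<bar>x\<bar> powr p) \<partial>\<nu>)"
    proof (rule integral_eq_nn_integral)
      show "(\<lambda>x. indicator {x. \<bar>x\<bar> > L} x * \<bar>x\<bar> powr p) \<in> borel_measurable \<nu>"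
        by (rule measurable_finite_borel) measurable
    qed auto
    also have "\<dots> \<le> s"
    proof (rule enn2real_leI)
      have "(\<integral>\<^sup>+x. ennreal (indicator {x. \<bar>x\<bar> > L} x * \<bar>x\<bar> powr p) \<partial>\<nu>)
         \<le> (\<integral>\<^sup>+x. ennreal p * (indicator {x. psi p x \<ge> c} x * ennreal (psi p x)) \<partial>\<nu>)"
      proof (rule nn_integral_mono)
        fix x
        have "ennreal p * ennreal (psi p x) = ennreal (\<bar>x\<bar> powr p)"
          using p by (subst ennreal_mult[symmetric]) (auto simp: psi_def)
        then show "ennreal (indicator {x. \<bar>x\<bar> > L} x * \<bar>x\<bar> powr p)
          \<le> ennreal p * (indicator {x. psi p x \<ge> c} x * ennreal (psi p x))"
          using pw[of x] by (cases "\<bar>x\<bar> > L"; cases "psi p x \<ge> c") simp_all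
      qed
      also have "\<dots> = ennreal p * ?T c \<nu>"
      proof (rule nn_integral_cmult)
        show "(\<lambda>x. indicator {x. psi p x \<ge> c} x * ennreal (psi p x)) \<in> borel_measurable \<nu>"
          unfolding psi_def by (rule measurable_finite_borel) measurable
      qed
      also have "\<dots> \<le> ennreal p * ennreal (s / p)"
        using order_trans[OF SUP_upper[OF nuN] less_imp_le[OF c(1)]] by (rule mult_left_mono) simp
      also have "\<dots> = ennreal s" using p s by (subst ennreal_mult[symmetric]) auto
      finally show "(\<integral>\<^sup>+x. ennreal (indicator {x. \<bar>x\<bar> > L} x * \<bar>x\<bar> powr p) \<partial>\<nu>) \<le> ennreal s" .
    qed (use s in simp)
    finally show ?thesis .
  qed
  then show ?thesis by blast
qed

lemma exp_times_nat_eventually_small: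
  fixes a c b :: real
  assumes "c > 0" "b > 0"
  shows "\<exists>n0. \<forall>n\<ge>n0. a * exp (- c * real n) \<le> b"
proof -
  have "(\<lambda>n. exp (- c) ^ n) \<longlonglongrightarrow> 0" by (rule LIMSEQ_power_zero) (use assms in simp)
  then have "(\<lambda>n. a * exp (- c) ^ n) \<longlonglongrightarrow> a * 0" by (rule tendsto_mult_left)
  then have "\<forall>\<^sub>F n in sequentially. a * exp (- c) ^ n < b"
    using assms by (intro order_tendstoD(2)) auto
  then obtain n0 where "\<And>n. n \<ge> n0 \<Longrightarrow> a * exp (- c) ^ n < b"
    unfolding eventually_sequentially by blast
  then show ?thesis
    by (intro exI[of _ n0]) (auto simp: exp_of_nat_mult[symmetric] mult.commute intro: less_imp_le)
qed

text \<open>The order of choices gives uniformity: \<open>L\<close> from the tails of the whole set,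
  then the grid, then \<tau>, and only then \<delta> and \<open>n0\<close>. The laws are linked
  through cdfs on the grid, \<mu> to \<nu> by Prohorov closeness and \<nu> to the sample by
  Hoeffding, each at a cost of \<open>\<tau> / 2\<close>.\<close>

theorem empirical_quantile_close:
  fixes \<eta> p :: real
  assumes p: "1 \<le> p" and UI: "unif_p_integrating p N" and muN: "\<mu> \<in> N" and eta: "\<eta> > 0"
    and rd: "\<And>\<nu>. \<nu> \<in> N \<Longrightarrow> real_distribution \<nu>"
    and bdd: "\<And>\<nu>. \<nu> \<in> N \<Longrightarrow> \<exists>K. AE x in \<nu>. \<bar>x\<bar> \<le> K"
  shows "\<exists>\<delta>>0. \<exists>n0::nat. \<forall>\<nu>\<in>N. prohorov \<mu> \<nu> \<le> \<delta> \<longrightarrow> (\<forall>n\<ge>n0. n > 0 \<longrightarrow>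
    (\<exists>G\<in>sets (PiM {..<n} (\<lambda>_. \<nu>)). measure (PiM {..<n} (\<lambda>_. \<nu>)) G \<ge> 1 - \<eta> \<and>
      (\<forall>x\<in>G. (\<integral>u. \<bar>quantile (empirical n x) u - quantile \<mu> u\<bar> powr p \<partial>Uni) < \<eta>)))"
proof -
  obtain K where K: "AE x in \<mu>. \<bar>x\<bar> \<le> K" using bdd[OF muN] by blast
  \<comment> \<open>\<open>h\<close>, \<tau> and \<open>a\<close> are tuned so that each summand of
    \<open>quantile_coupling_bound\<close> costs a quarter of \<eta>.\<close>
  define h where "h = (\<eta> / 4) powr (1 / p) / 2"
  have h: "h > 0" "(2 * h) powr p = \<eta> / 4" using eta p by (auto simp: h_def powr_powr)
  define a where "a = \<eta> / (4 * 2 powr p)"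
  have a: "a > 0" "2 powr p * a = \<eta> / 4" using eta by (auto simp: a_def)
  \<comment> \<open>The expected tail is this small so that Markov's inequality at level
    \<open>a\<close> fails with probability at most \<open>\<eta> / 2\<close>.\<close>
  have "a * \<eta> / 2 > 0" using a eta by simp
  from unif_p_integrating_tail[OF p UI this] obtain L0 where
    L0: "\<And>L \<nu>. L \<ge> L0 \<Longrightarrow> \<nu> \<in> N \<Longrightarrow> real_distribution \<nu> \<Longrightarrow>
      (\<integral>x. indicator {x. \<bar>x\<bar> > L} x * \<bar>x\<bar> powr p \<partial>\<nu>) \<le> a * \<eta> / 2" by blast
  define L where "L = max L0 (max K 1)"
  have L: "L \<ge> L0" "K \<le> L" "0 < L" by (auto simp: L_def)
  define m where "m = nat \<lceil>L / h\<rceil>"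
  have "L / h \<le> m" unfolding m_def using L h by (simp add: of_nat_ceiling)
  then have m: "L \<le> m * h" using h by (simp add: divide_le_eq)
  define D where "D = (2 * L) powr p * ((2 * real m + 5) * 2)"
  have D: "D > 0" using L by (auto simp: D_def intro!: mult_pos_pos add_nonneg_pos)
  define \<tau> where "\<tau> = \<eta> / 4 / D"
  have tau: "\<tau> > 0" "(2 * L) powr p * ((2 * real m + 5) * (2 * \<tau>)) = \<eta> / 4"
  proof -
    show "\<tau> > 0" using eta D by (simp add: \<tau>_def)
    have "(2 * L) powr p * ((2 * real m + 5) * (2 * \<tau>)) = D * \<tau>" by (simp add: D_def)
    then show "(2 * L) powr p * ((2 * real m + 5) * (2 * \<tau>)) = \<eta> / 4" using D by (simp add: \<tau>_def)
  qed
  \<comment> \<open>The final halving turns \<open>prohorov \<mu> \<nu> \<le> \<delta>\<close> into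
    the strict inequality that \<open>prohorov_cdf\<close> asks for.\<close>
  define \<delta> where "\<delta> = min h (\<tau> / 2) / 2"
  have d: "\<delta> > 0" using h tau by (simp add: \<delta>_def)
  define J where "J = {- (int m + 1)..int m + 1}"
  have J: "finite J" "card J = 2 * m + 3" by (auto simp: J_def)
  have "2 * (\<tau> / 2)\<^sup>2 > 0" "\<eta> / 2 > 0" using tau eta by auto
  \<comment> \<open>A union bound over the \<open>2 * m + 3\<close> grid points takes the other half
    of the admissible failure probability.\<close>
  from exp_times_nat_eventually_small[OF this, of "real (2 * m + 3) * 2"]
  obtain n0 where n0: "\<And>n. n \<ge> n0 \<Longrightarrow> real (2 * m + 3) * 2 * exp (- (2 * (\<tau> / 2)\<^sup>2) * real n) \<le> \<eta> / 2" by blast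
  define g where "g x = indicator {x. \<bar>x\<bar> > L} x * \<bar>x\<bar> powr p" for x :: real
  have gb [measurable]: "g \<in> borel_measurable borel" unfolding g_def by measurable
  have g0: "0 \<le> g x" for x by (simp add: g_def)
  have "\<exists>G\<in>sets (PiM {..<n} (\<lambda>_. \<nu>)). measure (PiM {..<n} (\<lambda>_. \<nu>)) G \<ge> 1 - \<eta> \<and>
      (\<forall>x\<in>G. (\<integral>u. \<bar>quantile (empirical n x) u - quantile \<mu> u\<bar> powr p \<partial>Uni) < \<eta>)"
    if nuN: "\<nu> \<in> N" and close: "prohorov \<mu> \<nu> \<le> \<delta>" and n: "n \<ge> n0" "n > 0" for \<nu> n
  proof -
    note nu = rd[OF nuN] and mu = rd[OF muN]
    interpret nu: real_distribution \<nu> by (rule nu)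
    define P where "P = PiM {..<n} (\<lambda>_. \<nu>)"
    interpret P: prob_space P unfolding P_def by (rule prob_space_PiM) (rule nu.prob_space_axioms)
    have cm [measurable]: "(\<lambda>x. x i) \<in> borel_measurable P" if "i < n" for i
      unfolding P_def by (rule measurable_PiM_coordinate[OF nu that])
    have "prohorov \<mu> \<nu> < min h (\<tau> / 2)" using close d by (auto simp: \<delta>_def)
    note pc = prohorov_cdf[OF mu nu this min.cobounded1]
    obtain K' where K': "AE x in \<nu>. \<bar>x\<bar> \<le> K'" using bdd[OF nuN] by blast
    have gi: "integrable \<nu> g"
    proof (rule nu.integrable_const_bound[of _ "K' powr p"])
      show "AE x in \<nu>. norm (g x) \<le> K' powr p" using K'
      proof eventually_elim
        case (elim x)
        have "\<bar>x\<bar> powr p \<le> K' powr p" using elim p by (intro powr_mono2) auto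
        then show ?case by (auto simp: g_def indicator_def)
      qed
      show "g \<in> borel_measurable \<nu>" by (rule nu.measurable_finite_borel[OF gb])
    qed
    define B where "B j = {x\<in>space P. \<bar>cdf (empirical n x) (of_int j * h) - cdf \<nu> (of_int j * h)\<bar> \<ge> \<tau> / 2}" for j :: int
    define T where "T = {x\<in>space P. (\<integral>y. g y \<partial>empirical n x) \<ge> a}"
    have indm: "(\<lambda>x. indicator {..t} (x i) :: real) \<in> borel_measurable P" if "i < n" for i t
      by (rule measurable_compose[OF cm[OF that]]) simp
    have Bm: "B j \<in> sets P" for j
    proof -
      have "(\<lambda>x. (\<Sum>i<n. indicator {..of_int j * h} (x i) :: real)) \<in> borel_measurable P"
        by (rule borel_measurable_sum) (rule indm, simp)
      then show ?thesis unfolding B_def cdf_empirical[OF n(2)] by measurable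
    qed
    have Tm: "T \<in> sets P"
    proof -
      have "(\<lambda>x. (\<Sum>i<n. g (x i))) \<in> borel_measurable P"
        by (rule borel_measurable_sum) (rule measurable_compose[OF cm gb], simp)
      then show ?thesis unfolding T_def integral_empirical[OF n(2) gb] by measurable
    qed
    have Bp: "P.prob (B j) \<le> 2 * exp (- (2 * (\<tau> / 2)\<^sup>2) * real n)" for j
      using empirical_cdf_deviation[OF nu n(2), of "\<tau> / 2" "of_int j * h"] tau
      unfolding B_def P_def by simp
    have Tp: "P.prob T \<le> \<eta> / 2"
    proof -
      have "P.prob T \<le> (\<integral>y. g y \<partial>\<nu>) / a"
        using empirical_markov[OF nu n(2) a(1) gb g0 gi] unfolding T_def P_def .
      also have "\<dots> \<le> (a * \<eta> / 2) / a"
        using L0[OF L(1) nuN nu] a(1) by (intro divide_right_mono) (auto simp: g_def)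
      finally show ?thesis using a(1) by simp
    qed
    define Bad where "Bad = (\<Union>j\<in>J. B j) \<union> T"
    have Badm: "Bad \<in> sets P" unfolding Bad_def using J Bm Tm by auto
    have "P.prob Bad \<le> P.prob (\<Union>j\<in>J. B j) + P.prob T"
      unfolding Bad_def by (rule measure_Un_le) (use J Bm Tm in auto)
    also have "P.prob (\<Union>j\<in>J. B j) \<le> (\<Sum>j\<in>J. P.prob (B j))"
      by (rule P.finite_measure_subadditive_finite) (use J Bm in auto)
    also have "\<dots> \<le> (\<Sum>j\<in>J. 2 * exp (- (2 * (\<tau> / 2)\<^sup>2) * real n))" by (rule sum_mono) (rule Bp)
    also have "\<dots> \<le> \<eta> / 2" using n0[OF n(1)] by (simp only: sum_constant J(2) mult.assoc)
    finally have Badp: "P.prob Bad \<le> \<eta>" using Tp by simp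
    have "(\<integral>u. \<bar>quantile (empirical n x) u - quantile \<mu> u\<bar> powr p \<partial>Uni) < \<eta>"
      if x: "x \<in> space P - Bad" for x
    proof -
      have Bx: "\<bar>cdf (empirical n x) (of_int j * h) - cdf \<nu> (of_int j * h)\<bar> < \<tau> / 2" if "j \<in> J" for j
        using x that by (auto simp: Bad_def B_def)
      have Tx: "(\<integral>y. g y \<partial>empirical n x) < a" using x by (auto simp: Bad_def T_def)
      have "(\<integral>u. \<bar>quantile (empirical n x) u - quantile \<mu> u\<bar> powr p \<partial>Uni) \<le>
        (2 * h) powr p + (2 * L) powr p * ((2 * m + 5) * (2 * \<tau>))
          + 2 powr p * (\<integral>y. indicator {y. \<bar>y\<bar> > L} y * \<bar>y\<bar> powr p \<partial>empirical n x)"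
      proof (rule quantile_coupling_bound[OF mu real_distribution_empirical p K L(2,3) h(1) m tau(1)])
        show "integrable (empirical n x) (\<lambda>x. \<bar>x\<bar> powr p)"
          by (rule integrable_empirical[OF n(2)]) measurable
        fix j :: int assume "\<bar>j\<bar> \<le> int (m + 1)"
        then have j: "j \<in> J" by (auto simp: J_def)
        have "cdf \<nu> (of_int j * h) \<le> cdf \<mu> (of_int j * h + h) + min h (\<tau> / 2)" by (rule pc)
        moreover have mt: "min h (\<tau> / 2) \<le> \<tau> / 2" by (rule min.cobounded2)
        moreover have e: "cdf (empirical n x) (of_int j * h) - cdf \<nu> (of_int j * h) < \<tau> / 2"
          "cdf \<nu> (of_int j * h) - cdf (empirical n x) (of_int j * h) < \<tau> / 2"
          using Bx[OF j] by linarith+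
        ultimately have "cdf (empirical n x) (of_int j * h) \<le> cdf \<mu> (of_int j * h + h) + \<tau>"
          by linarith
        moreover have "of_int (j + 1) * h = of_int j * h + h" by (simp add: distrib_right)
        ultimately show "cdf (empirical n x) (of_int j * h) \<le> cdf \<mu> (of_int (j + 1) * h) + \<tau>"
          by (simp only:)
        have "cdf \<mu> (of_int (j - 1) * h) \<le> cdf \<nu> (of_int (j - 1) * h + h) + min h (\<tau> / 2)" by (rule pc)
        also have "of_int (j - 1) * h + h = of_int j * h" by (simp add: algebra_simps)
        finally show "cdf \<mu> (of_int (j - 1) * h) \<le> cdf (empirical n x) (of_int j * h) + \<tau>"
          using mt e(2) by linarith
      qed
      also have "\<dots> = \<eta> / 4 + \<eta> / 4 + 2 powr p * (\<integral>y. g y \<partial>empirical n x)"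
        using tau(2) by (simp add: h(2) g_def)
      also have "\<dots> < \<eta> / 4 + \<eta> / 4 + 2 powr p * a" using Tx by simp
      also have "\<dots> \<le> \<eta>" using a(2) eta by simp
      finally show ?thesis .
    qed
    moreover have "P.prob (space P - Bad) \<ge> 1 - \<eta>" using P.prob_compl[OF Badm] Badp by simp
    moreover have "space P - Bad \<in> sets P" using Badm by auto
    ultimately show ?thesis unfolding P_def by (intro bexI[of _ "space P - Bad"]) (auto simp: P_def)
  qed
  then show ?thesis using d by blast
qed

section \<open>Qualitative robustness\<close>

lemma open_dist_neighborhood: "open {x::real. \<exists>y\<in>B. dist x y < e}"
proof -
  have "{x. \<exists>y\<in>B. dist x y < e} = (\<Union>y\<in>B. ball y e)" by (auto simp: dist_commute)
  then show ?thesis by auto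
qed

lemma prohorov_le:
  assumes "e > 0" and "\<And>B. B \<in> sets borel \<Longrightarrow>
      measure \<mu> B \<le> measure \<nu> {x. \<exists>y\<in>B. dist x y < e} + e \<and>
      measure \<nu> B \<le> measure \<mu> {x. \<exists>y\<in>B. dist x y < e} + e"
  shows "prohorov \<mu> \<nu> \<le> e"
  unfolding prohorov_def using assms
  by (intro cInf_lower bdd_belowI[of _ 0]) auto

text \<open>A set \<open>B\<close> either misses the ball and has mass at most \<open>e\<close>, or
  meets it, and then its \<open>e\<close>-neighbourhood contains the whole ball. Robustness is
  thereby reduced to concentration of both sample laws at one point.\<close>

lemma prohorov_concentrated:
  assumes a: "real_distribution \<alpha>" and b: "real_distribution \<beta>" and e: "e > 0"
    and S: "measure \<alpha> {y. \<bar>y - c\<bar> < e / 2} \<ge> 1 - e" "measure \<beta> {y. \<bar>y - c\<bar> < e / 2} \<ge> 1 - e"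
  shows "prohorov \<alpha> \<beta> \<le> e"
proof (rule prohorov_le[OF e])
  fix B :: "real set" assume B: "B \<in> sets borel"
  define S where "S = {y. \<bar>y - c\<bar> < e / 2}"
  have Sm: "S \<in> sets borel" unfolding S_def by measurable
  have *: "measure \<alpha> B \<le> measure \<beta> {x. \<exists>y\<in>B. dist x y < e} + e"
    if a: "real_distribution \<alpha>" and b: "real_distribution \<beta>" and aS: "measure \<alpha> S \<ge> 1 - e" and bS: "measure \<beta> S \<ge> 1 - e"
    for \<alpha> \<beta>
  proof -
    interpret a: real_distribution \<alpha> by (rule a)
    interpret b: real_distribution \<beta> by (rule b)
    show ?thesis
    proof (cases "B \<inter> S = {}")
      case True
      then have "measure \<alpha> B \<le> measure \<alpha> (UNIV - S)"
        using Sm by (intro a.finite_measure_mono) auto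
      also have "\<dots> = 1 - measure \<alpha> S" using a.prob_compl[of S] Sm by simp
      finally show ?thesis using aS measure_nonneg[of \<beta> "{x. \<exists>y\<in>B. dist x y < e}"] by linarith
    next
      case False
      then obtain y where y: "y \<in> B" "y \<in> S" by auto
      have "S \<subseteq> {x. \<exists>y\<in>B. dist x y < e}"
      proof
        fix x assume "x \<in> S"
        with y have "\<bar>x - c\<bar> < e / 2" "\<bar>y - c\<bar> < e / 2" by (simp_all add: S_def)
        then have "dist x y < e" unfolding dist_real_def by linarith
        then show "x \<in> {x. \<exists>y\<in>B. dist x y < e}" using y by blast
      qed
      then have "measure \<beta> S \<le> measure \<beta> {x. \<exists>y\<in>B. dist x y < e}"
        using open_dist_neighborhood by (intro b.finite_measure_mono) auto
      then show ?thesis using bS a.prob_le_1[of B] by linarith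
    qed
  qed
  show "measure \<alpha> B \<le> measure \<beta> {x. \<exists>y\<in>B. dist x y < e} + e \<and>
      measure \<beta> B \<le> measure \<alpha> {x. \<exists>y\<in>B. dist x y < e} + e"
    using *[OF a b] *[OF b a] S by (simp add: S_def)
qed

lemma prohorov_self_le:
  assumes "real_distribution \<mu>" "e > 0"
  shows "prohorov \<mu> \<mu> \<le> e"
proof (rule prohorov_le[OF assms(2)])
  interpret real_distribution \<mu> by (rule assms)
  fix B :: "real set" assume "B \<in> sets borel"
  have "B \<subseteq> {x. \<exists>y\<in>B. dist x y < e}" using assms(2) by force
  then have "measure \<mu> B \<le> measure \<mu> {x. \<exists>y\<in>B. dist x y < e}"
    using open_dist_neighborhood by (intro finite_measure_mono) auto
  then show "measure \<mu> B \<le> measure \<mu> {x. \<exists>y\<in>B. dist x y < e} + e \<and>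
      measure \<mu> B \<le> measure \<mu> {x. \<exists>y\<in>B. dist x y < e} + e" using assms(2) by simp
qed

lemma (in prob_space) laws_infD:
  assumes "\<nu> \<in> laws_inf M"
  shows "real_distribution \<nu>" "\<exists>K. AE x in \<nu>. \<bar>x\<bar> \<le> K"
proof -
  obtain X where X: "X \<in> Linf M" "\<nu> = distr M borel X" using assms by (auto simp: laws_inf_def)
  obtain K where K: "X \<in> borel_measurable M" "AE \<omega> in M. \<bar>X \<omega>\<bar> \<le> K" using X(1) by (rule LinfE)
  show "real_distribution \<nu>" unfolding X(2) by (rule real_distribution_distr[OF K(1)])
  have "AE x in \<nu>. \<bar>x\<bar> \<le> K" unfolding X(2)
    by (subst AE_distr_iff[OF K(1)]) (simp, rule K(2))
  then show "\<exists>K. AE x in \<nu>. \<bar>x\<bar> \<le> K" by blast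
qed

section \<open>The empirical risk as a random variable, and sufficiency of the interior\<close>

context convex_acceptance begin

text \<open>Both empirical measures are realised on \<open>M\<close> through the same uniform index
  \<open>kap\<close>, so coordinatewise closeness of samples becomes uniform closeness of
  variables.\<close>

lemma RA_empirical_lipschitz:
  assumes n: "n > 0" and c: "\<And>i. i < n \<Longrightarrow> \<bar>x i - y i\<bar> \<le> c"
  shows "\<bar>RA M A (empirical n x) - RA M A (empirical n y)\<bar> \<le> c"
proof -
  from nonatomic_uniform[OF nonatomic]
  obtain V where V: "V \<in> measurable M Uni" "distr M Uni V = Uni" ..
  define kap where "kap \<omega> = nat \<lfloor>real n * V \<omega>\<rfloor>" for \<omega>
  have fm: "(\<lambda>u. nat \<lfloor>real n * u\<rfloor>) \<in> measurable Uni (count_space UNIV)"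
    by (intro measurable_restrict_space1) measurable
  have kapm [measurable]: "kap \<in> measurable M (count_space UNIV)"
    unfolding kap_def by (rule measurable_compose[OF V(1) fm])
  have kapd: "distr M (count_space UNIV) kap = measure_pmf (pmf_of_set {..<n})"
    using distr_distr[OF fm V(1)] V(2) floor_uniform[OF n] by (simp add: comp_def kap_def[abs_def])
  have kapn: "kap \<omega> < n" if w: "\<omega> \<in> space M" for \<omega>
  proof -
    have v: "V \<omega> \<in> {0<..<1}" using measurable_space[OF V(1) w] by simp
    then have "real n * V \<omega> < n" using n by auto
    then show ?thesis unfolding kap_def using v n by (simp add: nat_less_iff floor_less_iff)
  qed
  have L: "(\<lambda>\<omega>. z (kap \<omega>)) \<in> Linf M" for z :: "nat \<Rightarrow> real"
  proof (rule LinfI)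
    show "AE \<omega> in M. \<bar>z (kap \<omega>)\<bar> \<le> (\<Sum>i<n. \<bar>z i\<bar>)"
    proof (rule AE_I2)
      fix \<omega> assume "\<omega> \<in> space M"
      then show "\<bar>z (kap \<omega>)\<bar> \<le> (\<Sum>i<n. \<bar>z i\<bar>)"
        by (intro member_le_sum[of "kap \<omega>" "{..<n}" "\<lambda>i. \<bar>z i\<bar>"]) (simp_all add: kapn)
    qed
  qed measurable
  have "distr M borel (\<lambda>\<omega>. z (kap \<omega>)) = empirical n z" for z :: "nat \<Rightarrow> real"
    unfolding empirical_def kapd[symmetric] by (subst distr_distr) (auto simp: comp_def)
  then have R: "RA M A (empirical n z) = rho A (\<lambda>\<omega>. z (kap \<omega>))" for z
    using RA_distr[OF L[of z]] by simp
  show ?thesis unfolding R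
    by (rule rho_lipschitz[OF L L]) (rule AE_I2, rule c, rule kapn)
qed

text \<open>The Lipschitz bound makes the empirical risk continuous for the product topology, whose
  neighbourhoods control finitely many coordinates. Measurability is what allows probabilities to be
  read off the \<open>distr\<close> in \<open>sample_law\<close>.\<close>

lemma RA_empirical_measurable:
  assumes nu: "real_distribution \<nu>" and n: "n > 0"
  shows "(\<lambda>x. RA M A (empirical n x)) \<in> borel_measurable (PiM {..<n} (\<lambda>_. \<nu>))"
proof -
  define g where "g x = RA M A (empirical n x)" for x
  have lip: "\<bar>g x - g y\<bar> \<le> c" if "\<And>i. i < n \<Longrightarrow> \<bar>x i - y i\<bar> \<le> c" for x y c
    unfolding g_def using that by (rule RA_empirical_lipschitz[OF n])
  have "isCont g x" for x
    unfolding isCont_def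
  proof (rule tendstoI)
    fix e :: real assume e: "e > 0"
    have "\<forall>\<^sub>F y in at x. \<forall>i\<in>{..<n}. dist (y i) (x i) < e / 2"
    proof (rule eventually_ball_finite)
      show "\<forall>i\<in>{..<n}. \<forall>\<^sub>F y in at x. dist (y i) (x i) < e / 2"
      proof
        fix i assume "i \<in> {..<n}"
        have "isCont (\<lambda>y :: nat \<Rightarrow> real. y i) x"
          by (rule continuous_on_product_coordinates[THEN continuous_on_eq_continuous_at[THEN iffD1, OF open_UNIV], THEN bspec]) simp
        then show "\<forall>\<^sub>F y in at x. dist (y i) (x i) < e / 2"
          unfolding isCont_def by (rule tendstoD) (use e in simp)
      qed
    qed simp
    then show "\<forall>\<^sub>F y in at x. dist (g y) (g x) < e"
    proof eventually_elim
      case (elim y)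
      have "\<bar>g y - g x\<bar> \<le> e / 2" by (rule lip) (use elim in \<open>auto simp: dist_real_def intro: less_imp_le\<close>)
      then show ?case using e by (simp add: dist_real_def)
    qed
  qed
  then have gc: "g \<in> borel_measurable borel"
    by (intro borel_measurable_continuous_onI continuous_at_imp_continuous_on) auto
  \<comment> \<open>Points of the finite product are \<open>undefined\<close> beyond
    \<open>n\<close>. Zero there gives a measurable map into the full sequence space, and
    \<open>g\<close> depends only on the first \<open>n\<close> coordinates.\<close>
  define E where "E x = (\<lambda>i. if i < n then x i else (0::real))" for x
  have "E \<in> borel_measurable (PiM {..<n} (\<lambda>_. \<nu>))"
  proof (rule measurable_coordinatewise_then_product)
    fix i
    show "(\<lambda>x. E x i) \<in> borel_measurable (PiM {..<n} (\<lambda>_. \<nu>))"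
      using measurable_PiM_coordinate[OF nu, of i n] by (cases "i < n") (simp_all add: E_def)
  qed
  from measurable_compose[OF this gc]
  have "(\<lambda>x. g (E x)) \<in> borel_measurable (PiM {..<n} (\<lambda>_. \<nu>))" .
  moreover have "g (E x) = g x" for x using lip[of "E x" x 0] by (simp add: E_def)
  ultimately show ?thesis by (simp add: g_def)
qed

lemma real_distribution_sample_law:
  assumes nu: "real_distribution \<nu>" and n: "n > 0"
  shows "real_distribution (sample_law M A \<nu> n)"
proof -
  interpret nu: real_distribution \<nu> by (rule nu)
  have "prob_space (PiM {..<n} (\<lambda>_. \<nu>))" by (rule prob_space_PiM) (rule nu.prob_space_axioms)
  then show ?thesis unfolding sample_law_def
    by (rule prob_space.real_distribution_distr) (rule RA_empirical_measurable[OF nu n])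
qed

lemma measure_sample_law_ge:
  assumes nu: "real_distribution \<nu>" and n: "n > 0" and S: "S \<in> sets borel"
    and G: "G \<in> sets (PiM {..<n} (\<lambda>_. \<nu>))" "\<And>x. x \<in> G \<Longrightarrow> RA M A (empirical n x) \<in> S"
  shows "measure (PiM {..<n} (\<lambda>_. \<nu>)) G \<le> measure (sample_law M A \<nu> n) S"
proof -
  interpret nu: real_distribution \<nu> by (rule nu)
  interpret P: prob_space "PiM {..<n} (\<lambda>_. \<nu>)" by (rule prob_space_PiM) (rule nu.prob_space_axioms)
  note m = RA_empirical_measurable[OF nu n]
  have "measure (sample_law M A \<nu> n) S = P.prob ((\<lambda>x. RA M A (empirical n x)) -` S \<inter> space (PiM {..<n} (\<lambda>_. \<nu>)))"
    unfolding sample_law_def by (rule measure_distr[OF m S])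
  moreover have "P.prob G \<le> P.prob ((\<lambda>x. RA M A (empirical n x)) -` S \<inter> space (PiM {..<n} (\<lambda>_. \<nu>)))"
    by (rule P.finite_measure_mono) (use G sets.sets_into_space[OF G(1)] measurable_sets[OF m S] in auto)
  ultimately show ?thesis by simp
qed

text \<open>Transports a sample to \<open>M\<close> through the same \<open>V\<close> that carries
  \<mu>, so that continuity of \<open>rho\<close> on \<open>M\<close> applies to the quantile
  distance.\<close>

lemma RA_empirical_quantile:
  fixes x :: "nat \<Rightarrow> real"
  assumes V: "V \<in> measurable M Uni" "distr M Uni V = Uni" and mu: "real_distribution \<mu>" and n: "n > 0"
  defines "Y \<equiv> \<lambda>\<omega>. quantile (empirical n x) (V \<omega>)"
  shows "Y \<in> Linf M" "RA M A (empirical n x) = rho A Y"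
    "(\<integral>\<omega>. \<bar>Y \<omega> - quantile \<mu> (V \<omega>)\<bar> powr p \<partial>M)
       = (\<integral>u. \<bar>quantile (empirical n x) u - quantile \<mu> u\<bar> powr p \<partial>Uni)"
proof -
  note q = quantile_transform[OF real_distribution_empirical AE_empirical_bounded[OF n] V, of x]
  show "Y \<in> Linf M" unfolding Y_def by (rule q)
  then show "RA M A (empirical n x) = rho A Y" using RA_distr[of Y] q(2) by (simp add: Y_def)
  note [measurable] = distr_quantile(1)[OF mu] distr_quantile(1)[OF real_distribution_empirical[of n x]]
  have m: "(\<lambda>u. \<bar>quantile (empirical n x) u - quantile \<mu> u\<bar> powr p) \<in> borel_measurable Uni" by measurable
  show "(\<integral>\<omega>. \<bar>Y \<omega> - quantile \<mu> (V \<omega>)\<bar> powr p \<partial>M)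
       = (\<integral>u. \<bar>quantile (empirical n x) u - quantile \<mu> u\<bar> powr p \<partial>Uni)"
    using integral_distr[OF V(1) m] V(2) by (simp add: Y_def)
qed

theorem interior_imp_p_robust:
  assumes p: "1 \<le> p" and int: "Lp_nonempty_interior M p (Clp M p A)"
  shows "p_robust M A p"
  unfolding p_robust_def
proof (intro allI impI ballI)
  fix N \<mu> and \<epsilon> :: real
  assume N: "N \<subseteq> laws_inf M \<and> unif_p_integrating p N" and muN: "\<mu> \<in> N" and eps: "0 < \<epsilon>"
  note D = laws_infD[OF subsetD[OF conjunct1[OF N]]]
  note mu = D(1)[OF muN]
  from nonatomic_uniform[OF nonatomic]
  obtain V where V: "V \<in> measurable M Uni" "distr M Uni V = Uni" ..
  define X where "X \<omega> = quantile \<mu> (V \<omega>)" for \<omega>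
  obtain K where "AE x in \<mu>. \<bar>x\<bar> \<le> K" using D(2)[OF muN] by blast
  then have X: "X \<in> Linf M" unfolding X_def[abs_def] by (rule quantile_transform[OF mu _ V])
  have "\<epsilon> / 2 > 0" using eps by simp
  from rho_continuous[OF p int X this] obtain d where d: "d > 0"
    and cont: "\<And>Y. Y \<in> Linf M \<Longrightarrow> (\<integral>\<omega>. \<bar>Y \<omega> - X \<omega>\<bar> powr p \<partial>M) < d \<Longrightarrow> \<bar>rho A Y - rho A X\<bar> < \<epsilon> / 2"
    by blast
  \<comment> \<open>A single number serves both as L^p radius and as failure probability.\<close>
  have "min d \<epsilon> > 0" using d eps by simp
  from empirical_quantile_close[OF p conjunct2[OF N] muN this D]
  obtain \<delta> n0 where del: "\<delta> > 0" and close: "\<And>\<nu> n. \<nu> \<in> N \<Longrightarrow> prohorov \<mu> \<nu> \<le> \<delta> \<Longrightarrow> n \<ge> n0 \<Longrightarrow> n > 0 \<Longrightarrow>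
    (\<exists>G\<in>sets (PiM {..<n} (\<lambda>_. \<nu>)). measure (PiM {..<n} (\<lambda>_. \<nu>)) G \<ge> 1 - min d \<epsilon> \<and>
      (\<forall>x\<in>G. (\<integral>u. \<bar>quantile (empirical n x) u - quantile \<mu> u\<bar> powr p \<partial>Uni) < min d \<epsilon>))"
    by blast
  \<comment> \<open>Applied to \<nu> and to \<mu> itself: both sample laws concentrate at the risk
    of the unperturbed law \<mu>.\<close>
  have conc: "measure (sample_law M A \<nu> n) {y. \<bar>y - rho A X\<bar> < \<epsilon> / 2} \<ge> 1 - \<epsilon>"
    if nu: "\<nu> \<in> N" "prohorov \<mu> \<nu> \<le> \<delta>" and n: "n \<ge> n0" "n > 0" for \<nu> n
  proof -
    obtain G where G: "G \<in> sets (PiM {..<n} (\<lambda>_. \<nu>))" "measure (PiM {..<n} (\<lambda>_. \<nu>)) G \<ge> 1 - min d \<epsilon>"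
      "\<And>x. x \<in> G \<Longrightarrow> (\<integral>u. \<bar>quantile (empirical n x) u - quantile \<mu> u\<bar> powr p \<partial>Uni) < min d \<epsilon>"
      using close[OF nu n] by blast
    have "RA M A (empirical n x) \<in> {y. \<bar>y - rho A X\<bar> < \<epsilon> / 2}" if "x \<in> G" for x
    proof -
      note Y = RA_empirical_quantile[OF V mu n(2), of x]
      show ?thesis using cont[OF Y(1)] G(3)[OF that] Y(2) Y(3)[of p] by (simp add: X_def)
    qed
    then have "measure (PiM {..<n} (\<lambda>_. \<nu>)) G \<le> measure (sample_law M A \<nu> n) {y. \<bar>y - rho A X\<bar> < \<epsilon> / 2}"
      by (intro measure_sample_law_ge[OF D(1)[OF nu(1)] n(2) _ G(1)]) simp_all
    then show ?thesis using G(2) by simp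
  qed
  show "\<exists>\<delta>>0. \<exists>n0. \<forall>\<nu>\<in>N. prohorov \<mu> \<nu> + \<bar>(\<integral>x. psi p x \<partial>\<mu>) - (\<integral>x. psi p x \<partial>\<nu>)\<bar> \<le> \<delta> \<longrightarrow>
      (\<forall>n\<ge>n0. n > 0 \<longrightarrow> prohorov (sample_law M A \<mu> n) (sample_law M A \<nu> n) \<le> \<epsilon>)"
  proof (intro exI[of _ \<delta>] exI[of _ n0] conjI del ballI impI allI)
    fix \<nu> n assume nu: "\<nu> \<in> N"
      and le: "prohorov \<mu> \<nu> + \<bar>(\<integral>x. psi p x \<partial>\<mu>) - (\<integral>x. psi p x \<partial>\<nu>)\<bar> \<le> \<delta>" and n: "n0 \<le> n" "0 < n"
    have "prohorov \<mu> \<nu> \<le> \<delta>" using le by linarith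
    then show "prohorov (sample_law M A \<mu> n) (sample_law M A \<nu> n) \<le> \<epsilon>"
      by (intro prohorov_concentrated[where c = "rho A X", OF _ _ eps] real_distribution_sample_law D(1) nu muN n conc prohorov_self_le mu del)
  qed
qed

end

section \<open>Necessity of the interior: a null sequence of bounded variables\<close>

context prob_space begin

lemma psi_law:
  assumes W: "W \<in> Linf M" and p: "1 \<le> p"
  shows "(\<integral>x. psi p x \<partial>distr M borel W) = (\<integral>\<omega>. \<bar>W \<omega>\<bar> powr p \<partial>M) / p"
    and "(\<integral>\<^sup>+x. ennreal (psi p x) \<partial>distr M borel W) = ennreal ((\<integral>\<omega>. \<bar>W \<omega>\<bar> powr p \<partial>M) / p)"
proof -
  note m = Linf_measurable[OF W]
  have pm: "psi p \<in> borel_measurable borel" unfolding psi_def[abs_def] by measurable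
  show "(\<integral>x. psi p x \<partial>distr M borel W) = (\<integral>\<omega>. \<bar>W \<omega>\<bar> powr p \<partial>M) / p"
    by (subst integral_distr[OF m pm]) (simp add: psi_def)
  have "(\<integral>\<^sup>+x. ennreal (psi p x) \<partial>distr M borel W) = (\<integral>\<^sup>+\<omega>. ennreal (psi p (W \<omega>)) \<partial>M)"
    by (rule nn_integral_distr[OF m]) (use pm in simp)
  also have "\<dots> = ennreal (\<integral>\<omega>. psi p (W \<omega>) \<partial>M)"
    using Linf_integrable_powr[OF W, of p] p by (intro nn_integral_eq_integral) (auto simp: psi_def)
  finally show "(\<integral>\<^sup>+x. ennreal (psi p x) \<partial>distr M borel W) = ennreal ((\<integral>\<omega>. \<bar>W \<omega>\<bar> powr p \<partial>M) / p)"
    by (simp add: psi_def)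
qed

text \<open>Finitely many of the laws are handled by boundedness, the others by their small moments.\<close>

lemma unif_p_integrating_null_sequence:
  assumes p: "1 \<le> p" and W: "\<And>k. W k \<in> Linf M"
    and null: "(\<lambda>k. \<integral>\<omega>. \<bar>W k \<omega>\<bar> powr p \<partial>M) \<longlonglongrightarrow> 0"
  shows "unif_p_integrating p (range (\<lambda>k. distr M borel (W k)))"
  unfolding unif_p_integrating_def
proof (rule tendsto_zero_ennreal)
  fix r :: real assume r: "0 < r"
  let ?T = "\<lambda>c \<nu>. \<integral>\<^sup>+ x. indicator {x. psi p x \<ge> c} x * ennreal (psi p x) \<partial>\<nu>"
  define r' where "r' = r / 2"
  have r': "0 < r'" "r' < r" using r by (auto simp: r'_def)
  obtain k0 where k0: "\<And>k. k \<ge> k0 \<Longrightarrow> (\<integral>\<omega>. \<bar>W k \<omega>\<bar> powr p \<partial>M) < r'"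
    using order_tendstoD(2)[OF null r'(1)] unfolding eventually_sequentially by blast
  have "\<exists>C. AE \<omega> in M. \<bar>W k \<omega>\<bar> \<le> C" for k using LinfE[OF W[of k]] by metis
  then obtain C where C: "\<And>k. AE \<omega> in M. \<bar>W k \<omega>\<bar> \<le> C k" by metis
  \<comment> \<open>Above this level the tail integrals of the first \<open>k0\<close> laws vanish,
    since \<open>psi p\<close> is bounded by one summand under each of them.\<close>
  define c0 where "c0 = (\<Sum>k<k0. \<bar>C k\<bar> powr p / p)"
  have T: "?T c (distr M borel (W k)) \<le> ennreal r'" if c: "c > c0" for c k
  proof (cases "k < k0")
    case True
    have "\<bar>C k\<bar> powr p / p \<le> c0" unfolding c0_def
      by (rule member_le_sum[of k "{..<k0}" "\<lambda>k. \<bar>C k\<bar> powr p / p"]) (use True p in simp_all)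
    then have Ck: "\<bar>C k\<bar> powr p / p < c" using c by simp
    have "?T c (distr M borel (W k)) = (\<integral>\<^sup>+\<omega>. indicator {x. psi p x \<ge> c} (W k \<omega>) * ennreal (psi p (W k \<omega>)) \<partial>M)"
      by (rule nn_integral_distr[OF Linf_measurable[OF W]]) (unfold psi_def, measurable)
    also have "\<dots> = (\<integral>\<^sup>+\<omega>. 0 \<partial>M)"
    proof (rule nn_integral_cong_AE)
      show "AE \<omega> in M. indicator {x. psi p x \<ge> c} (W k \<omega>) * ennreal (psi p (W k \<omega>)) = 0"
        using C[of k]
      proof eventually_elim
        case (elim \<omega>)
        then have "\<bar>W k \<omega>\<bar> powr p \<le> \<bar>C k\<bar> powr p" using p by (intro powr_mono2) auto
        then have "psi p (W k \<omega>) \<le> \<bar>C k\<bar> powr p / p" using p by (simp add: psi_def divide_right_mono)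
        then have "\<not> c \<le> psi p (W k \<omega>)" using Ck by linarith
        then show ?case by simp
      qed
    qed
    finally show ?thesis by simp
  next
    case False
    have "?T c (distr M borel (W k)) \<le> (\<integral>\<^sup>+x. ennreal (psi p x) \<partial>distr M borel (W k))"
      by (intro nn_integral_mono) (auto simp: indicator_def)
    also have "\<dots> = ennreal ((\<integral>\<omega>. \<bar>W k \<omega>\<bar> powr p \<partial>M) / p)" by (rule psi_law[OF W p])
    also have "\<dots> \<le> ennreal r'"
    proof (rule ennreal_leI)
      have "0 \<le> (\<integral>\<omega>. \<bar>W k \<omega>\<bar> powr p \<partial>M)" by (rule integral_nonneg_AE) simp
      then have "(\<integral>\<omega>. \<bar>W k \<omega>\<bar> powr p \<partial>M) / p \<le> (\<integral>\<omega>. \<bar>W k \<omega>\<bar> powr p \<partial>M) / 1"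
        using p by (intro divide_left_mono) auto
      then show "(\<integral>\<omega>. \<bar>W k \<omega>\<bar> powr p \<partial>M) / p \<le> r'" using k0[of k] False by simp
    qed
    finally show ?thesis .
  qed
  have "(SUP \<nu>\<in>range (\<lambda>k. distr M borel (W k)). ?T c \<nu>) < ennreal r" if "c > c0" for c
  proof -
    have "(SUP \<nu>\<in>range (\<lambda>k. distr M borel (W k)). ?T c \<nu>) \<le> ennreal r'"
      by (rule SUP_least) (use T[OF that] in blast)
    also have "\<dots> < ennreal r" using r' by (simp add: ennreal_less_iff)
    finally show ?thesis .
  qed
  then show "\<forall>\<^sub>F c in at_top. (SUP \<nu>\<in>range (\<lambda>k. distr M borel (W k)). ?T c \<nu>) < ennreal r"
    using eventually_gt_at_top[of c0] by (rule eventually_mono[rotated])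
qed

text \<open>Markov's inequality at level \<open>(e / 2) powr p\<close> concentrates \<open>W\<close>
  near 0, where the point mass sits as well.\<close>

lemma prohorov_zero_law_le:
  assumes W: "W \<in> Linf M" and p: "1 \<le> p" and e: "e > 0"
    and small: "(\<integral>\<omega>. \<bar>W \<omega>\<bar> powr p \<partial>M) \<le> e * (e / 2) powr p"
  shows "prohorov (distr M borel (\<lambda>_. 0)) (distr M borel W) \<le> e"
proof (rule prohorov_concentrated[OF _ _ e, of _ _ 0])
  note [measurable] = Linf_measurable[OF W]
  show "real_distribution (distr M borel (\<lambda>_. 0))" "real_distribution (distr M borel W)"
    by (rule real_distribution_distr, measurable)+
  show "1 - e \<le> measure (distr M borel (\<lambda>_. 0)) {y. \<bar>y - 0\<bar> < e / 2}"
    using e by (subst measure_distr) (simp_all add: prob_space)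
  have "prob {\<omega>\<in>space M. \<bar>W \<omega>\<bar> powr p \<ge> (e / 2) powr p} \<le> (\<integral>\<omega>. \<bar>W \<omega>\<bar> powr p \<partial>M) / (e / 2) powr p"
    by (rule integral_Markov_inequality_measure[OF _ sets.empty_sets])
       (use Linf_integrable_powr[OF W, of p] p e in auto)
  also have "\<dots> \<le> e" using small e by (simp add: divide_le_eq)
  also have "{\<omega>\<in>space M. \<bar>W \<omega>\<bar> powr p \<ge> (e / 2) powr p} = space M - {\<omega>\<in>space M. \<bar>W \<omega>\<bar> < e / 2}"
  proof -
    have "(e / 2) powr p \<le> \<bar>w\<bar> powr p \<longleftrightarrow> \<not> \<bar>w\<bar> < e / 2" for w
      using powr_less_mono2[of p "\<bar>w\<bar>" "e / 2"] powr_mono2[of p "e / 2" "\<bar>w\<bar>"] p e by linarith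
    then show ?thesis by auto
  qed
  finally have "1 - e \<le> prob {\<omega>\<in>space M. \<bar>W \<omega>\<bar> < e / 2}" by (subst (asm) prob_compl) auto
  then show "1 - e \<le> measure (distr M borel W) {y. \<bar>y - 0\<bar> < e / 2}"
    by (simp add: measure_distr vimage_def Int_def conj_commute)
qed

end

context convex_acceptance begin

text \<open>Samples from the point mass vanish almost surely on their first \<open>n\<close>
  coordinates; the Lipschitz bound with constant 0 identifies their risk with that of the zero
  sequence.\<close>

lemma sample_law_zero:
  assumes n: "n > 0"
  shows "measure (sample_law M A (distr M borel (\<lambda>_. 0)) n) {rho A (\<lambda>_. 0)} = 1"
proof -
  let ?Z = "distr M borel (\<lambda>_. 0 :: real)"
  have Z: "real_distribution ?Z" by (rule real_distribution_distr) simp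
  interpret Z: real_distribution ?Z by (rule Z)
  let ?P = "PiM {..<n} (\<lambda>_. ?Z)"
  interpret P: prob_space ?P by (rule prob_space_PiM) (rule Z.prob_space_axioms)
  note m = RA_empirical_measurable[OF Z n]
  have e0: "empirical n (\<lambda>_. 0) = distr M borel (\<lambda>_. 0)"
  proof (rule measure_eqI)
    fix S assume "S \<in> sets (empirical n (\<lambda>_. 0))"
    then have S: "S \<in> sets borel" by (simp add: empirical_def)
    show "emeasure (empirical n (\<lambda>_. 0)) S = emeasure ?Z S"
      using S emeasure_space_1 by (cases "0 \<in> S") (simp_all add: empirical_def emeasure_distr)
  qed (simp add: empirical_def)
  have "AE x in ?P. \<forall>i\<in>{..<n}. x i = 0"
  proof (subst AE_finite_all)
    have "AE y in ?Z. y = 0" by (subst AE_distr_iff) auto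
    then show "\<forall>i\<in>{..<n}. AE x in ?P. x i = 0"
      by (intro ballI AE_PiM_component[where P = "\<lambda>y. y = 0", OF Z.prob_space_axioms])
  qed simp
  then have "AE x in ?P. RA M A (empirical n x) = rho A (\<lambda>_. 0)"
  proof eventually_elim
    case (elim x)
    then have "\<bar>RA M A (empirical n x) - RA M A (empirical n (\<lambda>_. 0))\<bar> \<le> 0"
      by (intro RA_empirical_lipschitz[OF n]) simp
    then show ?case using RA_distr[OF Linf_const, of 0] by (simp add: e0)
  qed
  then have "P.prob ((\<lambda>x. RA M A (empirical n x)) -` {rho A (\<lambda>_. 0)} \<inter> space ?P) = 1"
    using m by (subst P.prob_eq_1) auto
  then show ?thesis unfolding sample_law_def by (subst measure_distr[OF m]) auto
qed

text \<open>Only a lower bound on the risk of the perturbed sample is called for, so lower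
  semicontinuity suffices; the sample from the point mass has risk exactly
  \<open>c0\<close>.\<close>

theorem p_robust_imp_interior:
  assumes p: "1 \<le> p" and rob: "p_robust M A p"
  shows "Lp_nonempty_interior M p (Clp M p A)"
proof (rule ccontr)
  assume neg: "\<not> ?thesis"
  define c0 where "c0 = rho A (\<lambda>_. 0)"
  have "\<exists>W\<in>Linf M. (\<integral>\<omega>. \<bar>W \<omega>\<bar> powr p \<partial>M) < 1 / real (Suc k) \<and> rho A W > c0 + 1" for k
    using rho_bound_imp_interior[OF p, of "1 / real (Suc k)" "c0 + 1"] neg by (force simp: not_le)
  then obtain W where W: "\<And>k. W k \<in> Linf M" "\<And>k. (\<integral>\<omega>. \<bar>W k \<omega>\<bar> powr p \<partial>M) < 1 / real (Suc k)"
    "\<And>k. rho A (W k) > c0 + 1" by metis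
  \<comment> \<open>The zero variable is put in front so that the point mass at 0 belongs to the set
    of laws being tested.\<close>
  define U where "U k = (case k of 0 \<Rightarrow> (\<lambda>_. 0) | Suc j \<Rightarrow> W j)" for k
  have U: "U k \<in> Linf M" for k by (cases k) (simp_all add: U_def W(1))
  have Wlim: "(\<lambda>k. \<integral>\<omega>. \<bar>W k \<omega>\<bar> powr p \<partial>M) \<longlonglongrightarrow> 0"
  proof (rule tendsto_sandwich[OF _ _ tendsto_const lim_inverse_n'])
    show "\<forall>\<^sub>F k in sequentially. 0 \<le> (\<integral>\<omega>. \<bar>W k \<omega>\<bar> powr p \<partial>M)" by (auto intro!: always_eventually integral_nonneg_AE)
    show "\<forall>\<^sub>F k in sequentially. (\<integral>\<omega>. \<bar>W k \<omega>\<bar> powr p \<partial>M) \<le> 1 / real k"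
      using eventually_gt_at_top[of 0]
    proof eventually_elim
      case (elim k)
      have "1 / real (Suc k) \<le> 1 / real k" using elim by (intro divide_left_mono) auto
      then show ?case using W(2)[of k] by linarith
    qed
  qed
  then have "(\<lambda>k. \<integral>\<omega>. \<bar>U (Suc k) \<omega>\<bar> powr p \<partial>M) \<longlonglongrightarrow> 0" by (simp add: U_def)
  then have "(\<lambda>k. \<integral>\<omega>. \<bar>U k \<omega>\<bar> powr p \<partial>M) \<longlonglongrightarrow> 0" by (rule LIMSEQ_imp_Suc)
  note UI = unif_p_integrating_null_sequence[OF p U this]
  define N where "N = range (\<lambda>k. distr M borel (U k))"
  have NL: "N \<subseteq> laws_inf M" using U by (auto simp: N_def laws_inf_def)
  note D = laws_infD[OF subsetD[OF NL]]
  define Z where "Z = distr M borel (\<lambda>_. 0 :: real)"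
  have "Z = distr M borel (U 0)" by (simp add: Z_def U_def)
  then have ZN: "Z \<in> N" unfolding N_def by blast
  have "(1/4::real) > 0" by simp
  with rob[unfolded p_robust_def, rule_format, OF conjI[OF NL UI[folded N_def]] ZN]
  obtain \<delta> n0 where del: "\<delta> > 0" and rb: "\<And>\<nu> n. \<nu> \<in> N \<Longrightarrow>
      prohorov Z \<nu> + \<bar>(\<integral>x. psi p x \<partial>Z) - (\<integral>x. psi p x \<partial>\<nu>)\<bar> \<le> \<delta> \<Longrightarrow> n \<ge> n0 \<Longrightarrow> n > 0 \<Longrightarrow>
      prohorov (sample_law M A Z n) (sample_law M A \<nu> n) \<le> 1/4"
    by meson
  \<comment> \<open>One half of \<delta> goes to the Prohorov distance, the other to the moment
    difference; the minimum below serves both.\<close>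
  define e where "e = \<delta> / 2"
  have e: "e > 0" "min e (e * (e / 2) powr p) > 0" using del by (auto simp: e_def)
  obtain k where k: "(\<integral>\<omega>. \<bar>W k \<omega>\<bar> powr p \<partial>M) < min e (e * (e / 2) powr p)"
    using order_tendstoD(2)[OF Wlim e(2)] by (meson eventually_happens' trivial_limit_sequentially)
  define \<nu> where "\<nu> = distr M borel (W k)"
  have "\<nu> = distr M borel (U (Suc k))" by (simp add: \<nu>_def U_def)
  then have nuN: "\<nu> \<in> N" unfolding N_def by blast
  note nu = D(1)[OF nuN]
  have "prohorov Z \<nu> \<le> e" unfolding Z_def \<nu>_def
    by (rule prohorov_zero_law_le[OF W(1) p e(1)]) (use k in simp)
  moreover have "\<bar>(\<integral>x. psi p x \<partial>Z) - (\<integral>x. psi p x \<partial>\<nu>)\<bar> \<le> e"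
  proof -
    have "(\<integral>x. psi p x \<partial>Z) = 0" unfolding Z_def using p by (subst psi_law[OF Linf_const p]) simp
    moreover have "(\<integral>x. psi p x \<partial>\<nu>) = (\<integral>\<omega>. \<bar>W k \<omega>\<bar> powr p \<partial>M) / p" unfolding \<nu>_def by (rule psi_law[OF W(1) p])
    moreover have I: "0 \<le> (\<integral>\<omega>. \<bar>W k \<omega>\<bar> powr p \<partial>M)" by (rule integral_nonneg_AE) simp
    moreover have "(\<integral>\<omega>. \<bar>W k \<omega>\<bar> powr p \<partial>M) / p \<le> (\<integral>\<omega>. \<bar>W k \<omega>\<bar> powr p \<partial>M) / 1"
      using p I by (intro divide_left_mono) auto
    ultimately show ?thesis using k p by (simp add: abs_le_iff)
  qed
  ultimately have near: "prohorov Z \<nu> + \<bar>(\<integral>x. psi p x \<partial>Z) - (\<integral>x. psi p x \<partial>\<nu>)\<bar> \<le> \<delta>"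
    by (simp add: e_def)
  from nonatomic_uniform[OF nonatomic]
  obtain V where V: "V \<in> measurable M Uni" "distr M Uni V = Uni" ..
  \<comment> \<open>A copy of \<open>W k\<close> driven by \<open>V\<close>, so that it is
    comonotone with the transported samples; its risk is the same by law invariance.\<close>
  define X where "X \<omega> = quantile \<nu> (V \<omega>)" for \<omega>
  obtain K where "AE x in \<nu>. \<bar>x\<bar> \<le> K" using D(2)[OF nuN] by blast
  note q = quantile_transform[OF nu this V]
  have X: "X \<in> Linf M" unfolding X_def[abs_def] by (rule q)
  have "rho A X = rho A (W k)"
    by (rule rho_law[OF X W(1)]) (use q(2) in \<open>simp add: X_def[abs_def] \<nu>_def\<close>)
  then have "c0 + 1 < rho A X" using W(3)[of k] by simp
  from rho_lower_semicontinuous[OF p X this] obtain d where d: "d > 0"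
    and lsc: "\<And>Y. Y \<in> Linf M \<Longrightarrow> (\<integral>\<omega>. \<bar>Y \<omega> - X \<omega>\<bar> powr p \<partial>M) < d \<Longrightarrow> c0 + 1 < rho A Y" by blast
  \<comment> \<open>The uniform law of large numbers is now centred at \<nu> and applied to samples
    from \<nu> itself.\<close>
  have "min d (1/4) > 0" using d by simp
  from empirical_quantile_close[OF p UI[folded N_def] nuN this D]
  obtain \<delta>1 n1 where del1: "\<delta>1 > 0" and close: "\<And>\<nu>' n. \<nu>' \<in> N \<Longrightarrow> prohorov \<nu> \<nu>' \<le> \<delta>1 \<Longrightarrow> n \<ge> n1 \<Longrightarrow> n > 0 \<Longrightarrow>
    (\<exists>G\<in>sets (PiM {..<n} (\<lambda>_. \<nu>')). measure (PiM {..<n} (\<lambda>_. \<nu>')) G \<ge> 1 - min d (1/4) \<and>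
      (\<forall>x\<in>G. (\<integral>u. \<bar>quantile (empirical n x) u - quantile \<nu> u\<bar> powr p \<partial>Uni) < min d (1/4)))"
    by blast
  define n where "n = Suc (max n0 n1)"
  have n: "n \<ge> n0" "n \<ge> n1" "n > 0" by (auto simp: n_def)
  obtain G where G: "G \<in> sets (PiM {..<n} (\<lambda>_. \<nu>))" "measure (PiM {..<n} (\<lambda>_. \<nu>)) G \<ge> 1 - min d (1/4)"
      "\<And>x. x \<in> G \<Longrightarrow> (\<integral>u. \<bar>quantile (empirical n x) u - quantile \<nu> u\<bar> powr p \<partial>Uni) < min d (1/4)"
    using close[OF nuN prohorov_self_le[OF nu del1] n(2,3)] by blast
  let ?S = "sample_law M A \<nu> n"
  have rS: "real_distribution ?S" by (rule real_distribution_sample_law[OF nu n(3)])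
  have rZ: "real_distribution (sample_law M A Z n)" by (rule real_distribution_sample_law[OF D(1)[OF ZN] n(3)])
  interpret S: real_distribution ?S by (rule rS)
  have "RA M A (empirical n x) \<in> {c0 + 1<..}" if "x \<in> G" for x
  proof -
    note Y = RA_empirical_quantile[OF V nu n(3), of x]
    show ?thesis using lsc[OF Y(1)] G(3)[OF that] Y(2) Y(3)[of p] by (simp add: X_def)
  qed
  then have "measure (PiM {..<n} (\<lambda>_. \<nu>)) G \<le> S.prob {c0 + 1<..}"
    by (intro measure_sample_law_ge[OF nu n(3) _ G(1)]) simp_all
  then have up: "S.prob {c0 + 1<..} \<ge> 3/4" using G(2) by simp
  have "prohorov (sample_law M A Z n) ?S < 1/2" using rb[OF nuN near n(1,3)] by simp
  from prohorov_lessD[OF rZ rS this] obtain s where s: "s > 0" "s < 1/2"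
    and B: "\<And>B. B \<in> sets borel \<Longrightarrow> measure (sample_law M A Z n) B \<le> S.prob {x. \<exists>y\<in>B. dist x y < s} + s" by blast
  \<comment> \<open>The unit mass at \<open>c0\<close> forces mass at least \<open>1 - s\<close>,
    above 1/2, within \<open>s\<close> of \<open>c0\<close>. At most 1/4 is left there, because mass
    at least 3/4 lies beyond \<open>c0 + 1\<close>.\<close>
  have "1 \<le> S.prob {x. \<exists>y\<in>{c0}. dist x y < s} + s"
    using B[of "{c0}"] sample_law_zero[OF n(3)] by (simp add: Z_def c0_def)
  moreover have "S.prob {x. \<exists>y\<in>{c0}. dist x y < s} \<le> S.prob (UNIV - {c0 + 1<..})"
    using s by (intro S.finite_measure_mono) (auto simp: dist_real_def)
  moreover have "S.prob (UNIV - {c0 + 1<..}) = 1 - S.prob {c0 + 1<..}"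
    using S.prob_compl[of "{c0 + 1<..}"] by simp
  ultimately show False using up s by linarith
qed

end

theorem theorem5p3:
  fixes M :: "'a measure" and A :: "('a \<Rightarrow> real) set" and p :: real
  assumes "prob_space M" and "nonatomic M"
    and "acceptance_set M A" and "convex_fset A" and "law_invariant M A"
    and "1 \<le> p"
  shows "(p_robust M A p \<longleftrightarrow> Lp_nonempty_interior M p (Clp M p A))
         \<and> Index_qr M A = 1 / Index_fin M A"
proof -
  interpret convex_acceptance M A
    by (intro convex_acceptance.intro convex_acceptance_axioms.intro assms)
  \<comment> \<open>Stated for every exponent, so that both indices are computed from the same
    set.\<close>
  have eq: "p_robust M A q \<longleftrightarrow> Lp_nonempty_interior M q (Clp M q A)" if "1 \<le> q" for q
    using interior_imp_p_robust[OF that] p_robust_imp_interior[OF that] by blast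
  have "{ereal q | q. 1 \<le> q \<and> p_robust M A q} =
      {ereal q | q. 1 \<le> q \<and> Lp_nonempty_interior M q (Clp M q A)}"
    using eq by blast
  then show ?thesis using eq[OF assms(6)] by (simp add: Index_qr_def Index_fin_def)
qed

end
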